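(* Let $v\in\mathrm{PE}$ be determined by the admissible matrices $\alpha$, $S_0$ (with $\det S_0\ne0$), $\gamma_1$, and $\gamma$. Then the transmission and reflection coefficients of the corresponding Dirac type system $$\frac{d}{dx}u(x,\lambda)=i(\lambda j+jV(x))u(x,\lambda)\quad(x\ge0)$$ are given by the formulas $$T_L(\lambda)=I_{m_1}-i\gamma_1^*S_0^{-1}(\lambda I_n-\theta)^{-1}\gamma_1,\qquad \theta=\alpha-i\gamma_1\gamma_1^*S_0^{-1},$$ $$R_L(\lambda)=-i\gamma^*S_0^{-1}(\lambda I_n-\theta)^{-1}\gamma_1,$$ $$T_R(\lambda)=I_{m_2}-i\gamma^*S_0^{-1}(\lambda I_n-\theta)^{-1}(I_n-S_0\varkappa_R)\gamma,$$ $$R_R(\lambda)=-i\gamma_1^*S_0^{-1}(\lambda I_n-\theta)^{-1}(I_n-S_0\varkappa_R)\gamma-i\gamma_1^*(\lambda I_n-\alpha^* )^{-1}\varkappa_R\gamma .$$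
   Context: Here $m=m_1+m_2$, $j=\begin{bmatrix} I_{m_1} & 0 \\ 0 & -I_{m_2} \end{bmatrix}$, $V=\begin{bmatrix} 0 & v \\ v^* & 0 \end{bmatrix}$, and $v$ is an $m_1\times m_2$ matrix function. A set of parameter matrices $\alpha$ ($n\times n$), $S_0=S_0^*$ ($n\times n$), $\gamma_1$ ($n\times m_1$), $\gamma$ ($n\times m_2$) is admissible if $$\alpha S_0-S_0\alpha^*=i(\gamma_1\gamma_1^*-\gamma\gamma^* ),\quad \sigma(\alpha)\subset\overline{\mathbb{C}}_-,\quad \mathrm{span}\bigcup_{l=0}^{n-1}\mathrm{Im}\,\alpha^l\gamma_1=\mathbb{C}^n,\quad \mathrm{span}\bigcup_{l=0}^{n-1}\mathrm{Im}\,\alpha^l\gamma=\mathbb{C}^n,$$ where $\mathrm{Im}$ denotes image and $\overline{\mathbb{C}}_-$ is the closed lower half-plane. Put $$\Lambda(x)=[\,e^{-ix\alpha}\gamma_1\ \ \ e^{ix\alpha}\gamma\,],\qquad S(x)=S_0+\int_0^x\Lambda(t)\Lambda(t)^*\,dt .$$ The potential determined by the admissible set is $$v(x)=-2i\gamma_1^*e^{ix\alpha^*}S(x)^{-1}e^{ix\alpha}\gamma ,$$ and $\mathrm{PE}$ is the class of all such potentials. $S_0$ is not assumed positive, so $v$ may have singularities on the semi-axis (zeros of $\det S(x)$); solutions of the system are understood as solutions meromorphic in $x$. One has $S(x)>0$ for all sufficiently large $x$, and the limit $$\varkappa_R=\lim_{x\to\infty}\bigl(e^{-ix\alpha}S(x)e^{ix\alpha^*}\bigr)^{-1}$$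 exists. For $\lambda\in\mathbb{R}$, the $m\times m_1$ solution $Y$ and the $m\times m_2$ solution $Z$ are determined by $$Y(x,\lambda)=e^{ix\lambda}\begin{bmatrix} I_{m_1} \\ 0 \end{bmatrix}+o(1)\ (x\to\infty),\qquad Z(0,\lambda)=\begin{bmatrix} 0 \\ I_{m_2} \end{bmatrix}.$$ Write $Y=\begin{bmatrix} Y_1 \\ Y_2 \end{bmatrix}$ and $Z=\begin{bmatrix} Z_1 \\ Z_2 \end{bmatrix}$ with $Y_1$ of size $m_1\times m_1$, $Y_2$ of size $m_2\times m_1$, $Z_1$ of size $m_1\times m_2$, $Z_2$ of size $m_2\times m_2$. The left and right transmission coefficients $T_L,T_R$ and the left and right reflection coefficients $R_L,R_R$ are $$T_L(\lambda)=Y_1(0,\lambda)^{-1},\qquad R_L(\lambda)=Y_2(0,\lambda)Y_1(0,\lambda)^{-1},$$ $$R_R(\lambda)=\Bigl(\lim_{x\to\infty}e^{-ix\lambda}Z_1(x,\lambda)\Bigr)\Bigl(\lim_{x\to\infty}e^{ix\lambda}Z_2(x,\lambda)\Bigr)^{-1},\qquad T_R(\lambda)=\Bigl(\lim_{x\to\infty}e^{ix\lambda}Z_2(x,\lambda)\Bigr)^{-1}.$$ The formulas for these coefficients are understood as identities of rational functions of $\lambda$ (holding for all real $\lambda$ with possibly finitely many exceptions). *)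

theory Defs
  imports "HOL-Complex_Analysis.Complex_Analysis"
begin

unbundle no fps_syntax

section \<open>Complex matrices\<close>

text \<open>A \<open>p \<times> q\<close> matrix has type \<open>complex^'q^'p\<close>. Block matrices with \<open>m = m1 + m2\<close> rows or
  columns are indexed by the sum type \<open>'m1 + 'm2\<close>.\<close>

definition cscale :: "complex \<Rightarrow> complex^'q^'p \<Rightarrow> complex^'q^'p"  (infixr \<open>*\<^sub>C\<close> 75)
  where "c *\<^sub>C A = (\<chi> i k. c * A $ i $ k)"

definition adj :: "complex^'q^'p \<Rightarrow> complex^'p^'q"
  where "adj A = (\<chi> i k. cnj (A $ k $ i))"

primrec mpow :: "complex^'n^'n \<Rightarrow> nat \<Rightarrow> complex^'n^'n" where
  "mpow A 0 = mat 1"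
| "mpow A (Suc k) = A ** mpow A k"

definition mexp :: "complex^'n^'n \<Rightarrow> complex^'n^'n"
  where "mexp A = (\<Sum>k. (1 / fact k) *\<^sub>R mpow A k)"

definition mspectrum :: "complex^'n^'n \<Rightarrow> complex set"
  where "mspectrum A = {z. \<not> invertible (mat z - A)}"

definition hcat :: "complex^'m1^'p \<Rightarrow> complex^'m2^'p \<Rightarrow> complex^('m1::finite + 'm2::finite)^'p"
  where "hcat A B = (\<chi> i k. case k of Inl a \<Rightarrow> A $ i $ a | Inr b \<Rightarrow> B $ i $ b)"

definition vcat :: "complex^'q^'m1 \<Rightarrow> complex^'q^'m2 \<Rightarrow> complex^'q^('m1::finite + 'm2::finite)"
  where "vcat A B = (\<chi> i. case i of Inl a \<Rightarrow> A $ a | Inr b \<Rightarrow> B $ b)"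

definition upper :: "complex^'q^('m1::finite + 'm2::finite) \<Rightarrow> complex^'q^'m1"
  where "upper A = (\<chi> a. A $ Inl a)"

definition lower :: "complex^'q^('m1::finite + 'm2::finite) \<Rightarrow> complex^'q^'m2"
  where "lower A = (\<chi> b. A $ Inr b)"


section \<open>Pseudo-exponential potentials\<close>

text \<open>The linear span below is the complex one (over \<open>*s\<close>).\<close>

definition admissible ::
    "complex^'n^'n \<Rightarrow> complex^'n^'n \<Rightarrow> complex^'m1^'n \<Rightarrow> complex^'m2^'n \<Rightarrow> bool"
  where "admissible \<alpha> S\<^sub>0 \<gamma>\<^sub>1 \<gamma> \<longleftrightarrow>
      adj S\<^sub>0 = S\<^sub>0 \<and>
      \<alpha> ** S\<^sub>0 - S\<^sub>0 ** adj \<alpha> = \<i> *\<^sub>C (\<gamma>\<^sub>1 ** adj \<gamma>\<^sub>1 - \<gamma> ** adj \<gamma>) \<and>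
      mspectrum \<alpha> \<subseteq> {z. Im z \<le> 0} \<and>
      vec.span (\<Union>l<CARD('n). range (\<lambda>y. (mpow \<alpha> l ** \<gamma>\<^sub>1) *v y)) = UNIV \<and>
      vec.span (\<Union>l<CARD('n). range (\<lambda>y. (mpow \<alpha> l ** \<gamma>) *v y)) = UNIV"

definition Lambda_mat ::
    "complex^'n^'n \<Rightarrow> complex^'m1^'n \<Rightarrow> complex^'m2^'n \<Rightarrow> real \<Rightarrow> complex^('m1::finite + 'm2::finite)^'n"
  where "Lambda_mat \<alpha> \<gamma>\<^sub>1 \<gamma> x =
      hcat (mexp ((- \<i> * complex_of_real x) *\<^sub>C \<alpha>) ** \<gamma>\<^sub>1) (mexp ((\<i> * complex_of_real x) *\<^sub>C \<alpha>) ** \<gamma>)"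

definition S_mat ::
    "complex^'n^'n \<Rightarrow> complex^'n^'n \<Rightarrow> complex^'m1^'n \<Rightarrow> complex^'m2^'n \<Rightarrow> real \<Rightarrow> complex^'n^'n"
  where "S_mat \<alpha> S\<^sub>0 \<gamma>\<^sub>1 \<gamma> x =
      S\<^sub>0 + integral {0..x} (\<lambda>t. Lambda_mat \<alpha> \<gamma>\<^sub>1 \<gamma> t ** adj (Lambda_mat \<alpha> \<gamma>\<^sub>1 \<gamma> t))"

definition pe_potential ::
    "complex^'n^'n \<Rightarrow> complex^'n^'n \<Rightarrow> complex^'m1^'n \<Rightarrow> complex^'m2^'n \<Rightarrow> real \<Rightarrow> complex^'m2^'m1"
  where "pe_potential \<alpha> S\<^sub>0 \<gamma>\<^sub>1 \<gamma> x =
      (- 2 * \<i>) *\<^sub>C (adj \<gamma>\<^sub>1 ** mexp ((\<i> * complex_of_real x) *\<^sub>C adj \<alpha>)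
        ** matrix_inv (S_mat \<alpha> S\<^sub>0 \<gamma>\<^sub>1 \<gamma> x) ** mexp ((\<i> * complex_of_real x) *\<^sub>C \<alpha>) ** \<gamma>)"

text \<open>The points of the semi-axis at which the formula for the potential makes sense; outside of
  this set \<^const>\<open>matrix_inv\<close> is unspecified and the value of \<^const>\<open>pe_potential\<close> is irrelevant.\<close>

definition pe_domain ::
    "complex^'n^'n \<Rightarrow> complex^'n^'n \<Rightarrow> complex^'m1^'n \<Rightarrow> complex^'m2^'n \<Rightarrow> real set"
  where "pe_domain \<alpha> S\<^sub>0 \<gamma>\<^sub>1 \<gamma> = {x. 0 \<le> x \<and> det (S_mat \<alpha> S\<^sub>0 \<gamma>\<^sub>1 \<gamma> x) \<noteq> 0}"

definition kappa_R ::
    "complex^'n^'n \<Rightarrow> complex^'n^'n \<Rightarrow> complex^'m1^'n \<Rightarrow> complex^'m2^'n \<Rightarrow> complex^'n^'n"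
  where "kappa_R \<alpha> S\<^sub>0 \<gamma>\<^sub>1 \<gamma> =
      Lim at_top (\<lambda>x. matrix_inv (mexp ((- \<i> * complex_of_real x) *\<^sub>C \<alpha>) ** S_mat \<alpha> S\<^sub>0 \<gamma>\<^sub>1 \<gamma> x
        ** mexp ((\<i> * complex_of_real x) *\<^sub>C adj \<alpha>)))"


section \<open>Dirac type systems and their scattering coefficients\<close>

definition j_mat :: "complex^('m1::finite + 'm2::finite)^('m1::finite + 'm2::finite)"
  where "j_mat = vcat (hcat (mat 1) 0) (hcat 0 (- mat 1))"

definition V_mat :: "complex^'m2^'m1 \<Rightarrow> complex^('m1::finite + 'm2::finite)^('m1::finite + 'm2::finite)"
  where "V_mat w = vcat (hcat 0 w) (hcat (adj w) 0)"

text \<open>The spectral parameter is written \<open>\<mu>\<close>.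

  Solutions meromorphic in \<open>x\<close>: \<open>u\<close> is the restriction to the semi-axis of a function that is
  meromorphic in a neighbourhood of it, and the differential equation holds at all points of \<open>D\<close>,
  the set where the potential \<open>v\<close> is defined. The continuation of a solution across the
  singularities of \<open>v\<close> is thereby determined. If \<open>0 \<in> D\<close>, the derivative at \<open>0\<close> is one-sided.\<close>

definition dirac_solution ::
    "real set \<Rightarrow> (real \<Rightarrow> complex^'m2^'m1) \<Rightarrow> real \<Rightarrow> (real \<Rightarrow> complex^'q^('m1::finite + 'm2::finite)) \<Rightarrow> bool"
  where "dirac_solution D v \<mu> u \<longleftrightarrow>
      (\<exists>U. (\<forall>i k. (\<lambda>z. U z $ i $ k) meromorphic_on (complex_of_real ` {0..})) \<and>
           (\<forall>x\<ge>0. u x = U (complex_of_real x))) \<and>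
      (\<forall>x\<in>D. (u has_vector_derivative
          (\<i> *\<^sub>C (complex_of_real \<mu> *\<^sub>C j_mat + j_mat ** V_mat (v x))) ** u x) (at x within {0..}))"

definition solution_Y ::
    "real set \<Rightarrow> (real \<Rightarrow> complex^'m2^'m1) \<Rightarrow> real \<Rightarrow> (real \<Rightarrow> complex^'m1^('m1::finite + 'm2::finite)) \<Rightarrow> bool"
  where "solution_Y D v \<mu> Y \<longleftrightarrow> dirac_solution D v \<mu> Y \<and>
      ((\<lambda>x. Y x - exp (\<i> * complex_of_real x * complex_of_real \<mu>) *\<^sub>C vcat (mat 1) 0) \<longlongrightarrow> 0) at_top"

definition solution_Z ::
    "real set \<Rightarrow> (real \<Rightarrow> complex^'m2^'m1) \<Rightarrow> real \<Rightarrow> (real \<Rightarrow> complex^'m2^('m1::finite + 'm2::finite)) \<Rightarrow> bool"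
  where "solution_Z D v \<mu> Z \<longleftrightarrow> dirac_solution D v \<mu> Z \<and> Z 0 = vcat 0 (mat 1)"

text \<open>\<open>is_T_L D v \<mu> T\<close> says that the left transmission coefficient at \<open>\<mu>\<close> is well defined and equals
  \<open>T\<close>: the solution \<open>Y\<close> exists, the inverse in the definition exists, and the value is \<open>T\<close>, for
  every choice of \<open>Y\<close>. Similarly for the other coefficients, including existence of the limits.\<close>

definition is_T_L ::
    "real set \<Rightarrow> (real \<Rightarrow> complex^'m2^'m1) \<Rightarrow> real \<Rightarrow> complex^'m1^'m1 \<Rightarrow> bool"
  where "is_T_L D v \<mu> T \<longleftrightarrow>
      (\<exists>Y. solution_Y D v \<mu> Y) \<and>
      (\<forall>Y. solution_Y D v \<mu> Y \<longrightarrow>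
        invertible (upper (Y 0)) \<and> T = matrix_inv (upper (Y 0)))"

definition is_R_L ::
    "real set \<Rightarrow> (real \<Rightarrow> complex^'m2^'m1) \<Rightarrow> real \<Rightarrow> complex^'m1^'m2 \<Rightarrow> bool"
  where "is_R_L D v \<mu> R \<longleftrightarrow>
      (\<exists>Y. solution_Y D v \<mu> Y) \<and>
      (\<forall>Y. solution_Y D v \<mu> Y \<longrightarrow>
        invertible (upper (Y 0)) \<and> R = lower (Y 0) ** matrix_inv (upper (Y 0)))"

definition is_T_R ::
    "real set \<Rightarrow> (real \<Rightarrow> complex^'m2^'m1) \<Rightarrow> real \<Rightarrow> complex^'m2^'m2 \<Rightarrow> bool"
  where "is_T_R D v \<mu> T \<longleftrightarrow>
      (\<exists>Z. solution_Z D v \<mu> Z) \<and>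
      (\<forall>Z. solution_Z D v \<mu> Z \<longrightarrow>
        (\<exists>B. ((\<lambda>x. exp (\<i> * complex_of_real x * complex_of_real \<mu>) *\<^sub>C lower (Z x)) \<longlongrightarrow> B) at_top \<and>
          invertible B \<and> T = matrix_inv B))"

definition is_R_R ::
    "real set \<Rightarrow> (real \<Rightarrow> complex^'m2^'m1) \<Rightarrow> real \<Rightarrow> complex^'m2^'m1 \<Rightarrow> bool"
  where "is_R_R D v \<mu> R \<longleftrightarrow>
      (\<exists>Z. solution_Z D v \<mu> Z) \<and>
      (\<forall>Z. solution_Z D v \<mu> Z \<longrightarrow>
        (\<exists>A B. ((\<lambda>x. exp (- \<i> * complex_of_real x * complex_of_real \<mu>) *\<^sub>C upper (Z x)) \<longlongrightarrow> A) at_top \<and>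
          ((\<lambda>x. exp (\<i> * complex_of_real x * complex_of_real \<mu>) *\<^sub>C lower (Z x)) \<longlongrightarrow> B) at_top \<and>
          invertible B \<and> R = A ** matrix_inv B))"

end

theory Submission
  imports Defs
begin

text \<open>
  The potential is obtained from the zero potential by a Darboux transformation. Let \<open>w\<close> be the
  transfer function \<open>1 + \<i> j \<Lambda>(x)\<^sup>* S(x)\<^sup>-\<^sup>1 (\<mu> - \<alpha>)\<^sup>-\<^sup>1 \<Lambda>(x)\<close>. The identity
  \<open>\<alpha> S - S \<alpha>\<^sup>* = \<i> \<Lambda> j \<Lambda>\<^sup>*\<close>, which holds at \<open>0\<close> by admissibility and propagates to all \<open>x\<close>, implies that
  \<open>\<Phi>(x) = w(x) exp(\<i> \<mu> x j)\<close> solves the Dirac system (\<open>w_deriv\<close>), and that \<open>w\<^sup>* j w = j\<close> for real \<open>\<mu>\<close>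
  (\<open>w_j_unitary\<close>). Consequently \<open>\<Phi>\<^sup>* j u\<close> is constant for each solution \<open>u\<close>, on both sides of every
  singularity with the same value because everything is meromorphic in \<open>x\<close>; so each solution is
  \<open>\<Phi>\<close> times a constant matrix (\<open>dirac_solution_eq_Phi\<close>).

  What remains is the behaviour of \<open>w\<close> at infinity. Its blocks contain the inverses of
  \<open>P = exp(\<i> x \<alpha>) S exp(- \<i> x \<alpha>\<^sup>*)\<close> and \<open>Q = exp(- \<i> x \<alpha>) S exp(\<i> x \<alpha>\<^sup>*)\<close>, and a mixed matrix \<open>M\<close> with
  \<open>M P M\<^sup>* = Q\<^sup>-\<^sup>1\<close>. Both \<open>P\<close> and \<open>Q\<close> are increasing. The quadratic form of \<open>P\<close> tends to infinity
  uniformly on the unit sphere (\<open>P_form_uniform_growth\<close>): the directions in which it stays bounded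
  form an \<open>\<alpha>\<^sup>*\<close>-invariant subspace, an eigenvector in it would be unobservable through \<open>\<gamma>\<^sup>*\<close> since the
  eigenvalues of \<open>\<alpha>\<^sup>*\<close> lie in the closed upper half-plane, and controllability excludes that.
  Hence \<open>P\<^sup>-\<^sup>1\<close> tends to \<open>0\<close>, the inverse of \<open>Q\<close> is eventually nonnegative and decreasing and so
  converges to \<open>\<kappa>\<^sub>R\<close>, and \<open>M\<close> tends to \<open>0\<close>. The limit of \<open>w\<close> is block diagonal with the blocks \<open>1\<close> and
  \<open>1 - \<i> \<gamma>\<^sup>* \<kappa>\<^sub>R (\<mu> - \<alpha>)\<^sup>-\<^sup>1 \<gamma>\<close>.

  It follows that \<open>Y = \<Phi> [1; 0]\<close> and \<open>Z = \<Phi> w(0)\<^sup>-\<^sup>1 [0; 1]\<close>, so all four coefficients are products and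
  inverses of transfer functions. They are brought into the stated form by the resolvent identity
  (\<open>state_space_inverse\<close>), by the similarity \<open>S\<^sub>0\<^sup>-\<^sup>1 \<theta> S\<^sub>0 = \<alpha>\<^sup>* - \<i> S\<^sub>0\<^sup>-\<^sup>1 \<gamma> \<gamma>\<^sup>*\<close>, and by the Riccati equation
  \<open>\<kappa>\<^sub>R \<alpha> - \<alpha>\<^sup>* \<kappa>\<^sub>R = - \<i> \<kappa>\<^sub>R \<gamma> \<gamma>\<^sup>* \<kappa>\<^sub>R\<close> (\<open>kappa_identity\<close>). The exceptional \<open>\<mu>\<close> are the real
  eigenvalues of \<open>\<alpha>\<close> and \<open>\<theta>\<close>.
\<close>

section \<open>Matrix algebra\<close>

lemma cscale_nth [simp]: "(c *\<^sub>C A) $ i $ k = c * A $ i $ k"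
  by (simp add: cscale_def)

lemma adj_nth [simp]: "adj A $ i $ k = cnj (A $ k $ i)"
  by (simp add: adj_def)

lemma scaleR_entry: "(r *\<^sub>R A) $ i $ k = complex_of_real r * A $ i $ k"
  by (simp only: vector_scaleR_component scaleR_conv_of_real[where 'a = complex])

lemma matrix_mult_nth: "(A ** B) $ i $ k = (\<Sum>l\<in>UNIV. A $ i $ l * B $ l $ k)"
  by (simp add: matrix_matrix_mult_def)

lemma matrix_vector_nth: "(A *v x) $ i = (\<Sum>l\<in>UNIV. A $ i $ l * x $ l)"
  by (simp add: matrix_vector_mult_def)

lemma cscale_mult_left [simp]: "(c *\<^sub>C A) ** B = c *\<^sub>C (A ** B)"
  by (simp add: vec_eq_iff matrix_mult_nth sum_distrib_left mult.assoc)

lemma cscale_mult_right [simp]: "A ** (c *\<^sub>C B) = c *\<^sub>C (A ** B)"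
  by (simp add: vec_eq_iff matrix_mult_nth sum_distrib_left mult.left_commute)

lemma cscale_vector: "(c *\<^sub>C A) *v x = c *s (A *v x)"
  by (simp add: vec_eq_iff matrix_vector_nth sum_distrib_left mult.assoc)

lemma cscale_cscale [simp]: "c *\<^sub>C d *\<^sub>C A = (c * d) *\<^sub>C A"
  by (simp add: vec_eq_iff mult.assoc)

lemma cscale_add_right: "c *\<^sub>C (A + B) = c *\<^sub>C A + c *\<^sub>C B"
  by (simp add: vec_eq_iff algebra_simps)

lemma cscale_diff_right: "c *\<^sub>C (A - B) = c *\<^sub>C A - c *\<^sub>C B"
  by (simp add: vec_eq_iff algebra_simps)

lemma cscale_minus_right [simp]: "c *\<^sub>C (- A) = (- c) *\<^sub>C A"
  by (simp add: vec_eq_iff)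

lemma cscale_minus_left: "(- c) *\<^sub>C A = - (c *\<^sub>C A)"
  by (simp add: vec_eq_iff)

lemma cscale_one [simp]: "1 *\<^sub>C A = A"
  by (simp add: vec_eq_iff)

lemma cscale_zero [simp]: "0 *\<^sub>C A = 0" "c *\<^sub>C 0 = 0"
  by (simp_all add: vec_eq_iff)

lemma cscale_add_left: "(c + d) *\<^sub>C A = c *\<^sub>C A + d *\<^sub>C A"
  by (simp add: vec_eq_iff algebra_simps)

lemma mult_minus_matrix [simp]:
  fixes A :: "complex^'q^'p" and B :: "complex^'r^'q"
  shows "(- A) ** B = - (A ** B)" "A ** (- B) = - (A ** B)"
  by (simp_all add: vec_eq_iff matrix_mult_nth sum_negf)

lemma mult_diff_matrix:
  fixes A C :: "complex^'q^'p" and B D :: "complex^'r^'q"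
  shows "(A - C) ** B = A ** B - C ** B" "A ** (B - D) = A ** B - A ** D"
  by (simp_all add: vec_eq_iff matrix_mult_nth algebra_simps sum_subtractf)

lemma matrix_add_rdistrib:
  fixes A C :: "complex^'q^'p" and B :: "complex^'r^'q"
  shows "(A + C) ** B = A ** B + C ** B"
  by (simp add: vec_eq_iff matrix_mult_nth algebra_simps sum.distrib)

lemma mult_zero_matrix [simp]:
  fixes A :: "complex^'q^'p"
  shows "(0 :: complex^'p^'r) ** A = 0" "A ** (0 :: complex^'r^'q) = 0"
  by (simp_all add: vec_eq_iff matrix_mult_nth)

lemma mat_eq_cscale: "mat c = c *\<^sub>C mat 1"
  by (simp add: vec_eq_iff mat_def)

lemma adj_mult: "adj (A ** B) = adj B ** adj A"
  by (simp add: vec_eq_iff matrix_mult_nth mult.commute)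

lemma adj_adj [simp]: "adj (adj A) = A"
  by (simp add: vec_eq_iff)

lemma adj_add: "adj (A + B) = adj A + adj B"
  by (simp add: vec_eq_iff)

lemma adj_diff: "adj (A - B) = adj A - adj B"
  by (simp add: vec_eq_iff)

lemma adj_minus: "adj (- A) = - adj A"
  by (simp add: vec_eq_iff)

lemma adj_cscale [simp]: "adj (c *\<^sub>C A) = cnj c *\<^sub>C adj A"
  by (simp add: vec_eq_iff)

lemma adj_scaleR: "adj (r *\<^sub>R A) = r *\<^sub>R adj A"
  by (simp add: vec_eq_iff)

lemma adj_mat [simp]: "adj (mat c) = mat (cnj c)"
  by (simp add: vec_eq_iff mat_def)

lemma adj_zero [simp]: "adj 0 = 0"
  by (simp add: vec_eq_iff)

lemmas matrix_algebra = matrix_add_ldistrib matrix_add_rdistrib mult_diff_matrix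
  cscale_add_right cscale_diff_right matrix_mul_assoc [symmetric]

lemma matrix_inv_mult:
  fixes A :: "complex^'n^'n"
  assumes "invertible A"
  shows "A ** matrix_inv A = mat 1" "matrix_inv A ** A = mat 1"
proof -
  have "A ** matrix_inv A = mat 1 \<and> matrix_inv A ** A = mat 1"
    using assms unfolding invertible_def matrix_inv_def by (rule someI_ex)
  then show "A ** matrix_inv A = mat 1" "matrix_inv A ** A = mat 1" by auto
qed

lemma right_inverse_imp_left_inverse:
  fixes A B :: "complex^'n^'n"
  shows "A ** B = mat 1 \<Longrightarrow> B ** A = mat 1"
  using matrix_left_right_inverse by blast

lemma left_inverse_unique:
  fixes A B C :: "complex^'n^'n"
  assumes "B ** A = mat 1" "A ** C = mat 1"
  shows "B = C"
  by (metis assms matrix_mul_assoc matrix_mul_lid matrix_mul_rid)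

lemma matrix_inv_eqI:
  fixes A B :: "complex^'n^'n"
  assumes "A ** B = mat 1"
  shows "matrix_inv A = B" and "invertible A"
proof -
  show inv: "invertible A"
    using assms right_inverse_imp_left_inverse[OF assms] unfolding invertible_def by blast
  show "matrix_inv A = B"
    using left_inverse_unique[OF matrix_inv_mult(2)[OF inv] assms] .
qed

section \<open>Limits and derivatives of matrix functions\<close>

lemma bounded_bilinear_matrix_mult:
  "bounded_bilinear (\<lambda>(A :: complex^'q^'p) (B :: complex^'r^'q). A ** B)"
  unfolding bilinear_conv_bounded_bilinear [symmetric] bilinear_def
  by (auto intro!: linearI simp: vec_eq_iff matrix_mult_nth algebra_simps sum.distrib
      scaleR_sum_right)

lemma bounded_bilinear_matrix_vector_mult:
  "bounded_bilinear (\<lambda>(A :: complex^'q^'p) (x :: complex^'q). A *v x)"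
  unfolding bilinear_conv_bounded_bilinear [symmetric] bilinear_def
  by (auto intro!: linearI simp: vec_eq_iff matrix_vector_nth algebra_simps sum.distrib
      scaleR_sum_right)

lemma bounded_bilinear_cscale:
  "bounded_bilinear (\<lambda>(c :: complex) (A :: complex^'q^'p). c *\<^sub>C A)"
  unfolding bilinear_conv_bounded_bilinear [symmetric] bilinear_def
  by (auto intro!: linearI simp: vec_eq_iff algebra_simps)

lemma bounded_linear_adj: "bounded_linear (adj :: complex^'q^'p \<Rightarrow> complex^'p^'q)"
  unfolding linear_conv_bounded_linear [symmetric]
  by (auto intro!: linearI simp: vec_eq_iff)

lemma bounded_linear_entry: "bounded_linear (\<lambda>A :: complex^'q^'p. A $ i $ k)"
  unfolding linear_conv_bounded_linear [symmetric]
  by (auto intro!: linearI)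

lemmas has_vector_derivative_matrix_mult =
  bounded_bilinear.has_vector_derivative [OF bounded_bilinear_matrix_mult]
lemmas has_vector_derivative_cscale =
  bounded_linear.has_vector_derivative
    [OF bounded_bilinear.bounded_linear_right [OF bounded_bilinear_cscale]]
lemmas has_vector_derivative_adj =
  bounded_linear.has_vector_derivative [OF bounded_linear_adj]

lemmas tendsto_matrix_mult [tendsto_intros] =
  bounded_bilinear.tendsto [OF bounded_bilinear_matrix_mult]
lemmas tendsto_cscale [tendsto_intros] = bounded_bilinear.tendsto [OF bounded_bilinear_cscale]
lemmas tendsto_adj [tendsto_intros] = bounded_linear.tendsto [OF bounded_linear_adj]

lemma tendsto_matrixI:
  fixes f :: "'a \<Rightarrow> complex^'q^'p"
  assumes "\<And>i k. ((\<lambda>x. f x $ i $ k) \<longlongrightarrow> L $ i $ k) F"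
  shows "(f \<longlongrightarrow> L) F"
  by (intro vec_tendstoI assms)

lemma has_vector_derivative_matrixI:
  fixes f :: "real \<Rightarrow> complex^'q^'p"
  assumes "\<And>i k. ((\<lambda>x. f x $ i $ k) has_vector_derivative f' $ i $ k) (at x within T)"
  shows "(f has_vector_derivative f') (at x within T)"
  unfolding has_vector_derivative_def has_derivative_within
proof (intro conjI tendsto_matrixI)
  show "bounded_linear (\<lambda>h. h *\<^sub>R f')" by (rule bounded_linear_scaleR_left)
  fix i k
  show "((\<lambda>y. ((1 / norm (y - x)) *\<^sub>R (f y - (f x + (y - x) *\<^sub>R f'))) $ i $ k)
      \<longlongrightarrow> 0 $ i $ k) (at x within T)"
    using assms[of i k] unfolding has_vector_derivative_def has_derivative_within by simp
qed

lemma matrix_sumsI: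
  fixes f :: "nat \<Rightarrow> complex^'q^'p"
  assumes "\<And>i k. (\<lambda>n. f n $ i $ k) sums (s $ i $ k)"
  shows "f sums s"
  unfolding sums_def using assms by (intro tendsto_matrixI) (simp add: sums_def)

section \<open>The matrix exponential\<close>

text \<open>A common geometric bound for all entries of the powers makes each entry of the exponential an
  entire power series, so that it can be differentiated term by term.\<close>

lemma norm_mpow_entry_le:
  fixes A :: "complex^'n^'n"
  shows "norm (mpow A k $ i $ j) \<le> (\<Sum>a\<in>UNIV. \<Sum>b\<in>UNIV. norm (A $ a $ b)) ^ k"
proof (induction k arbitrary: i j)
  case 0
  show ?case by (simp add: mat_def)
next
  case (Suc k)
  let ?K = "\<Sum>a\<in>UNIV. \<Sum>b\<in>UNIV. norm (A $ a $ b)"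
  have "norm (mpow A (Suc k) $ i $ j) \<le> (\<Sum>l\<in>UNIV. norm (A $ i $ l) * norm (mpow A k $ l $ j))"
    by (simp add: matrix_mult_nth norm_mult [symmetric] norm_sum)
  also have "\<dots> \<le> (\<Sum>l\<in>UNIV. norm (A $ i $ l) * ?K ^ k)"
    by (intro sum_mono mult_left_mono Suc) auto
  also have "\<dots> = (\<Sum>l\<in>UNIV. norm (A $ i $ l)) * ?K ^ k"
    by (simp add: sum_distrib_right)
  also have "\<dots> \<le> ?K * ?K ^ k"
    by (intro mult_right_mono member_le_sum[of i UNIV "\<lambda>a. \<Sum>b\<in>UNIV. norm (A $ a $ b)"]
        zero_le_power sum_nonneg) auto
  finally show ?case by simp
qed

lemma mpow_cscale: "mpow (c *\<^sub>C A) k = c ^ k *\<^sub>C mpow A k"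
  by (induction k) (simp_all add: mult.commute)

lemma mpow_Suc2: "mpow A (Suc k) = mpow A k ** A"
  by (induction k) (simp_all add: matrix_mul_assoc)

lemma adj_mpow: "adj (mpow A k) = mpow (adj A) k"
proof (induction k)
  case (Suc k)
  have "adj (mpow A (Suc k)) = mpow (adj A) k ** adj A"
    by (simp add: adj_mult Suc)
  then show ?case by (simp only: mpow_Suc2)
qed simp

lemma summable_mexp_entry: "summable (\<lambda>k. mpow A k $ i $ j / fact k * (z :: complex) ^ k)"
proof (rule summable_comparison_test)
  define K where "K = (\<Sum>a\<in>UNIV. \<Sum>b\<in>UNIV. norm (A $ a $ b))"
  have "norm (mpow A k $ i $ j / fact k * z ^ k) \<le> (K * norm z) ^ k /\<^sub>R fact k" for k
  proof -
    have "norm (mpow A k $ i $ j) * norm z ^ k / fact k \<le> K ^ k * norm z ^ k / fact k"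
      using norm_mpow_entry_le[of A k i j, folded K_def]
      by (intro divide_right_mono mult_right_mono) auto
    then show ?thesis
      by (simp add: norm_mult norm_divide norm_power power_mult_distrib real_scaleR_def)
         (simp add: field_simps)
  qed
  then show "\<exists>N. \<forall>k\<ge>N. norm (mpow A k $ i $ j / fact k * z ^ k) \<le> (K * norm z) ^ k /\<^sub>R fact k"
    by blast
  show "summable (\<lambda>k. (K * norm z) ^ k /\<^sub>R fact k)" by (rule summable_exp_generic)
qed

lemma mexp_sums:
  "(\<lambda>k. (1 / fact k) *\<^sub>R mpow A k) sums mexp A"
proof -
  define E where "E = (\<chi> i j. \<Sum>k. mpow A k $ i $ j / fact k)"
  have "(\<lambda>k. (1 / fact k) *\<^sub>R mpow A k) sums E"
  proof (rule matrix_sumsI)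
    fix i j
    show "(\<lambda>k. ((1 / fact k) *\<^sub>R mpow A k) $ i $ j) sums (E $ i $ j)"
    proof -
      have "((1 / fact k) *\<^sub>R mpow A k) $ i $ j = mpow A k $ i $ j / fact k * 1 ^ k" for k
        unfolding scaleR_entry by simp
      then have "(\<lambda>k. ((1 / fact k) *\<^sub>R mpow A k) $ i $ j) sums (\<Sum>k. mpow A k $ i $ j / fact k * 1 ^ k)"
        using summable_sums[OF summable_mexp_entry[of A i j 1]] by (simp only:)
      then show ?thesis unfolding E_def by (simp only: vec_lambda_beta power_one mult_1_right)
    qed
  qed
  moreover from sums_unique[OF this] have "E = mexp A" unfolding mexp_def .
  ultimately show ?thesis by simp
qed

lemma mexp_entry: "mexp (z *\<^sub>C A) $ i $ j = (\<Sum>k. mpow A k $ i $ j / fact k * z ^ k)"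
proof -
  have "(\<lambda>k. ((1 / fact k) *\<^sub>R mpow (z *\<^sub>C A) k) $ i $ j) sums (mexp (z *\<^sub>C A) $ i $ j)"
    by (rule bounded_linear.sums[OF bounded_linear_entry mexp_sums])
  moreover have "((1 / fact k) *\<^sub>R mpow (z *\<^sub>C A) k) $ i $ j = mpow A k $ i $ j / fact k * z ^ k" for k
    unfolding scaleR_entry mpow_cscale by simp
  ultimately have "(\<lambda>k. mpow A k $ i $ j / fact k * z ^ k) sums (mexp (z *\<^sub>C A) $ i $ j)"
    by simp
  from sums_unique[OF this] show ?thesis .
qed

lemma mexp_commute:
  assumes "A ** B = B ** A"
  shows "mexp (z *\<^sub>C A) ** B = B ** mexp (z *\<^sub>C A)"
proof -
  have pow: "mpow (z *\<^sub>C A) k ** B = B ** mpow (z *\<^sub>C A) k" for k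
  proof (induction k)
    case (Suc k)
    have "mpow (z *\<^sub>C A) (Suc k) ** B = z *\<^sub>C (A ** (mpow (z *\<^sub>C A) k ** B))"
      by (simp add: matrix_mul_assoc)
    also have "\<dots> = z *\<^sub>C ((A ** B) ** mpow (z *\<^sub>C A) k)"
      by (simp only: Suc matrix_mul_assoc)
    also have "\<dots> = B ** mpow (z *\<^sub>C A) (Suc k)"
      by (simp only: assms) (simp add: matrix_mul_assoc)
    finally show ?case .
  qed simp
  define f where "f k = (1 / fact k) *\<^sub>R mpow (z *\<^sub>C A) k" for k
  have f: "f sums mexp (z *\<^sub>C A)" unfolding f_def by (rule mexp_sums)
  have "(\<lambda>k. f k ** B) sums (mexp (z *\<^sub>C A) ** B)"
    by (rule bounded_linear.sums[OF bounded_bilinear.bounded_linear_left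
          [OF bounded_bilinear_matrix_mult] f])
  moreover have "(\<lambda>k. B ** f k) sums (B ** mexp (z *\<^sub>C A))"
    by (rule bounded_linear.sums[OF bounded_bilinear.bounded_linear_right
          [OF bounded_bilinear_matrix_mult] f])
  moreover have "f k ** B = B ** f k" for k
    unfolding f_def bounded_bilinear.scaleR_left[OF bounded_bilinear_matrix_mult]
      bounded_bilinear.scaleR_right[OF bounded_bilinear_matrix_mult] by (simp only: pow)
  ultimately show ?thesis by (simp only: sums_unique2)
qed

lemma adj_mexp: "adj (mexp A) = mexp (adj A)"
proof -
  have "(\<lambda>k. adj ((1 / fact k) *\<^sub>R mpow A k)) sums adj (mexp A)"
    by (rule bounded_linear.sums[OF bounded_linear_adj mexp_sums])
  then have "(\<lambda>k. (1 / fact k) *\<^sub>R mpow (adj A) k) sums adj (mexp A)"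
    by (simp add: adj_mpow adj_scaleR)
  then show ?thesis using mexp_sums sums_unique2 by blast
qed

lemma mexp_0 [simp]: "mexp (0 :: complex^'n^'n) = mat 1"
proof -
  have "mexp (0 *\<^sub>C (0 :: complex^'n^'n)) $ i $ j = mat 1 $ i $ j" for i j :: 'n
    unfolding mexp_entry by (subst powser_zero) simp
  then show ?thesis by (simp add: vec_eq_iff)
qed

lemma DERIV_mexp_entry:
  "((\<lambda>z. mexp (z *\<^sub>C A) $ i $ j) has_field_derivative (A ** mexp (z *\<^sub>C A)) $ i $ j) (at z)"
proof -
  define c where "c i j n = mpow A n $ i $ j / fact n" for i j n
  have summ: "summable (\<lambda>n. c i j n * z ^ n)" for i j z
    unfolding c_def by (rule summable_mexp_entry)
  have fct: "of_nat (Suc n) * (x / fact (Suc n)) = x / fact n" for n and x :: complex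
    unfolding fact_Suc by (simp del: of_nat_Suc)
  have "diffs (c i j) n * z ^ n = (\<Sum>l\<in>UNIV. A $ i $ l * (c l j n * z ^ n))" for n
    unfolding diffs_def c_def fct
    by (simp add: matrix_mult_nth sum_distrib_right sum_divide_distrib mult.assoc)
  then have "(\<Sum>n. diffs (c i j) n * z ^ n) = (\<Sum>n. \<Sum>l\<in>UNIV. A $ i $ l * (c l j n * z ^ n))"
    by simp
  also have "\<dots> = (\<Sum>l\<in>UNIV. \<Sum>n. A $ i $ l * (c l j n * z ^ n))"
    by (intro suminf_sum summable_mult summ)
  also have "\<dots> = (A ** mexp (z *\<^sub>C A)) $ i $ j"
    by (simp add: suminf_mult summ matrix_mult_nth mexp_entry c_def[symmetric])
  finally have "(\<Sum>n. diffs (c i j) n * z ^ n) = (A ** mexp (z *\<^sub>C A)) $ i $ j" .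
  moreover have "((\<lambda>z. \<Sum>n. c i j n * z ^ n) has_field_derivative (\<Sum>n. diffs (c i j) n * z ^ n)) (at z)"
    by (rule termdiffs_strong_converges_everywhere) (rule summ)
  ultimately show ?thesis by (simp add: mexp_entry c_def)
qed

lemma has_vector_derivative_mexp_affine:
  "((\<lambda>x. mexp ((w + c * complex_of_real x) *\<^sub>C A)) has_vector_derivative
     c *\<^sub>C (A ** mexp ((w + c * complex_of_real x) *\<^sub>C A))) (at x within T)"
proof (rule has_vector_derivative_matrixI)
  fix i j
  have "((\<lambda>z. mexp ((w + c * z) *\<^sub>C A) $ i $ j) has_field_derivative
      (A ** mexp ((w + c * z) *\<^sub>C A)) $ i $ j * c) (at z)" for z
    by (rule DERIV_chain2[OF DERIV_mexp_entry]) (auto intro!: derivative_eq_intros)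
  then show "((\<lambda>x. mexp ((w + c * complex_of_real x) *\<^sub>C A) $ i $ j) has_vector_derivative
      (c *\<^sub>C (A ** mexp ((w + c * complex_of_real x) *\<^sub>C A))) $ i $ j) (at x within T)"
    by (subst cscale_nth, subst mult.commute) (rule has_vector_derivative_real_field)
qed

lemma has_vector_derivative_mexp:
  "((\<lambda>x. mexp ((c * complex_of_real x) *\<^sub>C A)) has_vector_derivative
     c *\<^sub>C (A ** mexp ((c * complex_of_real x) *\<^sub>C A))) (at x within T)"
  using has_vector_derivative_mexp_affine[of 0] by simp

text \<open>Replacing \<open>z\<close> by \<open>z x\<close> turns the left-hand side into a function of \<open>x\<close> whose derivative vanishes,
  because \<open>A\<close> commutes with its exponential; the values at \<open>x = 0\<close> and \<open>x = 1\<close> are compared. The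
  addition theorem and the invertibility of the exponential both follow.\<close>

lemma mexp_add_minus:
  "mexp ((w + z) *\<^sub>C A) ** mexp ((- z) *\<^sub>C A) = mexp (w *\<^sub>C A)"
proof -
  define f where "f x = mexp ((w + z * complex_of_real x) *\<^sub>C A) ** mexp ((0 + (- z) * complex_of_real x) *\<^sub>C A)"
    for x
  have "(f has_vector_derivative 0) (at x within {0..1})" for x
  proof -
    define E where "E = mexp ((w + z * complex_of_real x) *\<^sub>C A)"
    define E' where "E' = mexp ((0 + (- z) * complex_of_real x) *\<^sub>C A)"
    have comm: "E ** A = A ** E" unfolding E_def by (rule mexp_commute) (rule refl)
    have "(f has_vector_derivative E ** ((- z) *\<^sub>C (A ** E')) + (z *\<^sub>C (A ** E)) ** E') (at x within {0..1})"
      unfolding f_def E_def E'_def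
      by (intro has_vector_derivative_matrix_mult has_vector_derivative_mexp_affine)
    moreover have "E ** ((- z) *\<^sub>C (A ** E')) + (z *\<^sub>C (A ** E)) ** E' = 0"
      by (simp add: matrix_mul_assoc comm cscale_minus_left)
    ultimately show ?thesis by simp
  qed
  then have "f 1 = f 0"
    by (rule_tac has_vector_derivative_zero_constant[of "{0..1::real}" f]) auto
  then show ?thesis by (simp add: f_def)
qed

lemma mexp_add: "mexp ((w + z) *\<^sub>C A) = mexp (w *\<^sub>C A) ** mexp (z *\<^sub>C A)"
proof -
  have "mexp (w *\<^sub>C A) ** mexp (z *\<^sub>C A) = mexp ((w + z) *\<^sub>C A) ** (mexp ((- z) *\<^sub>C A) ** mexp (z *\<^sub>C A))"
    by (simp only: mexp_add_minus[of w z A, symmetric] matrix_mul_assoc)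
  also have "mexp ((- z) *\<^sub>C A) ** mexp (z *\<^sub>C A) = mat 1"
    using mexp_add_minus[of 0 "- z" A] by simp
  finally show ?thesis by simp
qed

lemma mexp_eigenvector:
  assumes "A *v y = \<beta> *s y"
  shows "mexp (c *\<^sub>C A) *v y = exp (c * \<beta>) *s y"
proof -
  have pow: "mpow A k *v y = \<beta> ^ k *s y" for k
    by (induction k) (simp_all add: assms matrix_vector_mul_assoc [symmetric] vec.scale mult.commute)
  have "(\<lambda>k. ((1 / fact k) *\<^sub>R mpow (c *\<^sub>C A) k) *v y) sums (mexp (c *\<^sub>C A) *v y)"
    by (rule bounded_linear.sums[OF bounded_bilinear.bounded_linear_left
          [OF bounded_bilinear_matrix_vector_mult] mexp_sums])
  moreover have "((1 / fact k) *\<^sub>R mpow (c *\<^sub>C A) k) *v y = ((c * \<beta>) ^ k /\<^sub>R fact k) *s y" for k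
  proof -
    have "((1 / fact k) *\<^sub>R mpow (c *\<^sub>C A) k) *v y = (1 / fact k) *\<^sub>R (c ^ k *s (\<beta> ^ k *s y))"
      by (simp only: bounded_bilinear.scaleR_left[OF bounded_bilinear_matrix_vector_mult]
          mpow_cscale cscale_vector pow)
    then show ?thesis
      by (simp add: vec_eq_iff power_mult_distrib divide_inverse)
  qed
  moreover have "(\<lambda>k. ((c * \<beta>) ^ k /\<^sub>R fact k) *s y) sums (exp (c * \<beta>) *s y)"
    unfolding sums_def
  proof (rule vec_tendstoI)
    fix i
    have "(\<lambda>k. ((c * \<beta>) ^ k /\<^sub>R fact k) * y $ i) sums (exp (c * \<beta>) * y $ i)"
      by (intro sums_mult2 exp_converges)
    then show "((\<lambda>n. (\<Sum>k<n. ((c * \<beta>) ^ k /\<^sub>R fact k) *s y) $ i) \<longlongrightarrow> (exp (c * \<beta>) *s y) $ i) sequentially"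
      by (simp add: sums_def)
  qed
  ultimately show ?thesis by (simp only: sums_unique2)
qed

section \<open>Inverse matrices by Cramer's rule\<close>

text \<open>Cramer's rule is a formula in the entries that makes sense at every matrix: at a singular one,
  division by zero gives the zero matrix. The inverse of a matrix function with meromorphic entries
  is therefore again one, with a prescribed value at every point of the semi-axis.\<close>

definition cramer_inv :: "complex^'n^'n \<Rightarrow> complex^'n^'n" where
  "cramer_inv A = (\<chi> k l. det (\<chi> i j. if j = k then axis l 1 $ i else A $ i $ j) / det A)"

lemma cramer_inv_eq:
  fixes A :: "complex^'n^'n"
  assumes "det A \<noteq> 0"
  shows "cramer_inv A = matrix_inv A"
proof -
  have col: "A *v (\<chi> k. cramer_inv A $ k $ l) = axis l 1" for l
    using cramer[OF assms, of "\<chi> k. cramer_inv A $ k $ l" "axis l 1"]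
    by (simp add: cramer_inv_def)
  have "(A ** cramer_inv A) $ i $ l = (mat 1 :: complex^'n^'n) $ i $ l" for i l
    using arg_cong[OF col[of l], of "\<lambda>v. v $ i"]
    by (simp add: matrix_mult_nth matrix_vector_nth mat_def axis_def)
  then have "A ** cramer_inv A = mat 1" by (simp add: vec_eq_iff)
  then show ?thesis using matrix_inv_eqI(1) by metis
qed

lemma cramer_inv_mult:
  assumes "det A \<noteq> 0"
  shows "A ** cramer_inv A = mat 1" "cramer_inv A ** A = mat 1"
  using assms matrix_inv_mult[of A] by (simp_all add: cramer_inv_eq invertible_det_nz)

lemma tendsto_det:
  fixes f :: "'a \<Rightarrow> complex^'n^'n"
  assumes "(f \<longlongrightarrow> L) F"
  shows "((\<lambda>x. det (f x)) \<longlongrightarrow> det L) F"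
  unfolding det_def
  by (intro tendsto_intros tendsto_vec_nth assms)

lemma tendsto_cramer_inv:
  fixes f :: "'a \<Rightarrow> complex^'n^'n"
  assumes "(f \<longlongrightarrow> L) F" "det L \<noteq> 0"
  shows "((\<lambda>x. cramer_inv (f x)) \<longlongrightarrow> cramer_inv L) F"
proof (rule tendsto_matrixI)
  fix k l
  have "((\<lambda>x. \<chi> i j. if j = k then axis l 1 $ i else f x $ i $ j)
      \<longlongrightarrow> (\<chi> i j. if j = k then axis l 1 $ i else L $ i $ j)) F"
    by (rule tendsto_matrixI) (auto intro!: tendsto_intros tendsto_vec_nth assms)
  from tendsto_divide[OF tendsto_det[OF this] tendsto_det[OF assms(1)] assms(2)]
  show "((\<lambda>x. cramer_inv (f x) $ k $ l) \<longlongrightarrow> cramer_inv L $ k $ l) F"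
    by (simp add: cramer_inv_def)
qed

lemma has_vector_derivative_iff_quotient:
  "(f has_vector_derivative D) (at x within T) \<longleftrightarrow>
   ((\<lambda>y. (1 / (y - x)) *\<^sub>R (f y - f x)) \<longlongrightarrow> D) (at x within T)"
proof -
  have norm_eq: "norm ((1 / norm (y - x)) *\<^sub>R (f y - (f x + (y - x) *\<^sub>R D)))
      = norm ((1 / (y - x)) *\<^sub>R (f y - f x) - D)" if "y \<noteq> x" for y
  proof -
    have "(1 / (y - x)) *\<^sub>R (f y - f x) - D = (1 / (y - x)) *\<^sub>R (f y - (f x + (y - x) *\<^sub>R D))"
      using that by (simp add: scaleR_diff_right scaleR_add_right)
    then show ?thesis by simp
  qed
  have "(f has_vector_derivative D) (at x within T) \<longleftrightarrow>
      ((\<lambda>y. norm ((1 / norm (y - x)) *\<^sub>R (f y - (f x + (y - x) *\<^sub>R D)))) \<longlongrightarrow> 0) (at x within T)"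
    unfolding has_vector_derivative_def has_derivative_within tendsto_norm_zero_iff
    using bounded_linear_scaleR_left by blast
  also have "\<dots> \<longleftrightarrow> ((\<lambda>y. norm ((1 / (y - x)) *\<^sub>R (f y - f x) - D)) \<longlongrightarrow> 0) (at x within T)"
    by (rule filterlim_cong[OF refl refl]) (use norm_eq in \<open>auto simp: eventually_at_filter\<close>)
  also have "\<dots> \<longleftrightarrow> ((\<lambda>y. (1 / (y - x)) *\<^sub>R (f y - f x)) \<longlongrightarrow> D) (at x within T)"
    unfolding tendsto_norm_zero_iff by (rule LIM_zero_iff)
  finally show ?thesis .
qed

text \<open>The difference quotient of the inverse is
  \<open>- f(y)\<^sup>-\<^sup>1 ((f(y) - f(x)) / (y - x)) f(x)\<^sup>-\<^sup>1\<close>, so continuity of the inverse suffices.\<close>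

lemma has_vector_derivative_cramer_inv:
  fixes f :: "real \<Rightarrow> complex^'n^'n"
  assumes f: "(f has_vector_derivative f') (at x within T)" and det: "det (f x) \<noteq> 0"
  shows "((\<lambda>y. cramer_inv (f y)) has_vector_derivative
     - (cramer_inv (f x) ** (f' ** cramer_inv (f x)))) (at x within T)"
proof -
  have cont: "(f \<longlongrightarrow> f x) (at x within T)"
    using has_vector_derivative_continuous[OF f] by (simp add: continuous_within)
  have ev: "eventually (\<lambda>y. det (f y) \<noteq> 0) (at x within T)"
    using tendsto_imp_eventually_ne[OF tendsto_det[OF cont] det] .
  have quot: "(1 / (y - x)) *\<^sub>R (cramer_inv (f y) - cramer_inv (f x))
      = - (cramer_inv (f y) ** (((1 / (y - x)) *\<^sub>R (f y - f x)) ** cramer_inv (f x)))"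
    if "det (f y) \<noteq> 0" for y
  proof -
    have "cramer_inv (f y) - cramer_inv (f x) = - (cramer_inv (f y) ** ((f y - f x) ** cramer_inv (f x)))"
      using cramer_inv_mult[OF det] cramer_inv_mult[OF that]
      by (simp add: mult_diff_matrix matrix_mul_assoc)
    then show ?thesis
      by (simp add: bounded_bilinear.scaleR_left[OF bounded_bilinear_matrix_mult]
          bounded_bilinear.scaleR_right[OF bounded_bilinear_matrix_mult])
  qed
  have "((\<lambda>y. - (cramer_inv (f y) ** (((1 / (y - x)) *\<^sub>R (f y - f x)) ** cramer_inv (f x))))
      \<longlongrightarrow> - (cramer_inv (f x) ** (f' ** cramer_inv (f x)))) (at x within T)"
    using f[unfolded has_vector_derivative_iff_quotient] tendsto_cramer_inv[OF cont det]
    by (intro tendsto_minus tendsto_matrix_mult tendsto_const)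
  then show ?thesis
    unfolding has_vector_derivative_iff_quotient
    by (rule Lim_transform_eventually) (use ev quot in \<open>auto elim!: eventually_mono\<close>)
qed

section \<open>Functions of a real variable with a holomorphic or meromorphic continuation\<close>

definition entire_ext :: "(real \<Rightarrow> complex) \<Rightarrow> bool" where
  "entire_ext f \<longleftrightarrow> (\<exists>F. F holomorphic_on UNIV \<and> (\<forall>x. f x = F (complex_of_real x)))"

text \<open>Equality with the continuation is demanded at every point of the semi-axis, poles included. This
  is the sense in which the solutions of the Dirac system are meromorphic, and it makes the class
  closed under division with the convention \<open>1 / 0 = 0\<close>.\<close>

definition mero_ext :: "(real \<Rightarrow> complex) \<Rightarrow> bool" where
  "mero_ext f \<longleftrightarrow> (\<exists>F. F meromorphic_on (complex_of_real ` {0..}) \<and>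
     (\<forall>x\<ge>0. f x = F (complex_of_real x)))"

lemma entire_ext_imp_mero_ext: "entire_ext f \<Longrightarrow> mero_ext f"
  unfolding entire_ext_def mero_ext_def
  by (elim exE conjE, rule_tac x=F in exI)
     (auto intro!: analytic_on_imp_meromorphic_on intro: analytic_on_subset[of _ UNIV]
       simp: analytic_on_open)

lemma entire_ext_const: "entire_ext (\<lambda>x. c)"
  unfolding entire_ext_def by (intro exI[of _ "\<lambda>_. c"]) auto

lemma entire_ext_add: "entire_ext f \<Longrightarrow> entire_ext g \<Longrightarrow> entire_ext (\<lambda>x. f x + g x)"
  unfolding entire_ext_def by (elim exE conjE, rule_tac x="\<lambda>z. F z + Fa z" in exI) (auto intro: holomorphic_on_add)

lemma entire_ext_mult: "entire_ext f \<Longrightarrow> entire_ext g \<Longrightarrow> entire_ext (\<lambda>x. f x * g x)"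
  unfolding entire_ext_def by (elim exE conjE, rule_tac x="\<lambda>z. F z * Fa z" in exI) (auto intro: holomorphic_on_mult)

lemma entire_ext_sum: "(\<And>a. a \<in> A \<Longrightarrow> entire_ext (f a)) \<Longrightarrow> entire_ext (\<lambda>x. \<Sum>a\<in>A. f a x)"
  by (induction A rule: infinite_finite_induct) (auto intro: entire_ext_const entire_ext_add)

lemma mero_ext_const: "mero_ext (\<lambda>x. c)"
  by (intro entire_ext_imp_mero_ext entire_ext_const)

lemma mero_ext_add: "mero_ext f \<Longrightarrow> mero_ext g \<Longrightarrow> mero_ext (\<lambda>x. f x + g x)"
  unfolding mero_ext_def by (elim exE conjE, rule_tac x="\<lambda>z. F z + Fa z" in exI) (auto intro: meromorphic_on_add)

lemma mero_ext_mult: "mero_ext f \<Longrightarrow> mero_ext g \<Longrightarrow> mero_ext (\<lambda>x. f x * g x)"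
  unfolding mero_ext_def by (elim exE conjE, rule_tac x="\<lambda>z. F z * Fa z" in exI) (auto intro: meromorphic_on_mult)

lemma mero_ext_divide: "mero_ext f \<Longrightarrow> mero_ext g \<Longrightarrow> mero_ext (\<lambda>x. f x / g x)"
  unfolding mero_ext_def by (elim exE conjE, rule_tac x="\<lambda>z. F z / Fa z" in exI) (auto intro: meromorphic_on_divide)

lemma mero_ext_sum: "(\<And>a. a \<in> A \<Longrightarrow> mero_ext (f a)) \<Longrightarrow> mero_ext (\<lambda>x. \<Sum>a\<in>A. f a x)"
  by (induction A rule: infinite_finite_induct) (auto intro: mero_ext_const mero_ext_add)

lemma mero_ext_prod: "(\<And>a. a \<in> A \<Longrightarrow> mero_ext (f a)) \<Longrightarrow> mero_ext (\<lambda>x. \<Prod>a\<in>A. f a x)"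
  by (induction A rule: infinite_finite_induct) (auto intro: mero_ext_const mero_ext_mult)

text \<open>Around each point of the semi-axis a meromorphic function either equals \<open>c\<close> on a punctured
  neighbourhood or avoids \<open>c\<close> on one. Hence the points of the first kind form an open and closed
  subset of the connected semi-axis, and one such point at \<open>0\<close> forces all of them. This carries a
  constant of motion across the singularities of the potential.\<close>

lemma mero_ext_constant:
  assumes f: "mero_ext f" and "0 < e" and near0: "\<And>x. 0 \<le> x \<Longrightarrow> x < e \<Longrightarrow> f x = c"
    and "0 \<le> b" and cont: "(f \<longlongrightarrow> f b) (at b within {0..})"
  shows "f b = c"
proof -
  obtain F where F: "F meromorphic_on (complex_of_real ` {0..})"
    and fF: "\<And>x. x \<ge> 0 \<Longrightarrow> f x = F (complex_of_real x)"
    using f unfolding mero_ext_def by auto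
  define P where "P x \<longleftrightarrow> eventually (\<lambda>w. F w - c = 0) (at (complex_of_real x))" for x
  have dicho: "P x \<or> eventually (\<lambda>w. F w - c \<noteq> 0) (at (complex_of_real x))" if "0 \<le> x" for x
  proof -
    have "(\<lambda>w. F w - c) meromorphic_on {complex_of_real x}"
      using that by (intro meromorphic_intros meromorphic_on_subset[OF F]) auto
    then have "isolated_singularity_at (\<lambda>w. F w - c) (complex_of_real x)"
      "not_essential (\<lambda>w. F w - c) (complex_of_real x)" by (simp_all add: meromorphic_at_iff)
    then show ?thesis
      unfolding P_def
      using not_essential_frequently_0_imp_eventually_0[of "\<lambda>w. F w - c" "complex_of_real x"]
      unfolding frequently_def by blast
  qed
  have to_complex: "filterlim complex_of_real (at (complex_of_real x)) (at x within {0..})" for x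
    by (intro filterlim_atI tendsto_intros) (auto simp: eventually_at_filter)
  have nontriv: "at x within {0..} \<noteq> bot" if "0 \<le> x" for x :: real
  proof -
    have "at_right x \<le> at x within {0..}" using that by (intro at_le) auto
    then show ?thesis using trivial_limit_at_right_real[of x] by (auto simp: bot_unique)
  qed
  \<comment> \<open>If \<open>0\<close> were of the second kind, small positive arguments would both take and avoid the value \<open>c\<close>.\<close>
  have "P 0"
  proof (rule ccontr)
    assume "\<not> P 0"
    with dicho[of 0] have "eventually (\<lambda>w. F w - c \<noteq> 0) (at (complex_of_real 0))" by auto
    then have "eventually (\<lambda>x. F (complex_of_real x) - c \<noteq> 0) (at 0 within {0..})"
      using to_complex[of 0] by (rule eventually_compose_filterlim)
    moreover have "eventually (\<lambda>x. x < e) (at (0::real) within {0..})"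
      using \<open>0 < e\<close> by (intro order_tendstoD[OF tendsto_ident_at])
    moreover have "eventually (\<lambda>x. x \<in> {0..}) (at (0::real) within {0..})"
      by (simp add: eventually_at_filter)
    ultimately have "eventually (\<lambda>x. False) (at (0::real) within {0..})"
      by eventually_elim (use near0 fF in auto)
    then show False using nontriv[of 0] by simp
  qed
  have "P b"
  proof (rule connected_induction_simple[of "{0..}" 0 b])
    fix a :: real assume a: "a \<in> {0..}"
    have punct: "\<exists>T. openin (top_of_set {0..}) T \<and> a \<in> T \<and>
        (\<forall>x\<in>T. x \<noteq> a \<longrightarrow> eventually Q (at (complex_of_real x)))"
      if Q: "eventually Q (at (complex_of_real a))" for Q
    proof -
      from Q obtain U where U: "open U" "complex_of_real a \<in> U" "\<And>w. w \<in> U \<Longrightarrow> w \<noteq> complex_of_real a \<Longrightarrow> Q w"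
        by (auto simp: eventually_at_topological)
      let ?T = "{0..} \<inter> complex_of_real -` U"
      have "openin (top_of_set {0..}) ?T"
        using U(1) by (intro openin_open_Int open_vimage continuous_intros)
      moreover have "eventually Q (at (complex_of_real x))" if "x \<in> ?T" "x \<noteq> a" for x
        using that U by (auto simp: eventually_at_topological
            intro!: exI[of _ "U - {complex_of_real a}"])
      ultimately show ?thesis using a U by (intro exI[of _ ?T]) auto
    qed
    show "\<exists>T. openin (top_of_set {0..}) T \<and> a \<in> T \<and> (\<forall>x\<in>T. \<forall>y\<in>T. P x \<longrightarrow> P y)"
    proof (cases "P a")
      case True
      from punct[OF this[unfolded P_def], folded P_def] show ?thesis using True by metis
    next
      case False
      with dicho[of a] a have "eventually (\<lambda>w. F w - c \<noteq> 0) (at (complex_of_real a))" by auto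
      from punct[OF this] obtain T where T: "openin (top_of_set {0..}) T" "a \<in> T"
        "\<And>x. x \<in> T \<Longrightarrow> x \<noteq> a \<Longrightarrow> eventually (\<lambda>w. F w - c \<noteq> 0) (at (complex_of_real x))" by auto
      have "\<not> P x" if "x \<in> T" for x
      proof (cases "x = a")
        case False
        show ?thesis
        proof
          assume "P x"
          then have "eventually (\<lambda>w. False) (at (complex_of_real x))"
            using T(3)[OF that False] unfolding P_def by eventually_elim auto
          then show False by simp
        qed
      qed (use \<open>\<not> P a\<close> in simp)
      with T show ?thesis by metis
    qed
  qed (use \<open>P 0\<close> \<open>0 \<le> b\<close> in auto)
  then have "eventually (\<lambda>x. F (complex_of_real x) - c = 0) (at b within {0..})"
    unfolding P_def using to_complex[of b] by (rule eventually_compose_filterlim)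
  moreover have "eventually (\<lambda>x. x \<in> {0..}) (at b within {0..})"
    by (simp add: eventually_at_filter)
  ultimately have "eventually (\<lambda>x. f x = c) (at b within {0..})"
    by eventually_elim (use fF in auto)
  then have "(f \<longlongrightarrow> c) (at b within {0..})" by (rule tendsto_eventually)
  with cont show ?thesis using tendsto_unique[OF nontriv[OF \<open>0 \<le> b\<close>]] by blast
qed

lemma entire_ext_mexp: "entire_ext (\<lambda>x. mexp ((c * complex_of_real x) *\<^sub>C A) $ i $ j)"
proof -
  have "(\<lambda>z. mexp ((c * z) *\<^sub>C A) $ i $ j) holomorphic_on UNIV"
  proof (rule holomorphic_onI)
    fix z
    have "((\<lambda>z. mexp ((c * z) *\<^sub>C A) $ i $ j) has_field_derivative
      (A ** mexp ((c * z) *\<^sub>C A)) $ i $ j * c) (at z)"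
      by (rule DERIV_chain2[OF DERIV_mexp_entry]) (auto intro!: derivative_eq_intros)
    then show "(\<lambda>z. mexp ((c * z) *\<^sub>C A) $ i $ j) field_differentiable at z"
      by (auto simp: field_differentiable_def)
  qed
  then show ?thesis unfolding entire_ext_def by blast
qed

abbreviation entire_matrix :: "(real \<Rightarrow> complex^'q^'p) \<Rightarrow> bool" where
  "entire_matrix f \<equiv> \<forall>i k. entire_ext (\<lambda>x. f x $ i $ k)"

abbreviation mero_matrix :: "(real \<Rightarrow> complex^'q^'p) \<Rightarrow> bool" where
  "mero_matrix f \<equiv> \<forall>i k. mero_ext (\<lambda>x. f x $ i $ k)"

lemma entire_matrix_mult:
  "entire_matrix f \<Longrightarrow> entire_matrix g \<Longrightarrow> entire_matrix (\<lambda>x. f x ** g x)"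
  by (auto simp: matrix_mult_nth intro!: entire_ext_sum entire_ext_mult)

lemma mero_matrix_mult:
  "mero_matrix f \<Longrightarrow> mero_matrix g \<Longrightarrow> mero_matrix (\<lambda>x. f x ** g x)"
  by (auto simp: matrix_mult_nth intro!: mero_ext_sum mero_ext_mult)

lemma mero_matrix_add:
  "mero_matrix f \<Longrightarrow> mero_matrix g \<Longrightarrow> mero_matrix (\<lambda>x. f x + g x)"
  by (auto intro!: mero_ext_add)

lemma mero_matrix_cscale:
  "mero_ext c \<Longrightarrow> mero_matrix f \<Longrightarrow> mero_matrix (\<lambda>x. c x *\<^sub>C f x)"
  by (auto intro!: mero_ext_mult)

lemma mero_matrix_const: "mero_matrix (\<lambda>x. C)"
  by (auto intro!: mero_ext_const)

lemma mero_matrix_cramer_inv: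
  fixes f :: "real \<Rightarrow> complex^'n^'n"
  assumes "mero_matrix f"
  shows "mero_matrix (\<lambda>x. cramer_inv (f x))"
proof -
  have det: "mero_ext (\<lambda>x. det (g x))" if "mero_matrix g" for g :: "real \<Rightarrow> complex^'n^'n"
    using that unfolding det_def by (auto intro!: mero_ext_sum mero_ext_mult mero_ext_prod mero_ext_const)
  have "mero_matrix (\<lambda>x. \<chi> i j. if j = k then axis l 1 $ i else f x $ i $ j)" for k l
  proof (intro allI)
    fix i j
    show "mero_ext (\<lambda>x. (\<chi> i j. if j = k then axis l 1 $ i else f x $ i $ j) $ i $ j)"
      using assms by (cases "j = k") (simp_all add: mero_ext_const)
  qed
  then show ?thesis
    unfolding cramer_inv_def using assms by (simp add: mero_ext_divide det)
qed

text \<open>Entire functions have entire primitives; this continues the integral in the definition of \<open>S\<close>.\<close>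

lemma entire_matrix_primitive:
  fixes h :: "real \<Rightarrow> complex^'q^'p"
  assumes "entire_matrix h"
  obtains G where "entire_matrix G" "G 0 = 0"
    "\<And>x T. (G has_vector_derivative h x) (at x within T)"
proof -
  have "\<exists>g. entire_ext g \<and> g 0 = 0 \<and> (\<forall>x T. (g has_vector_derivative h x $ i $ k) (at x within T))" for i k
  proof -
    obtain F where F: "F holomorphic_on UNIV" "\<And>x. h x $ i $ k = F (complex_of_real x)"
      using assms unfolding entire_ext_def by metis
    obtain g where g: "\<And>z. (g has_field_derivative F z) (at z)"
      using holomorphic_convex_primitive'[OF convex_UNIV open_UNIV F(1)] by auto
    have "(\<lambda>z. g z - g 0) holomorphic_on UNIV"
      by (intro holomorphic_intros holomorphic_onI) (use g in \<open>auto simp: field_differentiable_def\<close>)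
    moreover have "((\<lambda>x. g (complex_of_real x) - g 0) has_vector_derivative h x $ i $ k) (at x within T)"
      for x T
      unfolding F(2) by (rule has_vector_derivative_real_field) (auto intro!: derivative_eq_intros g)
    ultimately show ?thesis
      by (intro exI[of _ "\<lambda>x. g (complex_of_real x) - g 0"])
         (auto simp: entire_ext_def intro!: exI[of _ "\<lambda>z. g z - g 0"])
  qed
  then obtain g where g: "\<And>i k. entire_ext (g i k)" "\<And>i k. g i k 0 = 0"
    "\<And>i k x T. (g i k has_vector_derivative h x $ i $ k) (at x within T)" by metis
  show ?thesis
  proof (rule that[of "\<lambda>x. \<chi> i k. g i k x"])
    show "((\<lambda>x. \<chi> i k. g i k x) has_vector_derivative h x) (at x within T)" for x T
      by (rule has_vector_derivative_matrixI) (simp add: g)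
  qed (simp_all add: g vec_eq_iff)
qed

section \<open>Real inner products and Hermitian matrices\<close>

text \<open>Quadratic forms of Hermitian matrices are real, so the real inner product of the Euclidean space
  \<open>complex^'n\<close> carries the same information as the complex one.\<close>

lemma inner_vector_Re: "x \<bullet> y = Re (\<Sum>i\<in>UNIV. cnj (x $ i) * y $ i)"
  for x y :: "complex^'n"
  by (simp add: inner_vec_def inner_complex_def)

lemma inner_matrix_vector: "x \<bullet> (A *v y) = (adj A *v x) \<bullet> y"
proof -
  have "(\<Sum>i\<in>UNIV. cnj (x $ i) * (A *v y) $ i) = (\<Sum>i\<in>UNIV. \<Sum>l\<in>UNIV. cnj (x $ i) * (A $ i $ l * y $ l))"
    by (simp add: matrix_vector_nth sum_distrib_left)
  also have "\<dots> = (\<Sum>l\<in>UNIV. \<Sum>i\<in>UNIV. cnj (x $ i) * (A $ i $ l * y $ l))"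
    by (rule sum.swap)
  also have "\<dots> = (\<Sum>l\<in>UNIV. cnj ((adj A *v x) $ l) * y $ l)"
    by (simp add: matrix_vector_nth sum_distrib_left mult_ac)
  finally show ?thesis by (simp add: inner_vector_Re)
qed

lemma inner_cscale_vector: "(c *s x) \<bullet> y = x \<bullet> (cnj c *s y)" for x y :: "complex^'n"
  by (simp add: inner_vector_Re mult_ac)

lemma norm_cscale_vector: "norm (c *s x) = norm c * norm x" for x :: "complex^'n"
proof -
  have "(c *s x) \<bullet> (c *s x) = (norm c)\<^sup>2 * (x \<bullet> x)"
  proof -
    have "cnj c * c = complex_of_real ((norm c)\<^sup>2)"
      by (simp only: complex_norm_square mult.commute)
    then have "cnj c *s (c *s x) = (norm c)\<^sup>2 *\<^sub>R x"
      by (simp add: vec_eq_iff mult.assoc [symmetric] scaleR_conv_of_real[where 'a = complex])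
    then show ?thesis by (simp add: inner_cscale_vector)
  qed
  then have "(norm (c *s x))\<^sup>2 = (norm c * norm x)\<^sup>2"
    by (simp add: power2_norm_eq_inner power_mult_distrib)
  then show ?thesis by simp
qed

text \<open>The vector \<open>axis i \<i>\<close> extracts the imaginary part that the real inner product with \<open>axis i 1\<close>
  loses.\<close>

lemma matrix_entry_inner:
  fixes A :: "complex^'q^'p"
  shows "A $ i $ k = Complex (axis i 1 \<bullet> (A *v axis k 1)) (axis i \<i> \<bullet> (A *v axis k 1))"
proof -
  have "(A *v axis k 1) $ i = A $ i $ k"
    by (simp add: matrix_vector_nth axis_def if_distrib[of "\<lambda>c. _ * c"] cong: if_cong)
  then show ?thesis by (simp add: inner_axis' inner_complex_def complex_eq_iff)
qed

lemma inner_polarization: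
  assumes "adj A = A"
  shows "x \<bullet> (A *v y) = ((x + y) \<bullet> (A *v (x + y)) - (x - y) \<bullet> (A *v (x - y))) / 4"
proof -
  have "y \<bullet> (A *v x) = x \<bullet> (A *v y)"
    using inner_matrix_vector[of y A x] assms by (simp add: inner_commute)
  then show ?thesis
    by (simp add: algebra_simps inner_add_left inner_add_right inner_diff_left inner_diff_right)
qed

lemma bounded_linear_quadratic_form: "bounded_linear (\<lambda>A :: complex^'n^'n. y \<bullet> (A *v y))"
  by (intro bounded_linear_compose[OF bounded_linear_inner_right]
      bounded_bilinear.bounded_linear_left[OF bounded_bilinear_matrix_vector_mult])

lemma antimono_tendsto_at_top:
  fixes f :: "real \<Rightarrow> real"
  assumes anti: "\<And>x y. X \<le> x \<Longrightarrow> x \<le> y \<Longrightarrow> f y \<le> f x" and bd: "\<And>x. X \<le> x \<Longrightarrow> 0 \<le> f x"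
  shows "\<exists>l. (f \<longlongrightarrow> l) at_top"
proof -
  define l where "l = Inf (f ` {X..})"
  have bdd: "bdd_below (f ` {X..})" using bd by (auto intro!: bdd_belowI[of _ 0])
  have "(f \<longlongrightarrow> l) at_top"
  proof (rule decreasing_tendsto)
    show "eventually (\<lambda>x. l \<le> f x) at_top"
      using eventually_ge_at_top[of X] by eventually_elim (auto simp: l_def intro!: cInf_lower bdd)
    fix u assume "l < u"
    then obtain x where x: "X \<le> x" "f x < u"
      unfolding l_def using cInf_less_iff[OF _ bdd] by auto
    show "eventually (\<lambda>x. f x < u) at_top"
      using eventually_ge_at_top[of x] by eventually_elim (use anti x in \<open>meson le_less_trans\<close>)
  qed
  then show ?thesis ..
qed

text \<open>The quadratic forms decrease and are bounded below, hence converge; polarization recovers the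
  sesquilinear form and thereby each entry from them.\<close>

lemma antimono_hermitian_converges:
  fixes A :: "real \<Rightarrow> complex^'n^'n"
  assumes herm: "\<And>x. X \<le> x \<Longrightarrow> adj (A x) = A x"
    and anti: "\<And>x y v. X \<le> x \<Longrightarrow> x \<le> y \<Longrightarrow> v \<bullet> (A y *v v) \<le> v \<bullet> (A x *v v)"
    and pos: "\<And>x v. X \<le> x \<Longrightarrow> 0 \<le> v \<bullet> (A x *v v)"
  shows "\<exists>L. (A \<longlongrightarrow> L) at_top"
proof -
  have "\<exists>l. ((\<lambda>x. v \<bullet> (A x *v v)) \<longlongrightarrow> l) at_top" for v
    by (rule antimono_tendsto_at_top[of X]) (use anti pos in auto)
  then obtain q where q: "\<And>v. ((\<lambda>x. v \<bullet> (A x *v v)) \<longlongrightarrow> q v) at_top" by metis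
  have b: "((\<lambda>x. u \<bullet> (A x *v v)) \<longlongrightarrow> (q (u + v) - q (u - v)) / 4) at_top" for u v
  proof (rule Lim_transform_eventually)
    show "((\<lambda>x. ((u + v) \<bullet> (A x *v (u + v)) - (u - v) \<bullet> (A x *v (u - v))) / 4)
        \<longlongrightarrow> (q (u + v) - q (u - v)) / 4) at_top"
      by (intro tendsto_intros q) auto
    show "eventually (\<lambda>x. ((u + v) \<bullet> (A x *v (u + v)) - (u - v) \<bullet> (A x *v (u - v))) / 4
        = u \<bullet> (A x *v v)) at_top"
      using eventually_ge_at_top[of X] by eventually_elim (use inner_polarization herm in metis)
  qed
  let ?b = "\<lambda>u v. (q (u + v) - q (u - v)) / 4"
  have "(A \<longlongrightarrow> (\<chi> i k. Complex (?b (axis i 1) (axis k 1)) (?b (axis i \<i>) (axis k 1)))) at_top"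
  proof (rule tendsto_matrixI)
    fix i k
    have "((\<lambda>x. Complex (axis i 1 \<bullet> (A x *v axis k 1)) (axis i \<i> \<bullet> (A x *v axis k 1)))
      \<longlongrightarrow> Complex (?b (axis i 1) (axis k 1)) (?b (axis i \<i>) (axis k 1))) at_top"
      by (intro tendsto_Complex b)
    then show "((\<lambda>x. A x $ i $ k) \<longlongrightarrow>
      (\<chi> i k. Complex (?b (axis i 1) (axis k 1)) (?b (axis i \<i>) (axis k 1))) $ i $ k) at_top"
      by (simp add: matrix_entry_inner[symmetric])
  qed
  then show ?thesis ..
qed

section \<open>Eigenvectors in invariant subspaces\<close>

text \<open>There are \<open>n + 1\<close> Krylov vectors in a space of dimension \<open>n\<close>. Two equal ones among them are handled
  separately, because the set of vectors then has fewer elements than the index set.\<close>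

lemma annihilating_coefficients:
  fixes A :: "complex^'n^'n"
  shows "\<exists>c :: nat \<Rightarrow> complex. (\<exists>i\<le>CARD('n). c i \<noteq> 0) \<and> (\<Sum>i\<le>CARD('n). c i *s (mpow A i *v y)) = 0"
proof (cases "inj_on (\<lambda>i. mpow A i *v y) {..CARD('n)}")
  case True
  let ?f = "\<lambda>i. mpow A i *v y"
  have "card (?f ` {..CARD('n)}) = Suc CARD('n)" using True by (simp add: card_image)
  then have "vec.dependent (?f ` {..CARD('n)})"
    using vec.independent_card_le_dim[of "?f ` {..CARD('n)}" UNIV] vec_dim_card[where 'a = complex and 'n = 'n]
    by fastforce
  then obtain u where u: "\<exists>v\<in>?f ` {..CARD('n)}. u v \<noteq> 0" "(\<Sum>v\<in>?f ` {..CARD('n)}. u v *s v) = 0"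
    by (auto simp: vec.dependent_finite)
  then show ?thesis
    by (intro exI[of _ "\<lambda>i. u (?f i)"]) (auto simp: sum.reindex[OF True])
next
  case False
  then obtain i j where ij: "i \<le> CARD('n)" "j \<le> CARD('n)" "i \<noteq> j" "mpow A i *v y = mpow A j *v y"
    by (auto simp: inj_on_def)
  let ?c = "\<lambda>k. (if k = i then 1 else 0) - (if k = j then 1 else 0) :: complex"
  have "(\<Sum>k\<le>CARD('n). ?c k *s (mpow A k *v y))
      = (\<Sum>k\<le>CARD('n). (if k = i then mpow A k *v y else 0) - (if k = j then mpow A k *v y else 0))"
    by (intro sum.cong) (auto simp: vec.scale_left_diff_distrib)
  also have "\<dots> = 0" using ij by (simp add: sum_subtractf)
  finally show ?thesis using ij by (intro exI[of _ ?c]) auto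
qed

text \<open>This is the vector \<open>p(A) y\<close>.\<close>

definition poly_vec :: "complex^'n^'n \<Rightarrow> complex^'n \<Rightarrow> complex poly \<Rightarrow> complex^'n" where
  "poly_vec A y p = (\<Sum>i\<le>degree p. coeff p i *s (mpow A i *v y))"

lemma poly_vec_eq:
  assumes "degree p \<le> n"
  shows "poly_vec A y p = (\<Sum>i\<le>n. coeff p i *s (mpow A i *v y))"
  unfolding poly_vec_def using assms
  by (intro sum.mono_neutral_left) (auto simp: coeff_eq_0)

lemma poly_vec_linear_factor:
  "poly_vec A y ([:- \<beta>, 1:] * q) = A *v poly_vec A y q - \<beta> *s poly_vec A y q"
proof -
  let ?n = "degree q"
  have "degree ([:- \<beta>, 1:] * q) \<le> Suc ?n"
    using degree_mult_le[of "[:- \<beta>, 1:]" q] by simp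
  then have "poly_vec A y ([:- \<beta>, 1:] * q)
      = (\<Sum>i\<le>Suc ?n. coeff ([:- \<beta>, 1:] * q) i *s (mpow A i *v y))"
    by (rule poly_vec_eq)
  also have "\<dots> = (\<Sum>i\<le>Suc ?n. coeff (pCons 0 q) i *s (mpow A i *v y))
      - (\<Sum>i\<le>Suc ?n. (\<beta> * coeff q i) *s (mpow A i *v y))"
  proof -
    have "coeff ([:- \<beta>, 1:] * q) i = coeff (pCons 0 q) i - \<beta> * coeff q i" for i by simp
    then show ?thesis by (simp only: vec.scale_left_diff_distrib sum_subtractf)
  qed
  also have "(\<Sum>i\<le>Suc ?n. coeff (pCons 0 q) i *s (mpow A i *v y)) = A *v poly_vec A y q"
    by (simp only: sum.atMost_Suc_shift poly_vec_def vec.sum)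
       (simp add: vec.scale matrix_vector_mul_assoc)
  also have "(\<Sum>i\<le>Suc ?n. (\<beta> * coeff q i) *s (mpow A i *v y)) = \<beta> *s poly_vec A y q"
    by (simp only: poly_vec_eq[of q "Suc ?n" A y, OF le_SucI[OF order_refl]] vec.scale_sum_right vec.scale_scale)
  finally show ?thesis .
qed

text \<open>Among the nonzero polynomials with \<open>p(A) y = 0\<close> take one of least degree. It is not constant, so a
  linear factor splits off, \<open>p = (X - \<beta>) q\<close>, and by minimality \<open>q(A) y\<close> is a nonzero vector of \<open>N\<close>
  annihilated by \<open>A - \<beta>\<close>.\<close>

lemma invariant_subspace_has_eigenvector:
  fixes A :: "complex^'n^'n"
  assumes sub: "vec.subspace N" and inv: "\<And>v. v \<in> N \<Longrightarrow> A *v v \<in> N"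
    and y: "y \<in> N" "y \<noteq> 0"
  shows "\<exists>v \<beta>. v \<in> N \<and> v \<noteq> 0 \<and> A *v v = \<beta> *s v"
proof -
  have powN: "mpow A k *v y \<in> N" for k
    by (induction k) (auto simp: y matrix_vector_mul_assoc [symmetric] intro: inv)
  then have polyN: "poly_vec A y p \<in> N" for p
    unfolding poly_vec_def by (intro vec.subspace_sum[OF sub] vec.subspace_scale[OF sub])
  obtain c where c: "\<exists>i\<le>CARD('n). c i \<noteq> 0" "(\<Sum>i\<le>CARD('n). c i *s (mpow A i *v y)) = 0"
    using annihilating_coefficients[of A y] by auto
  define p0 where "p0 = (\<Sum>i\<le>CARD('n). monom (c i) i)"
  have co: "coeff p0 k = (if k \<le> CARD('n) then c k else 0)" for k
    by (simp add: p0_def coeff_sum)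
  have "degree p0 \<le> CARD('n)" by (rule degree_le) (simp add: co)
  then have "poly_vec A y p0 = 0" using c(2) by (simp add: poly_vec_eq co)
  moreover have "p0 \<noteq> 0"
  proof
    assume "p0 = 0"
    then have "c k = 0" if "k \<le> CARD('n)" for k using co[of k] that by simp
    with c(1) show False by auto
  qed
  ultimately obtain p where p: "p \<noteq> 0" "poly_vec A y p = 0"
    and min: "\<And>q. q \<noteq> 0 \<Longrightarrow> poly_vec A y q = 0 \<Longrightarrow> degree p \<le> degree q"
    using ex_has_least_nat[of "\<lambda>p. p \<noteq> 0 \<and> poly_vec A y p = 0" p0 degree] by auto
  have "degree p \<noteq> 0"
  proof
    assume "degree p = 0"
    then have "coeff p 0 *s y = 0" using p(2) by (simp add: poly_vec_def)
    moreover have "coeff p 0 \<noteq> 0" using leading_coeff_0_iff[of p] p(1) \<open>degree p = 0\<close> by simp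
    ultimately show False using y(2) by simp
  qed
  then have "coeff p 0 = 0 \<or> (\<exists>i\<in>{1..degree p}. coeff p i \<noteq> 0)"
    using p(1) by (intro disjI2 bexI[of _ "degree p"]) auto
  then obtain \<beta> where "poly p \<beta> = 0"
    using fundamental_theorem_of_algebra[of "coeff p" "degree p"]
    by (metis poly_altdef)
  then obtain q where q: "p = [:- \<beta>, 1:] * q" by (auto simp: poly_eq_0_iff_dvd dvd_def)
  have "q \<noteq> 0" using p(1) q by auto
  then have "degree q < degree p" unfolding q by (subst degree_mult_eq) auto
  with min[OF \<open>q \<noteq> 0\<close>] have "poly_vec A y q \<noteq> 0" by auto
  moreover have "A *v poly_vec A y q = \<beta> *s poly_vec A y q"
    using p(2) unfolding q poly_vec_linear_factor by simp
  ultimately show ?thesis using polyN by blast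
qed

section \<open>Block matrices\<close>

lemma hcat_nth [simp]: "hcat A B $ i $ Inl a = A $ i $ a" "hcat A B $ i $ Inr b = B $ i $ b"
  by (simp_all add: hcat_def)

lemma vcat_nth [simp]: "vcat A B $ Inl a = A $ a" "vcat A B $ Inr b = B $ b"
  by (simp_all add: vcat_def)

lemma upper_nth [simp]: "upper A $ a = A $ Inl a" and lower_nth [simp]: "lower A $ b = A $ Inr b"
  by (simp_all add: upper_def lower_def)

lemma all_sum_iff: "(\<forall>k :: 'a + 'b. P k) \<longleftrightarrow> (\<forall>a. P (Inl a)) \<and> (\<forall>b. P (Inr b))"
  by (metis sum.exhaust)

lemma sum_UNIV_sum_type:
  fixes f :: "'a::finite + 'b::finite \<Rightarrow> 'c::comm_monoid_add"
  shows "(\<Sum>k\<in>UNIV. f k) = (\<Sum>a\<in>UNIV. f (Inl a)) + (\<Sum>b\<in>UNIV. f (Inr b))"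
  using sum.Plus[of "UNIV :: 'a set" "UNIV :: 'b set" f] by (simp add: UNIV_Plus_UNIV)

lemma adj_hcat: "adj (hcat A B) = vcat (adj A) (adj B)"
  by (simp_all add: vec_eq_iff all_sum_iff)

lemma hcat_mult_vcat: "hcat A B ** vcat C D = A ** C + B ** D"
  by (simp add: vec_eq_iff matrix_mult_nth sum_UNIV_sum_type)

lemma mult_hcat: "A ** hcat B C = hcat (A ** B) (A ** C)"
  by (simp add: vec_eq_iff all_sum_iff matrix_mult_nth)

lemma vcat_mult: "vcat A B ** C = vcat (A ** C) (B ** C)"
  by (simp add: vec_eq_iff all_sum_iff matrix_mult_nth)

lemma upper_vcat [simp]: "upper (vcat A B) = A" and lower_vcat [simp]: "lower (vcat A B) = B"
  by (simp_all add: vec_eq_iff)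

lemma vcat_upper_lower [simp]: "vcat (upper A) (lower A) = A"
  by (simp add: vec_eq_iff all_sum_iff)

lemma vcat_add: "vcat A B + vcat C D = vcat (A + C) (B + D)"
  and vcat_diff: "vcat A B - vcat C D = vcat (A - C) (B - D)"
  and cscale_vcat: "c *\<^sub>C vcat A B = vcat (c *\<^sub>C A) (c *\<^sub>C B)"
  and cscale_hcat: "c *\<^sub>C hcat A' B' = hcat (c *\<^sub>C A') (c *\<^sub>C B')"
  by (simp_all add: vec_eq_iff all_sum_iff)

lemma j_mat_vcat: "j_mat ** vcat A B = vcat A (- B)"
  unfolding j_mat_def vcat_mult hcat_mult_vcat by simp

lemma adj_j_mat [simp]: "adj j_mat = j_mat"
  by (simp add: j_mat_def vec_eq_iff all_sum_iff mat_def)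

lemma hcat_j_mat: "hcat A B ** j_mat = hcat A (- B)"
proof -
  have "adj (hcat A B ** j_mat) = adj (hcat A (- B))"
    by (simp add: adj_mult adj_hcat j_mat_vcat adj_minus)
  then show ?thesis by (metis adj_adj)
qed

lemma j_mat_square [simp]: "j_mat ** j_mat = mat 1"
proof -
  have "j_mat ** vcat (upper j_mat) (lower j_mat) = (mat 1 :: complex^('a + 'b)^('a + 'b))"
    unfolding j_mat_vcat by (simp add: j_mat_def vec_eq_iff all_sum_iff mat_def)
  then show ?thesis by simp
qed

section \<open>The mean value theorem on the semi-axis\<close>

lemma semiaxis_growth:
  fixes f :: "real \<Rightarrow> real"
  assumes f: "\<And>x. a \<le> x \<Longrightarrow> (f has_vector_derivative f' x) (at x within {0..})"
    and low: "\<And>x. a \<le> x \<Longrightarrow> c \<le> f' x" and "0 \<le> a" "a \<le> x" "x \<le> y"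
  shows "c * (y - x) \<le> f y - f x"
proof (cases "x = y")
  case False
  with \<open>x \<le> y\<close> have "x < y" by simp
  have "\<exists>z\<in>{x<..<y}. f y - f x = (y - x) *\<^sub>R f' z"
  proof (rule mvt_simple[OF \<open>x < y\<close>])
    fix z assume "x \<le> z" "z \<le> y"
    then have "(f has_vector_derivative f' z) (at z within {x..y})"
      using \<open>a \<le> x\<close> \<open>0 \<le> a\<close> by (intro has_vector_derivative_within_subset[OF f]) auto
    then show "(f has_derivative (\<lambda>h. h *\<^sub>R f' z)) (at z within {x..y})"
      by (simp add: has_vector_derivative_def)
  qed
  then obtain z where "x < z" "f y - f x = (y - x) * f' z" by auto
  moreover have "c * (y - x) \<le> f' z * (y - x)"
    using \<open>x < z\<close> \<open>x < y\<close> \<open>a \<le> x\<close> by (intro mult_right_mono low) auto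
  ultimately show ?thesis by (simp add: mult.commute)
qed simp

lemma semiaxis_constant:
  fixes f :: "real \<Rightarrow> 'a::real_normed_vector"
  assumes f: "\<And>x. 0 \<le> x \<Longrightarrow> (f has_vector_derivative 0) (at x within {0..})" and "0 \<le> x"
  shows "f x = f 0"
  using \<open>0 \<le> x\<close> by (rule_tac has_vector_derivative_zero_constant[of "{0..}" f]) (auto intro: f)

section \<open>Asymptotics of the matrix function S\<close>

locale pe_data =
  fixes \<alpha> S\<^sub>0 :: "complex^'n^'n" and \<gamma>\<^sub>1 :: "complex^'m1^'n" and \<gamma> :: "complex^'m2^'n"
  assumes adm: "admissible \<alpha> S\<^sub>0 \<gamma>\<^sub>1 \<gamma>" and det_S0: "det S\<^sub>0 \<noteq> 0"
begin

definition E :: "complex \<Rightarrow> real \<Rightarrow> complex^'n^'n" where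
  "E c x = mexp ((c * complex_of_real x) *\<^sub>C \<alpha>)"

text \<open>The exponential of the adjoint is kept as a function of its own, so that the adjoint of \<open>E\<close> stays
  visibly analytic in \<open>x\<close>.\<close>

definition F :: "complex \<Rightarrow> real \<Rightarrow> complex^'n^'n" where
  "F c x = mexp ((c * complex_of_real x) *\<^sub>C adj \<alpha>)"

abbreviation S :: "real \<Rightarrow> complex^'n^'n" where
  "S x \<equiv> S_mat \<alpha> S\<^sub>0 \<gamma>\<^sub>1 \<gamma> x"

abbreviation Lam :: "real \<Rightarrow> complex^('m1 + 'm2)^'n" where
  "Lam x \<equiv> Lambda_mat \<alpha> \<gamma>\<^sub>1 \<gamma> x"

lemma S0_herm: "adj S\<^sub>0 = S\<^sub>0"
  and S0_identity: "\<alpha> ** S\<^sub>0 - S\<^sub>0 ** adj \<alpha> = \<i> *\<^sub>C (\<gamma>\<^sub>1 ** adj \<gamma>\<^sub>1 - \<gamma> ** adj \<gamma>)"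
  and spectrum: "mspectrum \<alpha> \<subseteq> {z. Im z \<le> 0}"
  and controllable: "vec.span (\<Union>l<CARD('n). range (\<lambda>y. (mpow \<alpha> l ** \<gamma>) *v y)) = UNIV"
  using adm by (auto simp: admissible_def)

lemma adj_E [simp]: "adj (E c x) = F (cnj c) x"
  and adj_F [simp]: "adj (F c x) = E (cnj c) x"
  by (simp_all add: E_def F_def adj_mexp)

lemma E_0 [simp]: "E c 0 = mat 1" "E 0 x = mat 1"
  and F_0 [simp]: "F c 0 = mat 1" "F 0 x = mat 1"
  by (simp_all add: E_def F_def)

lemma E_entire: "entire_matrix (E c)" and F_entire: "entire_matrix (F c)"
  unfolding E_def F_def by (simp_all add: entire_ext_mexp)

lemma E_mult: "E c x ** E d x = E (c + d) x"
  and F_mult: "F c x ** F d x = F (c + d) x"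
  by (simp_all add: E_def F_def mexp_add [symmetric] distrib_right)

lemma E_inverse: "E c x ** E (- c) x = mat 1" "E (- c) x ** E c x = mat 1"
  and F_inverse: "F c x ** F (- c) x = mat 1" "F (- c) x ** F c x = mat 1"
  using E_mult[of c x "- c"] E_mult[of "- c" x c] F_mult[of c x "- c"] F_mult[of "- c" x c]
  by simp_all

lemma E_commute: "E c x ** \<alpha> = \<alpha> ** E c x"
  and F_commute: "F c x ** adj \<alpha> = adj \<alpha> ** F c x"
  by (simp_all add: E_def F_def mexp_commute)

lemma E_deriv: "(E c has_vector_derivative c *\<^sub>C (\<alpha> ** E c x)) (at x within T)"
  and F_deriv: "(F c has_vector_derivative c *\<^sub>C (adj \<alpha> ** F c x)) (at x within T)"
  unfolding E_def F_def by (rule has_vector_derivative_mexp)+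

lemma Lam_eq: "Lam x = hcat (E (- \<i>) x ** \<gamma>\<^sub>1) (E \<i> x ** \<gamma>)"
  by (simp add: Lambda_mat_def E_def)

lemma adj_Lam_eq: "adj (Lam x) = vcat (adj \<gamma>\<^sub>1 ** F \<i> x) (adj \<gamma> ** F (- \<i>) x)"
  by (simp add: Lam_eq adj_hcat adj_mult)

lemma Lam_deriv: "(Lam has_vector_derivative (- \<i>) *\<^sub>C (\<alpha> ** (Lam x ** j_mat))) (at x within T)"
proof -
  have a: "((\<lambda>x. E (- \<i>) x ** \<gamma>\<^sub>1) has_vector_derivative (- \<i>) *\<^sub>C (\<alpha> ** (E (- \<i>) x ** \<gamma>\<^sub>1))) (at x within T)"
    by (rule has_vector_derivative_eq_rhs[OF has_vector_derivative_matrix_mult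
          [OF E_deriv has_vector_derivative_const]]) (simp add: matrix_mul_assoc)
  have b: "((\<lambda>x. E \<i> x ** \<gamma>) has_vector_derivative \<i> *\<^sub>C (\<alpha> ** (E \<i> x ** \<gamma>))) (at x within T)"
    by (rule has_vector_derivative_eq_rhs[OF has_vector_derivative_matrix_mult
          [OF E_deriv has_vector_derivative_const]]) (simp add: matrix_mul_assoc)
  have "((\<lambda>x. hcat (E (- \<i>) x ** \<gamma>\<^sub>1) (E \<i> x ** \<gamma>)) has_vector_derivative
      hcat ((- \<i>) *\<^sub>C (\<alpha> ** (E (- \<i>) x ** \<gamma>\<^sub>1))) (\<i> *\<^sub>C (\<alpha> ** (E \<i> x ** \<gamma>)))) (at x within T)"
  proof (rule has_vector_derivative_matrixI)
    fix i and k :: "'m1 + 'm2"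
    show "((\<lambda>x. hcat (E (- \<i>) x ** \<gamma>\<^sub>1) (E \<i> x ** \<gamma>) $ i $ k) has_vector_derivative
      hcat ((- \<i>) *\<^sub>C (\<alpha> ** (E (- \<i>) x ** \<gamma>\<^sub>1))) (\<i> *\<^sub>C (\<alpha> ** (E \<i> x ** \<gamma>))) $ i $ k) (at x within T)"
      using bounded_linear.has_vector_derivative[OF bounded_linear_entry a]
        bounded_linear.has_vector_derivative[OF bounded_linear_entry b]
      by (cases k) (simp_all only: hcat_nth)
  qed
  then show ?thesis by (simp add: Lam_eq hcat_j_mat mult_hcat cscale_hcat)
qed

lemma adj_Lam_deriv: "((\<lambda>x. adj (Lam x)) has_vector_derivative \<i> *\<^sub>C (j_mat ** (adj (Lam x) ** adj \<alpha>))) (at x within T)"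
  by (rule has_vector_derivative_eq_rhs[OF has_vector_derivative_adj[OF Lam_deriv]])
     (simp add: adj_mult matrix_mul_assoc)

lemma Lam_entire: "entire_matrix Lam"
proof -
  have "entire_matrix (\<lambda>x. E (- \<i>) x ** \<gamma>\<^sub>1)" "entire_matrix (\<lambda>x. E \<i> x ** \<gamma>)"
    by (intro entire_matrix_mult E_entire F_entire allI entire_ext_const)+
  then show ?thesis unfolding Lam_eq by (simp add: all_sum_iff)
qed

lemma adj_Lam_entire: "entire_matrix (\<lambda>x. adj (Lam x))"
proof -
  have "entire_matrix (\<lambda>x. adj \<gamma>\<^sub>1 ** F \<i> x)" "entire_matrix (\<lambda>x. adj \<gamma> ** F (- \<i>) x)"
    by (intro entire_matrix_mult E_entire F_entire allI entire_ext_const)+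
  then show ?thesis unfolding adj_Lam_eq by (simp add: all_sum_iff)
qed

lemma S_primitive:
  obtains G where "entire_matrix G" "\<And>x T. (G has_vector_derivative Lam x ** adj (Lam x)) (at x within T)"
    "\<And>x. 0 \<le> x \<Longrightarrow> S x = S\<^sub>0 + G x" "G 0 = 0"
proof -
  have "entire_matrix (\<lambda>x. Lam x ** adj (Lam x))"
    by (intro entire_matrix_mult Lam_entire adj_Lam_entire)
  then obtain G where G: "entire_matrix G" "G 0 = 0"
    "\<And>x T. (G has_vector_derivative Lam x ** adj (Lam x)) (at x within T)"
    by (rule entire_matrix_primitive) blast
  have "S x = S\<^sub>0 + G x" if "0 \<le> x" for x
    using integral_unique[OF fundamental_theorem_of_calculus[OF that G(3)]] G(2)
    by (simp add: S_mat_def)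
  with G show ?thesis using that by blast
qed

lemma S_0 [simp]: "S 0 = S\<^sub>0"
  by (simp add: S_mat_def)

lemma S_mero: "mero_matrix S"
proof -
  obtain G where G: "entire_matrix G" "\<And>x. 0 \<le> x \<Longrightarrow> S x = S\<^sub>0 + G x"
    by (rule S_primitive) blast
  have "mero_ext (\<lambda>x. S\<^sub>0 $ i $ k + G x $ i $ k)" for i k
    using G(1) by (intro mero_ext_add mero_ext_const entire_ext_imp_mero_ext) auto
  then show ?thesis using G(2) unfolding mero_ext_def by simp
qed

lemma S_deriv:
  assumes "0 \<le> x"
  shows "(S has_vector_derivative Lam x ** adj (Lam x)) (at x within {0..})"
proof -
  obtain G where G: "\<And>x T. (G has_vector_derivative Lam x ** adj (Lam x)) (at x within T)"
    "\<And>x. 0 \<le> x \<Longrightarrow> S x = S\<^sub>0 + G x"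
    by (rule S_primitive) blast
  have "((\<lambda>x. S\<^sub>0 + G x) has_vector_derivative Lam x ** adj (Lam x)) (at x within {0..})"
    using has_vector_derivative_add[OF has_vector_derivative_const G(1)] by simp
  then show ?thesis
    by (rule has_vector_derivative_transform[rotated 2]) (use assms G(2) in auto)
qed

lemma S_herm:
  assumes "0 \<le> x"
  shows "adj (S x) = S x"
proof -
  have "((\<lambda>x. adj (S x) - S x) has_vector_derivative 0) (at x within {0..})" if "0 \<le> x" for x
    by (rule has_vector_derivative_eq_rhs[OF has_vector_derivative_diff
          [OF has_vector_derivative_adj[OF S_deriv[OF that]] S_deriv[OF that]]])
       (simp add: adj_mult)
  from semiaxis_constant[OF this assms] show ?thesis by (simp add: S0_herm)
qed

lemma Lam_adj_Lam: "Lam x ** adj (Lam x)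
    = E (- \<i>) x ** \<gamma>\<^sub>1 ** adj \<gamma>\<^sub>1 ** F \<i> x + E \<i> x ** \<gamma> ** adj \<gamma> ** F (- \<i>) x"
  by (simp add: Lam_eq adj_hcat adj_mult hcat_mult_vcat matrix_mul_assoc)

lemma Lam_j_adj_Lam: "Lam x ** j_mat ** adj (Lam x)
    = E (- \<i>) x ** \<gamma>\<^sub>1 ** adj \<gamma>\<^sub>1 ** F \<i> x - E \<i> x ** \<gamma> ** adj \<gamma> ** F (- \<i>) x"
  by (simp add: Lam_eq adj_hcat adj_mult hcat_j_mat hcat_mult_vcat matrix_mul_assoc)

text \<open>Both sides have the same derivative, and at \<open>x = 0\<close> the identity is part of admissibility. All
  further algebra of the potential rests on it.\<close>

lemma S_identity:
  assumes "0 \<le> x"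
  shows "\<alpha> ** S x - S x ** adj \<alpha> = \<i> *\<^sub>C (Lam x ** j_mat ** adj (Lam x))"
proof -
  let ?f = "\<lambda>x. \<alpha> ** S x - S x ** adj \<alpha> - \<i> *\<^sub>C (Lam x ** (j_mat ** adj (Lam x)))"
  have "(?f has_vector_derivative 0) (at x within {0..})" if "0 \<le> x" for x
  proof (rule has_vector_derivative_eq_rhs)
    show "(?f has_vector_derivative
        ((\<alpha> ** (Lam x ** adj (Lam x)) + 0 ** S x) - (S x ** 0 + (Lam x ** adj (Lam x)) ** adj \<alpha>)
         - \<i> *\<^sub>C (Lam x ** (j_mat ** (\<i> *\<^sub>C (j_mat ** (adj (Lam x) ** adj \<alpha>))) + 0 ** adj (Lam x))
              + ((- \<i>) *\<^sub>C (\<alpha> ** (Lam x ** j_mat))) ** (j_mat ** adj (Lam x))))) (at x within {0..})"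
      by (intro has_vector_derivative_diff has_vector_derivative_matrix_mult has_vector_derivative_cscale
          has_vector_derivative_const S_deriv that Lam_deriv adj_Lam_deriv)
    have "Lam x ** j_mat ** (j_mat ** X) = Lam x ** X" for X :: "complex^'n^('m1 + 'm2)"
      by (metis j_mat_square matrix_mul_assoc matrix_mul_rid)
    moreover have "j_mat ** (j_mat ** X) = X" for X :: "complex^'n^('m1 + 'm2)"
      by (metis j_mat_square matrix_mul_assoc matrix_mul_lid)
    ultimately show "(\<alpha> ** (Lam x ** adj (Lam x)) + 0 ** S x) - (S x ** 0 + (Lam x ** adj (Lam x)) ** adj \<alpha>)
         - \<i> *\<^sub>C (Lam x ** (j_mat ** (\<i> *\<^sub>C (j_mat ** (adj (Lam x) ** adj \<alpha>))) + 0 ** adj (Lam x))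
              + ((- \<i>) *\<^sub>C (\<alpha> ** (Lam x ** j_mat))) ** (j_mat ** adj (Lam x))) = 0"
      by (simp add: matrix_algebra cscale_minus_left)
  qed
  from semiaxis_constant[OF this assms]
  have "?f x = ?f 0" .
  also have "Lam 0 ** (j_mat ** adj (Lam 0)) = \<gamma>\<^sub>1 ** adj \<gamma>\<^sub>1 - \<gamma> ** adj \<gamma>"
    using Lam_j_adj_Lam[of 0] by (simp add: matrix_mul_assoc)
  finally show ?thesis by (simp add: S0_identity matrix_mul_assoc)
qed

text \<open>For \<open>c = \<i>\<close> and \<open>c = - \<i>\<close> the identity for \<open>S\<close> cancels one of the two Gram terms of
  \<open>\<Lambda> \<Lambda>\<^sup>*\<close> and doubles the other. The two congruent copies \<open>P\<close> and \<open>Q\<close> of \<open>S\<close> below are therefore both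
  increasing; \<open>P\<close> sees only \<open>\<gamma>\<close> and \<open>Q\<close> sees only \<open>\<gamma>\<^sub>1\<close>.\<close>

lemma congruence_deriv:
  assumes "0 \<le> x"
  shows "((\<lambda>x. E c x ** (S x ** F (- c) x)) has_vector_derivative
     E c x ** ((c *\<^sub>C (\<alpha> ** S x - S x ** adj \<alpha>) + Lam x ** adj (Lam x)) ** F (- c) x)) (at x within {0..})"
proof (rule has_vector_derivative_eq_rhs)
  show "((\<lambda>x. E c x ** (S x ** F (- c) x)) has_vector_derivative
      E c x ** (S x ** ((- c) *\<^sub>C (adj \<alpha> ** F (- c) x)) + (Lam x ** adj (Lam x)) ** F (- c) x)
      + (c *\<^sub>C (\<alpha> ** E c x)) ** (S x ** F (- c) x)) (at x within {0..})"
    by (intro has_vector_derivative_matrix_mult E_deriv F_deriv S_deriv assms)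
  have "\<alpha> ** (E c x ** X) = E c x ** (\<alpha> ** X)" for X :: "complex^'n^'n"
    by (simp add: matrix_mul_assoc E_commute)
  then show "E c x ** (S x ** ((- c) *\<^sub>C (adj \<alpha> ** F (- c) x)) + (Lam x ** adj (Lam x)) ** F (- c) x)
      + (c *\<^sub>C (\<alpha> ** E c x)) ** (S x ** F (- c) x)
      = E c x ** ((c *\<^sub>C (\<alpha> ** S x - S x ** adj \<alpha>) + Lam x ** adj (Lam x)) ** F (- c) x)"
    by (simp add: matrix_algebra cscale_minus_left)
qed

definition P :: "real \<Rightarrow> complex^'n^'n" where
  "P x = E \<i> x ** (S x ** F (- \<i>) x)"

definition Q :: "real \<Rightarrow> complex^'n^'n" where
  "Q x = E (- \<i>) x ** (S x ** F \<i> x)"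

lemma P_deriv:
  assumes "0 \<le> x"
  shows "(P has_vector_derivative 2 *\<^sub>C ((E (2 * \<i>) x ** \<gamma>) ** adj (E (2 * \<i>) x ** \<gamma>))) (at x within {0..})"
proof -
  have "(\<lambda>x. E \<i> x ** (S x ** F (- \<i>) x)) = P" by (simp add: P_def fun_eq_iff)
  moreover have "\<i> *\<^sub>C (\<alpha> ** S x - S x ** adj \<alpha>) + Lam x ** adj (Lam x)
      = 2 *\<^sub>C (E \<i> x ** \<gamma> ** adj \<gamma> ** F (- \<i>) x)"
    unfolding S_identity[OF assms] Lam_j_adj_Lam Lam_adj_Lam
    by (simp add: vec_eq_iff)
  moreover have "E \<i> x ** (2 *\<^sub>C (E \<i> x ** \<gamma> ** adj \<gamma> ** F (- \<i>) x) ** F (- \<i>) x)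
      = 2 *\<^sub>C ((E \<i> x ** E \<i> x) ** \<gamma> ** adj \<gamma> ** (F (- \<i>) x ** F (- \<i>) x))"
    by (simp add: matrix_mul_assoc)
  ultimately show ?thesis using congruence_deriv[OF assms, of \<i>]
    by (simp add: E_mult F_mult adj_mult matrix_mul_assoc)
qed

lemma Q_deriv:
  assumes "0 \<le> x"
  shows "(Q has_vector_derivative
    2 *\<^sub>C ((E (- 2 * \<i>) x ** \<gamma>\<^sub>1) ** adj (E (- 2 * \<i>) x ** \<gamma>\<^sub>1))) (at x within {0..})"
proof -
  have "(\<lambda>x. E (- \<i>) x ** (S x ** F (- (- \<i>)) x)) = Q" by (simp add: Q_def fun_eq_iff)
  moreover have "(- \<i>) *\<^sub>C (\<alpha> ** S x - S x ** adj \<alpha>) + Lam x ** adj (Lam x)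
      = 2 *\<^sub>C (E (- \<i>) x ** \<gamma>\<^sub>1 ** adj \<gamma>\<^sub>1 ** F \<i> x)"
    unfolding S_identity[OF assms] Lam_j_adj_Lam Lam_adj_Lam
    by (simp add: vec_eq_iff)
  moreover have "E (- \<i>) x ** (2 *\<^sub>C (E (- \<i>) x ** \<gamma>\<^sub>1 ** adj \<gamma>\<^sub>1 ** F \<i> x) ** F \<i> x)
      = 2 *\<^sub>C ((E (- \<i>) x ** E (- \<i>) x) ** \<gamma>\<^sub>1 ** adj \<gamma>\<^sub>1 ** (F \<i> x ** F \<i> x))"
    by (simp add: matrix_mul_assoc)
  ultimately show ?thesis using congruence_deriv[OF assms, of "- \<i>"]
    by (simp add: E_mult F_mult adj_mult matrix_mul_assoc)
qed

end

section \<open>Growth in the directions seen by \<gamma>\<close>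

lemma quadratic_form_deriv:
  fixes A :: "real \<Rightarrow> complex^'n^'n" and K :: "complex^'m^'n"
  assumes "(A has_vector_derivative 2 *\<^sub>C (K ** adj K)) (at x within T)"
  shows "((\<lambda>x. y \<bullet> (A x *v y)) has_vector_derivative 2 * (norm (adj K *v y))\<^sup>2) (at x within T)"
proof -
  have "((\<lambda>x. y \<bullet> (A x *v y)) has_vector_derivative y \<bullet> ((2 *\<^sub>C (K ** adj K)) *v y)) (at x within T)"
    by (rule bounded_linear.has_vector_derivative[OF bounded_linear_quadratic_form assms])
  also have "(2 *\<^sub>C (K ** adj K)) *v y = 2 *\<^sub>R (K *v (adj K *v y))"
    by (simp add: cscale_vector matrix_vector_mul_assoc vec_eq_iff scaleR_conv_of_real[where 'a = complex])
  also have "y \<bullet> (2 *\<^sub>R (K *v (adj K *v y))) = 2 * (norm (adj K *v y))\<^sup>2"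
    by (simp add: inner_matrix_vector power2_norm_eq_inner)
  finally show ?thesis .
qed

context pe_data begin

definition P_form :: "complex^'n \<Rightarrow> real \<Rightarrow> real" where
  "P_form y x = y \<bullet> (P x *v y)"

lemma P_form_deriv:
  assumes "0 \<le> x"
  shows "(P_form y has_vector_derivative 2 * (norm (adj \<gamma> *v (F (- 2 * \<i>) x *v y)))\<^sup>2) (at x within {0..})"
proof -
  have "(\<lambda>x. y \<bullet> (P x *v y)) = P_form y" by (simp add: P_form_def fun_eq_iff)
  then show ?thesis
    using quadratic_form_deriv[OF P_deriv[OF assms], of y]
    by (simp add: adj_mult matrix_vector_mul_assoc)
qed

lemma P_form_mono: "0 \<le> x \<Longrightarrow> x \<le> x' \<Longrightarrow> P_form y x \<le> P_form y x'"
  using semiaxis_growth[of 0 "P_form y" _ 0 x x', OF P_form_deriv] by auto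

lemma P_form_add: "P_form (y + z) x + P_form (y - z) x = 2 * P_form y x + 2 * P_form z x"
  by (simp add: P_form_def algebra_simps inner_add_left inner_add_right inner_diff_left inner_diff_right)

lemma P_form_scale: "P_form (c *s y) x = (norm c)\<^sup>2 * P_form y x"
proof -
  have "cnj c * c = complex_of_real ((norm c)\<^sup>2)"
    by (simp only: complex_norm_square mult.commute)
  then have "cnj c *s (P x *v (c *s y)) = (norm c)\<^sup>2 *\<^sub>R (P x *v y)"
    by (simp add: vec.scale vec_eq_iff mult.assoc [symmetric] scaleR_conv_of_real[where 'a = complex])
  then show ?thesis by (simp add: P_form_def inner_cscale_vector)
qed

text \<open>The derivative of the form depends on \<open>y\<close> only through the orbit of \<open>y\<close> under the flow, so
  translating the orbit changes the form by a translation of the argument and a constant.\<close>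

lemma P_form_shift:
  assumes "0 \<le> s" "0 \<le> x"
  shows "P_form (F (- 2 * \<i>) s *v y) x = P_form y (x + s) + (P_form (F (- 2 * \<i>) s *v y) 0 - P_form y s)"
proof -
  have "((\<lambda>x. P_form (F (- 2 * \<i>) s *v y) x - P_form y (x + s)) has_vector_derivative 0) (at x within {0..})"
    if "0 \<le> x" for x
  proof (rule has_vector_derivative_eq_rhs[OF has_vector_derivative_diff])
    show "(P_form (F (- 2 * \<i>) s *v y) has_vector_derivative
        2 * (norm (adj \<gamma> *v (F (- 2 * \<i>) x *v (F (- 2 * \<i>) s *v y))))\<^sup>2) (at x within {0..})"
      by (rule P_form_deriv[OF that])
    have "((P_form y \<circ> (\<lambda>x. x + s)) has_vector_derivative
        1 *\<^sub>R (2 * (norm (adj \<gamma> *v (F (- 2 * \<i>) (x + s) *v y)))\<^sup>2)) (at x within {0..})"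
    proof (rule vector_diff_chain_within)
      show "((\<lambda>x. x + s) has_vector_derivative 1) (at x within {0..})"
        by (auto intro!: derivative_eq_intros)
      show "(P_form y has_vector_derivative 2 * (norm (adj \<gamma> *v (F (- 2 * \<i>) (x + s) *v y)))\<^sup>2)
          (at (x + s) within (\<lambda>x. x + s) ` {0..})"
        using that \<open>0 \<le> s\<close> by (intro has_vector_derivative_within_subset[OF P_form_deriv]) auto
    qed
    then show "((\<lambda>x. P_form y (x + s)) has_vector_derivative
        2 * (norm (adj \<gamma> *v (F (- 2 * \<i>) (x + s) *v y)))\<^sup>2) (at x within {0..})"
      by (simp add: o_def)
    have "F (- 2 * \<i>) x ** F (- 2 * \<i>) s = F (- 2 * \<i>) (x + s)"
      by (simp only: F_def mexp_add [symmetric] distrib_left of_real_add)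
    then show "2 * (norm (adj \<gamma> *v (F (- 2 * \<i>) x *v (F (- 2 * \<i>) s *v y))))\<^sup>2
        - 2 * (norm (adj \<gamma> *v (F (- 2 * \<i>) (x + s) *v y)))\<^sup>2 = 0"
      by (simp add: matrix_vector_mul_assoc matrix_mul_assoc [symmetric])
  qed
  from semiaxis_constant[OF this \<open>0 \<le> x\<close>] show ?thesis by simp
qed

definition bounded_directions :: "(complex^'n) set" where
  "bounded_directions = {y. \<exists>B. \<forall>x\<ge>0. P_form y x \<le> B}"

text \<open>Sums are handled by the parallelogram identity: the form at \<open>y - z\<close> increases, so it is bounded
  below by its value at \<open>0\<close>.\<close>

lemma bounded_directions_subspace: "vec.subspace bounded_directions"
proof (rule vec.subspaceI)
  show "0 \<in> bounded_directions"
    by (auto simp: bounded_directions_def P_form_def)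
  fix y z assume "y \<in> bounded_directions" "z \<in> bounded_directions"
  then obtain B C where BC: "\<And>x. 0 \<le> x \<Longrightarrow> P_form y x \<le> B" "\<And>x. 0 \<le> x \<Longrightarrow> P_form z x \<le> C"
    by (auto simp: bounded_directions_def)
  have "P_form (y + z) x \<le> 2 * B + 2 * C - P_form (y - z) 0" if "0 \<le> x" for x
    using P_form_add[of y z x] BC(1)[OF that] BC(2)[OF that] P_form_mono[of 0 x "y - z"] that by linarith
  then show "y + z \<in> bounded_directions"
    by (auto simp: bounded_directions_def)
next
  fix c y assume "y \<in> bounded_directions"
  then obtain B where "\<And>x. 0 \<le> x \<Longrightarrow> P_form y x \<le> B" by (auto simp: bounded_directions_def)
  then have "P_form (c *s y) x \<le> (norm c)\<^sup>2 * B" if "0 \<le> x" for x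
    using that by (simp add: P_form_scale mult_left_mono)
  then show "c *s y \<in> bounded_directions" by (auto simp: bounded_directions_def)
qed

lemma bounded_directions_flow:
  assumes "y \<in> bounded_directions" "0 \<le> s"
  shows "F (- 2 * \<i>) s *v y \<in> bounded_directions"
proof -
  obtain B where "\<And>x. 0 \<le> x \<Longrightarrow> P_form y x \<le> B" using assms(1) by (auto simp: bounded_directions_def)
  then have "P_form (F (- 2 * \<i>) s *v y) x \<le> B + (P_form (F (- 2 * \<i>) s *v y) 0 - P_form y s)" if "0 \<le> x" for x
    using P_form_shift[OF assms(2) that, of y] assms(2) that by simp
  then show ?thesis by (auto simp: bounded_directions_def)
qed

text \<open>The subspace is invariant under the flow and, being finite-dimensional, closed. It therefore
  contains the derivative of the flow at \<open>0\<close>, a nonzero multiple of \<open>\<alpha>\<^sup>* y\<close>.\<close>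

lemma bounded_directions_invariant:
  assumes "y \<in> bounded_directions"
  shows "adj \<alpha> *v y \<in> bounded_directions"
proof -
  let ?N = bounded_directions
  have scaleR: "r *\<^sub>R v \<in> ?N" if "v \<in> ?N" for r v
  proof -
    have "r *\<^sub>R v = complex_of_real r *s v"
      by (simp add: vec_eq_iff scaleR_conv_of_real[where 'a = complex])
    then show ?thesis using that vec.subspace_scale[OF bounded_directions_subspace] by simp
  qed
  have "subspace ?N"
    using bounded_directions_subspace scaleR
    by (auto simp: subspace_def vec.subspace_def)
  then have "closed ?N" by (rule closed_subspace)
  moreover have "((\<lambda>s. (1 / (s - 0)) *\<^sub>R (F (- 2 * \<i>) s *v y - F (- 2 * \<i>) 0 *v y))
      \<longlongrightarrow> ((- 2 * \<i>) *\<^sub>C (adj \<alpha> ** F (- 2 * \<i>) 0)) *v y) (at 0 within {0..})"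
    using bounded_linear.has_vector_derivative[OF bounded_bilinear.bounded_linear_left
          [OF bounded_bilinear_matrix_vector_mult] F_deriv]
    unfolding has_vector_derivative_iff_quotient .
  moreover have "eventually (\<lambda>s. (1 / (s - 0)) *\<^sub>R (F (- 2 * \<i>) s *v y - F (- 2 * \<i>) 0 *v y) \<in> ?N)
      (at 0 within {0..})"
    unfolding eventually_at_filter
    by (intro always_eventually allI impI scaleR vec.subspace_diff[OF bounded_directions_subspace]
        bounded_directions_flow assms) auto
  moreover have "at (0::real) within {0..} \<noteq> bot"
  proof -
    have "at_right (0::real) \<le> at 0 within {0..}" by (intro at_le) auto
    then show ?thesis using trivial_limit_at_right_real[of "0::real"] by (auto simp: bot_unique)
  qed
  ultimately have "((- 2 * \<i>) *\<^sub>C (adj \<alpha> ** F (- 2 * \<i>) 0)) *v y \<in> ?N"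
    by (intro Lim_in_closed_set)
  moreover have "((- 2 * \<i>) *\<^sub>C (adj \<alpha> ** F (- 2 * \<i>) 0)) *v y = (- 2 * \<i>) *s (adj \<alpha> *v y)"
    unfolding cscale_vector by simp
  ultimately have "(1 / (- 2 * \<i>)) *s ((- 2 * \<i>) *s (adj \<alpha> *v y)) \<in> ?N"
    using vec.subspace_scale[OF bounded_directions_subspace] by metis
  moreover have "(1 / (- 2 * \<i>)) * (- 2 * \<i>) = 1" by simp
  ultimately show ?thesis by (simp only: vec.scale_scale vec.scale_one)
qed

lemma adj_eigenvalue_Im_nonneg:
  assumes "adj \<alpha> *v y = \<beta> *s y" "y \<noteq> 0"
  shows "0 \<le> Im \<beta>"
proof -
  have "\<not> invertible (mat (cnj \<beta>) - \<alpha>)"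
  proof
    assume "invertible (mat (cnj \<beta>) - \<alpha>)"
    then obtain B where "(mat (cnj \<beta>) - \<alpha>) ** B = mat 1" unfolding invertible_def by auto
    then have "adj ((mat (cnj \<beta>) - \<alpha>) ** B) = mat 1" by simp
    then have "adj B ** (mat \<beta> - adj \<alpha>) = mat 1" by (simp add: adj_mult adj_diff)
    then have "y = adj B *v ((mat \<beta> - adj \<alpha>) *v y)"
      by (simp add: matrix_vector_mul_assoc)
    also have "mat \<beta> *v y = \<beta> *s y"
      by (subst mat_eq_cscale) (simp add: cscale_vector)
    then have "(mat \<beta> - adj \<alpha>) *v y = 0"
      by (simp add: matrix_vector_mult_diff_rdistrib assms)
    finally show False using assms(2) by simp
  qed
  then have "cnj \<beta> \<in> mspectrum \<alpha>" by (simp add: mspectrum_def)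
  then show ?thesis using spectrum by auto
qed

text \<open>The eigenvector is orthogonal to the images of all \<open>\<alpha>\<^sup>l \<gamma>\<close>, which span the whole space.\<close>

lemma observability:
  assumes "adj \<alpha> *v y = \<beta> *s y" "adj \<gamma> *v y = 0"
  shows "y = 0"
proof -
  have pow: "mpow (adj \<alpha>) l *v y = \<beta> ^ l *s y" for l
    by (induction l) (simp_all add: assms matrix_vector_mul_assoc [symmetric] vec.scale mult.commute)
  let ?T = "{v. \<forall>c. (c *s y) \<bullet> v = 0}"
  have "vec.subspace ?T"
  proof (rule vec.subspaceI)
    show "d *s v \<in> ?T" if "v \<in> ?T" for d v
    proof -
      have "(c *s y) \<bullet> (d *s v) = ((cnj d * c) *s y) \<bullet> v" for c
        using inner_cscale_vector[of "cnj d" "c *s y" v] by simp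
      then show ?thesis using that by simp
    qed
  qed (auto simp: inner_add_right)
  moreover have "(\<Union>l<CARD('n). range (\<lambda>u. (mpow \<alpha> l ** \<gamma>) *v u)) \<subseteq> ?T"
  proof clarsimp
    fix l u c
    have "adj (mpow \<alpha> l ** \<gamma>) *v (c *s y) = 0"
      by (simp add: adj_mult adj_mpow matrix_vector_mul_assoc [symmetric] vec.scale pow assms)
    then show "(c *s y) \<bullet> ((mpow \<alpha> l ** \<gamma>) *v u) = 0"
      by (simp add: inner_matrix_vector)
  qed
  ultimately have "vec.span (\<Union>l<CARD('n). range (\<lambda>u. (mpow \<alpha> l ** \<gamma>) *v u)) \<subseteq> ?T"
    by (intro vec.span_minimal)
  then have "(1 *s y) \<bullet> y = 0" unfolding controllable by blast
  then show ?thesis by simp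
qed

text \<open>Otherwise there is an eigenvector \<open>v\<close> of \<open>\<alpha>\<^sup>*\<close> among the bounded directions. Its eigenvalue lies in
  the closed upper half-plane, so the derivative of its form never falls below
  \<open>2 \<bar>\<gamma>\<^sup>* v\<bar>\<^sup>2\<close>. Boundedness gives \<open>\<gamma>\<^sup>* v = 0\<close>, which contradicts observability.\<close>

lemma no_bounded_directions:
  assumes "y \<in> bounded_directions"
  shows "y = 0"
proof (rule ccontr)
  assume "y \<noteq> 0"
  from invariant_subspace_has_eigenvector[OF bounded_directions_subspace bounded_directions_invariant assms this]
  obtain v \<beta> where v: "v \<in> bounded_directions" "v \<noteq> 0" "adj \<alpha> *v v = \<beta> *s v" by auto
  have Im: "0 \<le> Im \<beta>" by (rule adj_eigenvalue_Im_nonneg[OF v(3,2)])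
  define r where "r = 2 * (norm (adj \<gamma> *v v))\<^sup>2"
  have "r \<le> 2 * (norm (adj \<gamma> *v (F (- 2 * \<i>) x *v v)))\<^sup>2" if "0 \<le> x" for x
  proof -
    have "F (- 2 * \<i>) x *v v = exp ((- 2 * \<i> * complex_of_real x) * \<beta>) *s v"
      unfolding F_def by (rule mexp_eigenvector[OF v(3)])
    then have "norm (adj \<gamma> *v (F (- 2 * \<i>) x *v v)) = exp (2 * x * Im \<beta>) * norm (adj \<gamma> *v v)"
      by (simp add: vec.scale norm_cscale_vector)
    moreover have "1 * norm (adj \<gamma> *v v) \<le> exp (2 * x * Im \<beta>) * norm (adj \<gamma> *v v)"
      using Im that by (intro mult_right_mono) auto
    ultimately show ?thesis unfolding r_def by (simp add: power_mono)
  qed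
  from semiaxis_growth[of 0 "P_form v" _ r 0, OF P_form_deriv this] have grow: "r * x \<le> P_form v x - P_form v 0" if "0 \<le> x" for x
    using that by fastforce
  obtain B where B: "\<And>x. 0 \<le> x \<Longrightarrow> P_form v x \<le> B" using v(1) by (auto simp: bounded_directions_def)
  have "r = 0"
  proof (rule ccontr)
    assume "r \<noteq> 0"
    then have "0 < r" unfolding r_def by simp
    \<comment> \<open>The argument is chosen beyond the point where linear growth of slope \<open>r\<close> exceeds the bound.\<close>
    then have "r * ((\<bar>B - P_form v 0\<bar> + 1) / r) \<le> B - P_form v 0"
      using grow[of "(\<bar>B - P_form v 0\<bar> + 1) / r"] B[of "(\<bar>B - P_form v 0\<bar> + 1) / r"] by simp
    then show False using \<open>0 < r\<close> by simp
  qed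
  then have "adj \<gamma> *v v = 0" by (simp add: r_def)
  from observability[OF v(3) this] v(2) show False by simp
qed

text \<open>A Dini argument: on the unit sphere the sets where the form is still at most \<open>M\<close> at time \<open>k\<close> are
  compact and decrease with \<open>k\<close>. If none were empty, a common point would be a bounded direction.\<close>

lemma P_form_uniform_growth: "\<exists>X\<ge>0. \<forall>x\<ge>X. \<forall>y. M * (norm y)\<^sup>2 \<le> P_form y x"
proof -
  define K where "K k = {y \<in> sphere 0 1. P_form y (real k) \<le> M}" for k
  have "\<exists>k. K k = {}"
  proof (rule ccontr)
    assume "\<nexists>k. K k = {}"
    moreover have "compact (K k)" for k
    proof -
      have "continuous_on UNIV (\<lambda>y. P_form y (real k))"
        unfolding P_form_def by (intro continuous_intros linear_continuous_on
            bounded_bilinear.bounded_linear_right[OF bounded_bilinear_matrix_vector_mult])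
      then have "closed {y. P_form y (real k) \<le> M}"
        by (intro closed_Collect_le) auto
      moreover have "K k = sphere 0 1 \<inter> {y. P_form y (real k) \<le> M}" by (auto simp: K_def)
      ultimately show ?thesis by (simp add: compact_Int_closed)
    qed
    moreover have "K n \<subseteq> K m" if "m \<le> n" for m n
    proof -
      have "P_form y (real m) \<le> P_form y (real n)" for y using that by (intro P_form_mono) auto
      then show ?thesis unfolding K_def using order_trans by blast
    qed
    ultimately have "\<Inter> (range K) \<noteq> {}" by (intro compact_nest) auto
    then obtain y where y: "\<And>k. y \<in> K k" by auto
    have "P_form y x \<le> M" if "0 \<le> x" for x
    proof -
      have "P_form y x \<le> P_form y (real (nat \<lceil>x\<rceil>))" using that by (intro P_form_mono) linarith+
      also have "\<dots> \<le> M" using y by (auto simp: K_def)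
      finally show ?thesis .
    qed
    then have "y \<in> bounded_directions" by (auto simp: bounded_directions_def)
    then have "y = 0" by (rule no_bounded_directions)
    then show False using y[of 0] by (simp add: K_def)
  qed
  then obtain k where k: "K k = {}" by auto
  have "M * (norm y)\<^sup>2 \<le> P_form y x" if "real k \<le> x" for x y
  proof (cases "y = 0")
    case False
    let ?c = "complex_of_real (1 / norm y)"
    have "?c *s y \<in> sphere 0 1" using False by (simp add: norm_cscale_vector norm_divide)
    then have "M < P_form (?c *s y) (real k)" using k unfolding K_def by force
    also have "\<dots> \<le> P_form (?c *s y) x" using that by (intro P_form_mono) auto
    also have "\<dots> = P_form y x / (norm y)\<^sup>2" by (simp add: P_form_scale norm_divide power_divide)
    finally show ?thesis using False by (simp add: field_simps)
  qed (simp add: P_form_def)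
  then show ?thesis by (intro exI[of _ "real k"]) auto
qed

end

section \<open>Limits at infinity of the congruent forms of S\<close>

lemma norm_lower_bound_of_form:
  fixes A :: "complex^'n^'n"
  assumes "M * (norm y)\<^sup>2 \<le> y \<bullet> (A *v y)"
  shows "M * norm y \<le> norm (A *v y)"
proof (cases "y = 0")
  case False
  have "M * norm y * norm y \<le> norm (A *v y) * norm y"
    using assms norm_cauchy_schwarz[of y "A *v y"] by (simp add: power2_eq_square mult_ac)
  then show ?thesis using False by simp
qed simp

lemma det_nonzero_of_form:
  fixes A :: "complex^'n^'n"
  assumes "\<And>y. (norm y)\<^sup>2 \<le> y \<bullet> (A *v y)"
  shows "det A \<noteq> 0"
proof -
  have "y = 0" if "A *v y = 0" for y
    using norm_lower_bound_of_form[of 1 y A] assms[of y] that by simp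
  then have "\<exists>B. B ** A = mat 1" by (simp add: matrix_left_invertible_ker)
  then show ?thesis using invertible_det_nz invertible_left_inverse by blast
qed

lemma tendsto_zero_matrixI:
  fixes A :: "real \<Rightarrow> complex^'n^'n"
  assumes "\<And>y M. 0 < M \<Longrightarrow> eventually (\<lambda>x. M * norm (A x *v y) \<le> B y) F"
  shows "(A \<longlongrightarrow> 0) F"
proof (rule tendsto_matrixI)
  fix i k
  have "((\<lambda>x. A x *v axis k 1) \<longlongrightarrow> 0) F"
  proof (rule tendstoI)
    fix e :: real assume "0 < e"
    define M where "M = (\<bar>B (axis k 1)\<bar> + 1) / e"
    have "0 < M" using \<open>0 < e\<close> by (simp add: M_def)
    from assms[OF this, of "axis k 1"] show "eventually (\<lambda>x. dist (A x *v axis k 1) 0 < e) F"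
    proof eventually_elim
      case (elim x)
      then have "M * norm (A x *v axis k 1) < M * e"
        using \<open>0 < e\<close> by (simp add: M_def)
      then show ?case using \<open>0 < M\<close> by simp
    qed
  qed
  from tendsto_vec_nth[OF this, of i]
  show "((\<lambda>x. A x $ i $ k) \<longlongrightarrow> 0 $ i $ k) F"
    by (simp add: matrix_vector_nth axis_def if_distrib[of "\<lambda>c. _ * c"] cong: if_cong)
qed

context pe_data begin

definition Sinv :: "real \<Rightarrow> complex^'n^'n" where
  "Sinv x = cramer_inv (S x)"

definition Pinv :: "real \<Rightarrow> complex^'n^'n" where
  "Pinv x = F \<i> x ** (Sinv x ** E (- \<i>) x)"

definition Qinv :: "real \<Rightarrow> complex^'n^'n" where
  "Qinv x = F (- \<i>) x ** (Sinv x ** E \<i> x)"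

text \<open>The off-diagonal blocks of the Darboux matrix contain this matrix, which combines the left factor of
  \<open>Qinv\<close> with the right factor of \<open>Pinv\<close>.\<close>

definition Mixed :: "real \<Rightarrow> complex^'n^'n" where
  "Mixed x = F (- \<i>) x ** (Sinv x ** E (- \<i>) x)"

lemma EF_cancel:
  "E c x ** (E (- c) x ** X) = X" "E (- c) x ** (E c x ** X) = X"
  "F c x ** (F (- c) x ** X') = X'" "F (- c) x ** (F c x ** X') = X'"
  by (simp_all add: matrix_mul_assoc E_inverse F_inverse)

lemma EF_cancel_i:
  "E \<i> x ** (E (- \<i>) x ** X) = X" "E (- \<i>) x ** (E \<i> x ** X) = X"
  "F \<i> x ** (F (- \<i>) x ** X') = X'" "F (- \<i>) x ** (F \<i> x ** X') = X'"
  "E \<i> x ** E (- \<i>) x = mat 1" "E (- \<i>) x ** E \<i> x = mat 1"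
  "F \<i> x ** F (- \<i>) x = mat 1" "F (- \<i>) x ** F \<i> x = mat 1"
  by (simp_all add: EF_cancel E_inverse F_inverse)

context
  fixes x assumes S_det: "det (S x) \<noteq> 0"
begin

lemma S_Sinv: "S x ** Sinv x = mat 1" "Sinv x ** S x = mat 1"
  "S x ** (Sinv x ** X) = X" "Sinv x ** (S x ** X) = X"
  using cramer_inv_mult[OF S_det] by (simp_all add: Sinv_def matrix_mul_assoc)

lemma P_Pinv: "P x ** Pinv x = mat 1" and Q_Qinv: "Q x ** Qinv x = mat 1"
  by (simp_all add: P_def Pinv_def Q_def Qinv_def matrix_mul_assoc [symmetric] EF_cancel_i S_Sinv)

lemma Qinv_eq: "Qinv x = matrix_inv (Q x)" "Qinv x = cramer_inv (Q x)"
proof -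
  show 1: "Qinv x = matrix_inv (Q x)" using matrix_inv_eqI(1)[OF Q_Qinv] by simp
  have "det (Q x) \<noteq> 0" using matrix_inv_eqI(2)[OF Q_Qinv] by (simp add: invertible_det_nz)
  then show "Qinv x = cramer_inv (Q x)" using 1 by (simp add: cramer_inv_eq)
qed

lemma Sinv_herm: "0 \<le> x \<Longrightarrow> adj (Sinv x) = Sinv x"
  using left_inverse_unique[of "adj (Sinv x)" "S x" "Sinv x", OF _ S_Sinv(1)] arg_cong[OF S_Sinv(1), of adj]
  by (simp add: adj_mult S_herm)

lemma Qinv_herm: "0 \<le> x \<Longrightarrow> adj (Qinv x) = Qinv x"
  by (simp add: Qinv_def adj_mult Sinv_herm matrix_mul_assoc)

lemma adj_Mixed: "0 \<le> x \<Longrightarrow> adj (Mixed x) = F \<i> x ** (Sinv x ** E \<i> x)"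
  by (simp add: Mixed_def adj_mult Sinv_herm matrix_mul_assoc)

text \<open>This relation lets the growth of \<open>P\<close> and the boundedness of \<open>Qinv\<close> force \<open>Mixed\<close> to zero.\<close>

lemma Mixed_P_Mixed: "0 \<le> x \<Longrightarrow> Mixed x ** (P x ** adj (Mixed x)) = Qinv x"
  by (simp only: adj_Mixed)
     (simp add: Mixed_def P_def Qinv_def matrix_mul_assoc [symmetric] EF_cancel_i S_Sinv)

lemma Qinv_form: "0 \<le> x \<Longrightarrow> y \<bullet> (Qinv x *v y) = P_form (adj (Mixed x) *v y) x"
  by (simp add: Mixed_P_Mixed [symmetric] matrix_vector_mul_assoc [symmetric] P_form_def inner_matrix_vector)

lemma Sinv_identity:
  assumes "0 \<le> x"
  shows "Sinv x ** \<alpha> - adj \<alpha> ** Sinv x = \<i> *\<^sub>C (Sinv x ** Lam x ** j_mat ** adj (Lam x) ** Sinv x)"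
proof -
  have "Sinv x ** ((\<alpha> ** S x - S x ** adj \<alpha>) ** Sinv x) = Sinv x ** \<alpha> - adj \<alpha> ** Sinv x"
    by (simp add: matrix_algebra S_Sinv)
  then show ?thesis unfolding S_identity[OF assms] by (simp add: matrix_mul_assoc)
qed

text \<open>The identity for the inverse of \<open>S\<close> seen in the frame of \<open>Q\<close>: the \<open>\<gamma>\<^sub>1\<close> term picks up two factors
  \<open>Mixed\<close> and so disappears in the limit, which leaves a Riccati equation for \<open>\<kappa>\<^sub>R\<close>.\<close>

lemma Qinv_identity:
  assumes "0 \<le> x"
  shows "Qinv x ** \<alpha> - adj \<alpha> ** Qinv x
    = \<i> *\<^sub>C (Mixed x ** (\<gamma>\<^sub>1 ** adj \<gamma>\<^sub>1) ** adj (Mixed x) - Qinv x ** (\<gamma> ** adj \<gamma>) ** Qinv x)"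
proof -
  have "Qinv x ** \<alpha> - adj \<alpha> ** Qinv x = F (- \<i>) x ** ((Sinv x ** \<alpha> - adj \<alpha> ** Sinv x) ** E \<i> x)"
    by (simp add: Qinv_def mult_diff_matrix matrix_mul_assoc [symmetric] E_commute)
       (simp add: matrix_mul_assoc F_commute)
  also have "\<dots> = \<i> *\<^sub>C (F (- \<i>) x ** Sinv x ** (Lam x ** j_mat ** adj (Lam x)) ** Sinv x ** E \<i> x)"
    unfolding Sinv_identity[OF assms] by (simp add: matrix_mul_assoc)
  also have "\<dots> = \<i> *\<^sub>C (Mixed x ** (\<gamma>\<^sub>1 ** adj \<gamma>\<^sub>1) ** adj (Mixed x) - Qinv x ** (\<gamma> ** adj \<gamma>) ** Qinv x)"
    unfolding Lam_j_adj_Lam adj_Mixed[OF assms]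
    by (simp add: Mixed_def Qinv_def mult_diff_matrix matrix_mul_assoc)
  finally show ?thesis .
qed

end

lemma P_dominates:
  assumes "0 < M"
  shows "eventually (\<lambda>x. 0 \<le> x \<and> det (S x) \<noteq> 0 \<and> (\<forall>y. M * (norm y)\<^sup>2 \<le> P_form y x)) at_top"
proof -
  obtain X where X: "0 \<le> X" "\<And>x y. X \<le> x \<Longrightarrow> max M 1 * (norm y)\<^sup>2 \<le> P_form y x"
    using P_form_uniform_growth[of "max M 1"] by auto
  have "0 \<le> x \<and> det (S x) \<noteq> 0 \<and> (\<forall>y. M * (norm y)\<^sup>2 \<le> P_form y x)" if "X \<le> x" for x
  proof (intro conjI allI)
    show "0 \<le> x" using X(1) that by simp
    have "N * (norm y)\<^sup>2 \<le> P_form y x" if "N \<le> max M 1" for N y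
      using X(2)[OF \<open>X \<le> x\<close>, of y] mult_right_mono[OF that, of "(norm y)\<^sup>2"] by simp
    from this[of M] this[of 1] show "M * (norm y)\<^sup>2 \<le> P_form y x" for y by simp
    have "det (P x) \<noteq> 0"
      by (rule det_nonzero_of_form) (use \<open>\<And>N y. N \<le> max M 1 \<Longrightarrow> N * (norm y)\<^sup>2 \<le> P_form y x\<close>[of 1] in \<open>simp add: P_form_def\<close>)
    then show "det (S x) \<noteq> 0" by (simp add: P_def det_mul)
  qed
  then show ?thesis by (auto simp: eventually_at_top_linorder)
qed

lemma eventually_S_det: "eventually (\<lambda>x. 0 \<le> x \<and> det (S x) \<noteq> 0) at_top"
  using P_dominates[of 1] by (rule eventually_mono) auto

lemma Pinv_tendsto_0: "(Pinv \<longlongrightarrow> 0) at_top"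
proof (rule tendsto_zero_matrixI)
  fix y and M :: real assume "0 < M"
  from P_dominates[OF this] show "eventually (\<lambda>x. M * norm (Pinv x *v y) \<le> norm y) at_top"
  proof eventually_elim
    case (elim x)
    then have "M * norm (Pinv x *v y) \<le> norm (P x *v (Pinv x *v y))"
      by (intro norm_lower_bound_of_form) (auto simp: P_form_def)
    also have "P x *v (Pinv x *v y) = y"
      using elim by (simp add: matrix_vector_mul_assoc P_Pinv)
    finally show ?case .
  qed
qed

lemma Qinv_deriv:
  assumes "0 \<le> x" "det (S x) \<noteq> 0"
  defines "H \<equiv> Qinv x ** (E (- 2 * \<i>) x ** \<gamma>\<^sub>1)"
  shows "((\<lambda>x. - cramer_inv (Q x)) has_vector_derivative 2 *\<^sub>C (H ** adj H)) (at x within {0..})"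
proof -
  have "det (Q x) \<noteq> 0"
    using matrix_inv_eqI(2)[OF Q_Qinv[OF assms(2)]] by (simp add: invertible_det_nz)
  from has_vector_derivative_minus[OF has_vector_derivative_cramer_inv[OF Q_deriv[OF assms(1)] this]]
  show ?thesis
    by (simp add: Qinv_eq(2)[OF assms(2), symmetric] H_def adj_mult Qinv_herm[OF assms(2,1)] matrix_mul_assoc)
qed

text \<open>\<open>Q\<close> increases, so its inverse decreases; its form is a value of the form of \<open>P\<close>, which is
  eventually nonnegative.\<close>

lemma Qinv_converges: "\<exists>L. (Qinv \<longlongrightarrow> L) at_top"
proof -
  obtain X where X: "\<And>x. X \<le> x \<Longrightarrow> 0 \<le> x \<and> det (S x) \<noteq> 0 \<and> (\<forall>y. 1 * (norm y)\<^sup>2 \<le> P_form y x)"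
    using P_dominates[of 1] by (auto simp: eventually_at_top_linorder)
  have "0 \<le> X" using X by blast
  show ?thesis
  proof (rule antimono_hermitian_converges[of X])
    show "adj (Qinv x) = Qinv x" if "X \<le> x" for x using X[OF that] Qinv_herm by blast
    show "0 \<le> v \<bullet> (Qinv x *v v)" if "X \<le> x" for x v
    proof -
      have "0 \<le> 1 * (norm (adj (Mixed x) *v v))\<^sup>2" by simp
      also have "\<dots> \<le> v \<bullet> (Qinv x *v v)" using X[OF that] Qinv_form by metis
      finally show ?thesis .
    qed
    fix x y v assume "X \<le> x" "x \<le> y"
    have "0 * (y - x) \<le> v \<bullet> ((- cramer_inv (Q y)) *v v) - v \<bullet> ((- cramer_inv (Q x)) *v v)"
    proof (rule semiaxis_growth[OF _ _ \<open>0 \<le> X\<close> \<open>X \<le> x\<close> \<open>x \<le> y\<close>])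
      fix z assume "X \<le> z"
      show "((\<lambda>x. v \<bullet> ((- cramer_inv (Q x)) *v v)) has_vector_derivative
          2 * (norm (adj (Qinv z ** (E (- 2 * \<i>) z ** \<gamma>\<^sub>1)) *v v))\<^sup>2) (at z within {0..})"
        using X[OF \<open>X \<le> z\<close>] by (intro quadratic_form_deriv Qinv_deriv) auto
    qed simp
    moreover have "cramer_inv (Q x) = Qinv x" "cramer_inv (Q y) = Qinv y"
      using X[of x] X[of y] \<open>X \<le> x\<close> \<open>x \<le> y\<close> Qinv_eq(2) by auto
    ultimately show "v \<bullet> (Qinv y *v v) \<le> v \<bullet> (Qinv x *v v)"
      by (simp add: bounded_bilinear.minus_left[OF bounded_bilinear_matrix_vector_mult])
  qed
qed

abbreviation kap :: "complex^'n^'n" where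
  "kap \<equiv> kappa_R \<alpha> S\<^sub>0 \<gamma>\<^sub>1 \<gamma>"

lemma Qinv_tendsto: "(Qinv \<longlongrightarrow> kap) at_top"
proof -
  obtain L where L: "(Qinv \<longlongrightarrow> L) at_top" using Qinv_converges by auto
  have "((\<lambda>x. matrix_inv (Q x)) \<longlongrightarrow> L) at_top"
    by (rule Lim_transform_eventually[OF L])
       (use eventually_S_det in \<open>auto elim!: eventually_mono simp: Qinv_eq\<close>)
  then have "Lim at_top (\<lambda>x. matrix_inv (Q x)) = L" by (intro tendsto_Lim) auto
  then have "kap = L" by (simp add: kappa_R_def Q_def E_def F_def matrix_mul_assoc)
  with L show ?thesis by simp
qed

text \<open>The form of \<open>Qinv\<close> at \<open>y\<close> is the form of \<open>P\<close> at \<open>Mixed\<^sup>* y\<close>. The former stays bounded, while the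
  latter is eventually at least any given multiple of the squared norm of \<open>Mixed\<^sup>* y\<close>.\<close>

lemma Mixed_tendsto_0: "(Mixed \<longlongrightarrow> 0) at_top" "((\<lambda>x. adj (Mixed x)) \<longlongrightarrow> 0) at_top"
proof -
  show adj0: "((\<lambda>x. adj (Mixed x)) \<longlongrightarrow> 0) at_top"
  proof (rule tendsto_zero_matrixI)
    fix y and M :: real assume "0 < M"
    define B where "B = y \<bullet> (kap *v y) + 1"
    have "((\<lambda>x. y \<bullet> (Qinv x *v y)) \<longlongrightarrow> y \<bullet> (kap *v y)) at_top"
      by (rule bounded_linear.tendsto[OF bounded_linear_quadratic_form Qinv_tendsto])
    then have ev: "eventually (\<lambda>x. y \<bullet> (Qinv x *v y) < B) at_top"
      by (rule order_tendstoD) (simp add: B_def)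
    from \<open>0 < M\<close> have "0 < M\<^sup>2" by simp
    from P_dominates[OF this] ev show "eventually (\<lambda>x. M * norm (adj (Mixed x) *v y) \<le> sqrt \<bar>B\<bar>) at_top"
    proof eventually_elim
      case (elim x)
      then have "M\<^sup>2 * (norm (adj (Mixed x) *v y))\<^sup>2 \<le> P_form (adj (Mixed x) *v y) x" by blast
      also have "\<dots> < B" using elim by (simp add: Qinv_form [symmetric])
      finally have "(M * norm (adj (Mixed x) *v y))\<^sup>2 \<le> \<bar>B\<bar>" by (simp add: power_mult_distrib)
      then show ?case by (rule real_le_rsqrt)
    qed
  qed
  from tendsto_adj[OF this] show "(Mixed \<longlongrightarrow> 0) at_top" by simp
qed

lemma kappa_identity: "kap ** \<alpha> - adj \<alpha> ** kap = - (\<i> *\<^sub>C (kap ** (\<gamma> ** adj \<gamma>) ** kap))"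
proof (rule tendsto_unique)
  show "((\<lambda>x. Qinv x ** \<alpha> - adj \<alpha> ** Qinv x) \<longlongrightarrow> kap ** \<alpha> - adj \<alpha> ** kap) at_top"
    by (intro tendsto_intros Qinv_tendsto)
  have "((\<lambda>x. \<i> *\<^sub>C (Mixed x ** (\<gamma>\<^sub>1 ** adj \<gamma>\<^sub>1) ** adj (Mixed x) - Qinv x ** (\<gamma> ** adj \<gamma>) ** Qinv x))
      \<longlongrightarrow> \<i> *\<^sub>C (0 ** (\<gamma>\<^sub>1 ** adj \<gamma>\<^sub>1) ** 0 - kap ** (\<gamma> ** adj \<gamma>) ** kap)) at_top"
    by (intro tendsto_intros Qinv_tendsto Mixed_tendsto_0)
  then have "((\<lambda>x. Qinv x ** \<alpha> - adj \<alpha> ** Qinv x)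
      \<longlongrightarrow> \<i> *\<^sub>C (0 ** (\<gamma>\<^sub>1 ** adj \<gamma>\<^sub>1) ** 0 - kap ** (\<gamma> ** adj \<gamma>) ** kap)) at_top"
    by (rule Lim_transform_eventually)
       (use eventually_S_det in \<open>auto elim!: eventually_mono simp: Qinv_identity\<close>)
  then show "((\<lambda>x. Qinv x ** \<alpha> - adj \<alpha> ** Qinv x)
      \<longlongrightarrow> - (\<i> *\<^sub>C (kap ** (\<gamma> ** adj \<gamma>) ** kap))) at_top"
    by (simp add: cscale_minus_left)
qed simp

end

section \<open>The Dirac system and the free phase factor\<close>

lemma j_mat_cancel: "j_mat ** (j_mat ** X) = X" "(X' ** j_mat) ** j_mat = X'"
  by (simp_all add: matrix_mul_assoc) (simp add: matrix_mul_assoc [symmetric])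

lemma adj_V_mat [simp]: "adj (V_mat w) = V_mat w"
  by (simp add: V_mat_def vec_eq_iff all_sum_iff)

lemma hcat_vcat: "hcat (vcat A B) (vcat C D) = vcat (hcat A C) (hcat B D)"
  by (simp add: vec_eq_iff all_sum_iff)

lemma mero_matrix_continuation:
  fixes u :: "real \<Rightarrow> complex^'q^'p"
  shows "mero_matrix u \<longleftrightarrow> (\<exists>U. (\<forall>i k. (\<lambda>z. U z $ i $ k) meromorphic_on (complex_of_real ` {0..})) \<and>
           (\<forall>x\<ge>0. u x = U (complex_of_real x)))"
proof
  assume "mero_matrix u"
  then obtain G where G: "\<And>i k. G i k meromorphic_on (complex_of_real ` {0..})"
    "\<And>i k x. 0 \<le> x \<Longrightarrow> u x $ i $ k = G i k (complex_of_real x)"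
    unfolding mero_ext_def by metis
  then show "\<exists>U. (\<forall>i k. (\<lambda>z. U z $ i $ k) meromorphic_on (complex_of_real ` {0..})) \<and>
           (\<forall>x\<ge>0. u x = U (complex_of_real x))"
    by (intro exI[of _ "\<lambda>z. \<chi> i k. G i k z"]) (simp add: vec_eq_iff)
next
  assume "\<exists>U. (\<forall>i k. (\<lambda>z. U z $ i $ k) meromorphic_on (complex_of_real ` {0..})) \<and>
           (\<forall>x\<ge>0. u x = U (complex_of_real x))"
  then obtain U :: "complex \<Rightarrow> complex^'q^'p" where
    U: "\<forall>i k. (\<lambda>z. U z $ i $ k) meromorphic_on (complex_of_real ` {0..})"
    "\<forall>x\<ge>0. u x = U (complex_of_real x)" by blast
  show "mero_matrix u"
  proof (intro allI)
    fix i k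
    show "mero_ext (\<lambda>x. u x $ i $ k)"
      unfolding mero_ext_def using U by (intro exI[of _ "\<lambda>z. U z $ i $ k"]) auto
  qed
qed

lemma cscale_two: "2 *\<^sub>C A = A + A"
  by (simp add: vec_eq_iff)

text \<open>Subtracting the conjugation by \<open>j\<close> removes the diagonal blocks and doubles the others.\<close>

lemma off_diagonal_part:
  fixes A :: "complex^'m1^'m1" and b :: "complex^'m2^'m1" and C :: "complex^'m2^'m2"
  defines "X \<equiv> vcat (hcat A b) (hcat (adj b) C)"
  shows "\<i> *\<^sub>C (j_mat ** V_mat ((- 2 * \<i>) *\<^sub>C b)) = X - j_mat ** (X ** j_mat)"
proof -
  have minus: "- hcat A' B' = hcat (- A') (- B')"
    and diff: "hcat A' B' - hcat C' D' = hcat (A' - C') (B' - D')"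
    for A' C' :: "complex^'r::finite^'p" and B' D' :: "complex^'s::finite^'p"
    by (simp_all add: vec_eq_iff all_sum_iff)
  have "\<i> * (- 2 * \<i>) = 2" "- \<i> * cnj (- 2 * \<i>) = 2" by (simp_all add: complex_eq_iff)
  then have two: "\<i> *\<^sub>C (- 2 * \<i>) *\<^sub>C b = b + b"
    "\<i> *\<^sub>C (- adj ((- 2 * \<i>) *\<^sub>C b)) = adj b + adj b"
    by (simp_all only: cscale_minus_right cscale_cscale adj_cscale cscale_two)
  have "\<i> *\<^sub>C (j_mat ** V_mat ((- 2 * \<i>) *\<^sub>C b)) = vcat (hcat 0 (b + b)) (hcat (adj b + adj b) 0)"
    by (simp only: V_mat_def j_mat_vcat minus cscale_vcat cscale_hcat two cscale_zero minus_zero)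
  moreover have "X - j_mat ** (X ** j_mat) = vcat (hcat 0 (b + b)) (hcat (adj b + adj b) 0)"
    by (simp only: X_def vcat_mult hcat_j_mat j_mat_vcat minus vcat_diff diff diff_self
        minus_minus diff_minus_eq_add)
  ultimately show ?thesis by (simp only:)
qed

definition dirac_matrix :: "real \<Rightarrow> complex^'m2^'m1 \<Rightarrow> complex^('m1::finite + 'm2::finite)^('m1 + 'm2)" where
  "dirac_matrix \<mu> w = \<i> *\<^sub>C (complex_of_real \<mu> *\<^sub>C j_mat + j_mat ** V_mat w)"

text \<open>This skewness makes \<open>\<Phi>\<^sup>* j u\<close> constant for any two solutions \<open>\<Phi>\<close> and \<open>u\<close> with the same real
  spectral parameter.\<close>

lemma dirac_matrix_j_skew: "adj (dirac_matrix \<mu> w) ** j_mat + j_mat ** dirac_matrix \<mu> w = 0"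
  by (simp add: dirac_matrix_def adj_add adj_mult matrix_algebra j_mat_cancel cscale_minus_left)

text \<open>This is \<open>exp(i \<mu> x j)\<close>, the fundamental solution for zero potential, written with \<open>j\<^sup>2 = 1\<close>.\<close>

definition phase :: "real \<Rightarrow> real \<Rightarrow> complex^('m1::finite + 'm2::finite)^('m1 + 'm2)" where
  "phase \<mu> x = complex_of_real (cos (\<mu> * x)) *\<^sub>C mat 1 + (\<i> * complex_of_real (sin (\<mu> * x))) *\<^sub>C j_mat"

lemma phase_0 [simp]: "phase \<mu> 0 = mat 1"
  by (simp add: phase_def)

lemma phase_deriv:
  "((phase \<mu> :: real \<Rightarrow> complex^('m1::finite + 'm2::finite)^('m1 + 'm2)) has_vector_derivative
     (\<i> * complex_of_real \<mu>) *\<^sub>C (j_mat ** phase \<mu> x)) (at x within T)"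
proof -
  let ?I = "mat 1 :: complex^('m1 + 'm2)^('m1 + 'm2)"
  let ?j = "j_mat :: complex^('m1 + 'm2)^('m1 + 'm2)"
  have "((\<lambda>x. complex_of_real (cos (\<mu> * x)) *\<^sub>C ?I + (\<i> * complex_of_real (sin (\<mu> * x))) *\<^sub>C ?j)
      has_vector_derivative (complex_of_real (- sin (\<mu> * x) * \<mu>)) *\<^sub>C ?I
        + (\<i> * complex_of_real (cos (\<mu> * x) * \<mu>)) *\<^sub>C ?j) (at x within T)"
  proof (intro has_vector_derivative_add
      bounded_linear.has_vector_derivative[OF bounded_bilinear.bounded_linear_left[OF bounded_bilinear_cscale]])
    show "((\<lambda>x. complex_of_real (cos (\<mu> * x))) has_vector_derivative
        complex_of_real (- sin (\<mu> * x) * \<mu>)) (at x within T)"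
      by (intro has_vector_derivative_of_real)
         (auto intro!: derivative_eq_intros simp: has_real_derivative_iff_has_vector_derivative [symmetric])
    show "((\<lambda>x. \<i> * complex_of_real (sin (\<mu> * x))) has_vector_derivative
        \<i> * complex_of_real (cos (\<mu> * x) * \<mu>)) (at x within T)"
      by (intro has_vector_derivative_mult_right has_vector_derivative_of_real)
         (auto intro!: derivative_eq_intros simp: has_real_derivative_iff_has_vector_derivative [symmetric])
  qed
  moreover have "complex_of_real (- sin (\<mu> * x) * \<mu>) *\<^sub>C ?I
        + (\<i> * complex_of_real (cos (\<mu> * x) * \<mu>)) *\<^sub>C ?j
      = (\<i> * complex_of_real \<mu>) *\<^sub>C (?j ** phase \<mu> x)"
    by (simp add: phase_def matrix_algebra cscale_minus_left mult_ac add.commute)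
  ultimately show ?thesis unfolding phase_def [abs_def] by (simp only:)
qed

lemma phase_unitary: "adj (phase \<mu> x) ** (j_mat ** phase \<mu> x) = j_mat"
proof -
  have "complex_of_real (cos (\<mu> * x)) * complex_of_real (cos (\<mu> * x))
      + complex_of_real (sin (\<mu> * x)) * complex_of_real (sin (\<mu> * x)) = 1"
    using sin_cos_squared_add3[of "\<mu> * x"] by (simp flip: of_real_mult of_real_add)
  then show ?thesis
    by (simp add: phase_def adj_add matrix_algebra mult.commute cscale_minus_left)
       (simp add: vec_eq_iff algebra_simps flip: distrib_left)
qed

lemma phase_vcat: "phase \<mu> x ** vcat A B
    = vcat (exp (\<i> * complex_of_real x * complex_of_real \<mu>) *\<^sub>C A)
           (exp (- \<i> * complex_of_real x * complex_of_real \<mu>) *\<^sub>C B)"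
proof -
  have "exp (\<i> * complex_of_real x * complex_of_real \<mu>)
      = complex_of_real (cos (\<mu> * x)) + \<i> * complex_of_real (sin (\<mu> * x))"
    using cis_conv_exp[of "\<mu> * x"] by (simp add: complex_eq_iff mult_ac)
  moreover have "exp (- \<i> * complex_of_real x * complex_of_real \<mu>)
      = complex_of_real (cos (\<mu> * x)) - \<i> * complex_of_real (sin (\<mu> * x))"
    using cis_conv_exp[of "- (\<mu> * x)"] by (simp add: complex_eq_iff mult_ac)
  ultimately show ?thesis
    by (simp add: phase_def matrix_add_rdistrib j_mat_vcat vcat_add cscale_vcat cscale_add_left)
       (simp add: vec_eq_iff all_sum_iff algebra_simps)
qed

lemma phase_mero: "mero_matrix (phase \<mu>)"
proof -
  have "entire_ext (\<lambda>x. complex_of_real (cos (\<mu> * x)))"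
    unfolding entire_ext_def
    by (intro exI[of _ "\<lambda>z. cos (complex_of_real \<mu> * z)"]) (auto intro!: holomorphic_intros simp flip: cos_of_real)
  moreover have "entire_ext (\<lambda>x. complex_of_real (sin (\<mu> * x)))"
    unfolding entire_ext_def
    by (intro exI[of _ "\<lambda>z. sin (complex_of_real \<mu> * z)"]) (auto intro!: holomorphic_intros simp flip: sin_of_real)
  ultimately show ?thesis
    unfolding phase_def
    by (intro mero_matrix_add mero_matrix_cscale mero_matrix_const entire_ext_imp_mero_ext
        entire_ext_mult entire_ext_const)
qed

lemma adj_phase: "adj (phase \<mu> x) = phase (- \<mu>) x"
  by (simp add: phase_def adj_add)

lemma adj_phase_mero: "mero_matrix (\<lambda>x. adj (phase \<mu> x))"
  unfolding adj_phase by (rule phase_mero)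

context pe_data begin

abbreviation v :: "real \<Rightarrow> complex^'m2^'m1" where
  "v \<equiv> pe_potential \<alpha> S\<^sub>0 \<gamma>\<^sub>1 \<gamma>"

abbreviation D :: "real set" where
  "D \<equiv> pe_domain \<alpha> S\<^sub>0 \<gamma>\<^sub>1 \<gamma>"

lemma D_iff: "x \<in> D \<longleftrightarrow> 0 \<le> x \<and> det (S x) \<noteq> 0"
  by (simp add: pe_domain_def)

lemma zero_in_D: "0 \<in> D"
  using det_S0 by (simp add: D_iff)

lemma eventually_in_D:
  assumes "x \<in> D"
  shows "eventually (\<lambda>y. y \<in> D) (at x within {0..})"
proof -
  have "(S \<longlongrightarrow> S x) (at x within {0..})"
    using has_vector_derivative_continuous[OF S_deriv[of x]] assms by (simp add: D_iff continuous_within)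
  from tendsto_imp_eventually_ne[OF tendsto_det[OF this]]
  have "eventually (\<lambda>y. det (S y) \<noteq> 0) (at x within {0..})" using assms by (simp add: D_iff)
  then show ?thesis unfolding eventually_at_filter by eventually_elim (simp add: D_iff)
qed

lemma Sinv_mero: "mero_matrix Sinv"
  unfolding Sinv_def by (intro mero_matrix_cramer_inv S_mero)

lemma Lam_mero: "mero_matrix Lam" and adj_Lam_mero: "mero_matrix (\<lambda>x. adj (Lam x))"
  using Lam_entire adj_Lam_entire by (auto intro: entire_ext_imp_mero_ext)

lemma Sinv_deriv:
  assumes "x \<in> D"
  shows "(Sinv has_vector_derivative - (Sinv x ** ((Lam x ** adj (Lam x)) ** Sinv x))) (at x within {0..})"
  using has_vector_derivative_cramer_inv[OF S_deriv[of x]] assms by (simp add: D_iff Sinv_def [abs_def])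

text \<open>The potential is the off-diagonal part of \<open>\<Lambda>\<^sup>* S\<^sup>-\<^sup>1 \<Lambda>\<close>; this is the form in which it appears in
  the derivative of the Darboux matrix.\<close>

lemma potential_matrix:
  assumes "x \<in> D"
  defines "X \<equiv> adj (Lam x) ** (Sinv x ** Lam x)"
  shows "\<i> *\<^sub>C (j_mat ** V_mat (v x)) = X - j_mat ** (X ** j_mat)"
proof -
  define b where "b = adj \<gamma>\<^sub>1 ** F \<i> x ** Sinv x ** E \<i> x ** \<gamma>"
  have D: "0 \<le> x" "det (S x) \<noteq> 0" using assms by (auto simp: D_iff)
  have v: "v x = (- 2 * \<i>) *\<^sub>C b"
    by (simp add: pe_potential_def b_def E_def F_def Sinv_def cramer_inv_eq[OF D(2)])
  have adj_b: "adj b = adj \<gamma> ** F (- \<i>) x ** Sinv x ** E (- \<i>) x ** \<gamma>\<^sub>1"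
    by (simp add: b_def adj_mult Sinv_herm[OF D(2,1)] matrix_mul_assoc)
  have X: "X = vcat (hcat (adj \<gamma>\<^sub>1 ** F \<i> x ** Sinv x ** E (- \<i>) x ** \<gamma>\<^sub>1) b)
                    (hcat (adj b) (adj \<gamma> ** F (- \<i>) x ** Sinv x ** E \<i> x ** \<gamma>))"
    unfolding X_def adj_Lam_eq adj_b
    by (simp only: Lam_eq vcat_mult mult_hcat hcat_vcat b_def matrix_mul_assoc)
  show ?thesis
    unfolding X v by (rule off_diagonal_part)
qed

end

section \<open>The Darboux matrix and the fundamental solution\<close>

locale pe_spectral = pe_data \<alpha> S\<^sub>0 \<gamma>\<^sub>1 \<gamma>
  for \<alpha> S\<^sub>0 :: "complex^'n^'n" and \<gamma>\<^sub>1 :: "complex^'m1^'n" and \<gamma> :: "complex^'m2^'n" +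
  fixes \<mu> :: real
  assumes inv_alpha: "invertible (mat (complex_of_real \<mu>) - \<alpha>)"
begin

definition R :: "complex^'n^'n" where
  "R = matrix_inv (mat (complex_of_real \<mu>) - \<alpha>)"

lemma R_alpha: "R ** \<alpha> = complex_of_real \<mu> *\<^sub>C R - mat 1"
  and alpha_R: "\<alpha> ** R = complex_of_real \<mu> *\<^sub>C R - mat 1"
proof -
  have "R ** (complex_of_real \<mu> *\<^sub>C mat 1 - \<alpha>) = mat 1" "(complex_of_real \<mu> *\<^sub>C mat 1 - \<alpha>) ** R = mat 1"
    using matrix_inv_mult[OF inv_alpha] by (simp_all add: R_def mat_eq_cscale[of "complex_of_real \<mu>"])
  then show "R ** \<alpha> = complex_of_real \<mu> *\<^sub>C R - mat 1" "\<alpha> ** R = complex_of_real \<mu> *\<^sub>C R - mat 1"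
    by (simp_all add: mult_diff_matrix algebra_simps)
qed

lemma adj_R_alpha: "adj R ** adj \<alpha> = complex_of_real \<mu> *\<^sub>C adj R - mat 1"
  using arg_cong[OF alpha_R, of adj] by (simp add: adj_mult adj_diff)

lemma R_E: "E c x ** R = R ** E c x"
  unfolding E_def by (rule mexp_commute) (simp add: R_alpha alpha_R)

definition w_core :: "real \<Rightarrow> complex^('m1 + 'm2)^('m1 + 'm2)" where
  "w_core x = adj (Lam x) ** (Sinv x ** (R ** Lam x))"

text \<open>The Darboux matrix: the transfer function of the node formed by \<open>\<alpha>\<close>, \<open>S\<close> and \<open>\<Lambda>\<close>.\<close>

definition w :: "real \<Rightarrow> complex^('m1 + 'm2)^('m1 + 'm2)" where
  "w x = mat 1 + \<i> *\<^sub>C (j_mat ** w_core x)"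

definition Phi :: "real \<Rightarrow> complex^('m1 + 'm2)^('m1 + 'm2)" where
  "Phi x = w x ** phase \<mu> x"

text \<open>The Darboux matrix is a gauge transformation from the free system to the system with potential \<open>v\<close>.
  In the derivative of \<open>\<Lambda>\<^sup>* S\<^sup>-\<^sup>1 R \<Lambda>\<close> each factor \<open>\<alpha>\<close> can be moved next to the resolvent \<open>R\<close>, where it
  turns into \<open>\<mu> R - 1\<close>; moving \<open>\<alpha>\<^sup>*\<close> across \<open>S\<^sup>-\<^sup>1\<close> costs the term of the identity for \<open>S\<close>.\<close>

lemma w_deriv:
  assumes "x \<in> D"
  shows "(w has_vector_derivative
     dirac_matrix \<mu> (v x) ** w x - (\<i> * complex_of_real \<mu>) *\<^sub>C (w x ** j_mat)) (at x within {0..})"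
proof -
  let ?m = "complex_of_real \<mu>"
  have D: "0 \<le> x" "det (S x) \<noteq> 0" using assms by (auto simp: D_iff)
  define L where "L = Lam x"
  define L' where "L' = adj (Lam x)"
  define s where "s = Sinv x"
  define X where "X = L' ** (s ** L)"
  define h where "h = w_core x"
  have h: "h = L' ** (s ** (R ** L))" by (simp add: h_def w_core_def L_def L'_def s_def)
  have "(w_core has_vector_derivative
      L' ** (s ** (R ** ((- \<i>) *\<^sub>C (\<alpha> ** (L ** j_mat))) + 0 ** L) + (- (s ** ((L ** L') ** s))) ** (R ** L))
      + (\<i> *\<^sub>C (j_mat ** (L' ** adj \<alpha>))) ** (s ** (R ** L))) (at x within {0..})"
    unfolding w_core_def L_def L'_def s_def
    by (intro has_vector_derivative_matrix_mult Lam_deriv adj_Lam_deriv Sinv_deriv assms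
        has_vector_derivative_const)
  moreover have "L' ** (s ** (R ** ((- \<i>) *\<^sub>C (\<alpha> ** (L ** j_mat))) + 0 ** L) + (- (s ** ((L ** L') ** s))) ** (R ** L))
      + (\<i> *\<^sub>C (j_mat ** (L' ** adj \<alpha>))) ** (s ** (R ** L))
    = - (\<i> *\<^sub>C ((?m *\<^sub>C h - X) ** j_mat)) + - (X ** h)
      + \<i> *\<^sub>C (j_mat ** (?m *\<^sub>C h - X - \<i> *\<^sub>C (X ** (j_mat ** h))))"
  proof -
    have 1: "L' ** (s ** (R ** (\<alpha> ** (L ** j_mat)))) = (?m *\<^sub>C h - X) ** j_mat"
    proof -
      have "L' ** (s ** (R ** (\<alpha> ** (L ** j_mat)))) = L' ** (s ** ((R ** \<alpha>) ** (L ** j_mat)))"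
        by (simp add: matrix_mul_assoc)
      then show ?thesis unfolding R_alpha h X_def
        by (simp add: matrix_algebra)
    qed
    have 2: "L' ** (adj \<alpha> ** (s ** (R ** L))) = ?m *\<^sub>C h - X - \<i> *\<^sub>C (X ** (j_mat ** h))"
    proof -
      have "adj \<alpha> ** s = s ** \<alpha> - \<i> *\<^sub>C (s ** L ** j_mat ** L' ** s)"
        using Sinv_identity[OF D(2,1)] by (simp add: s_def L_def L'_def algebra_simps)
      then have "L' ** (adj \<alpha> ** (s ** (R ** L)))
          = L' ** ((s ** \<alpha> - \<i> *\<^sub>C (s ** L ** j_mat ** L' ** s)) ** (R ** L))"
        by (simp add: matrix_mul_assoc)
      also have "\<dots> = L' ** (s ** ((\<alpha> ** R) ** L)) - \<i> *\<^sub>C (X ** (j_mat ** h))"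
        by (simp add: matrix_algebra X_def h)
      also have "L' ** (s ** ((\<alpha> ** R) ** L)) = ?m *\<^sub>C h - X"
        unfolding alpha_R h X_def by (simp add: matrix_algebra)
      finally show ?thesis .
    qed
    have "L' ** (s ** (R ** ((- \<i>) *\<^sub>C (\<alpha> ** (L ** j_mat))))) = - (\<i> *\<^sub>C ((?m *\<^sub>C h - X) ** j_mat))"
      by (simp only: cscale_mult_right 1) (simp only: cscale_minus_left)
    moreover have "L' ** ((- (s ** ((L ** L') ** s))) ** (R ** L)) = - (X ** h)"
      by (simp add: X_def h matrix_mul_assoc)
    moreover have "(\<i> *\<^sub>C (j_mat ** (L' ** adj \<alpha>))) ** (s ** (R ** L))
        = \<i> *\<^sub>C (j_mat ** (?m *\<^sub>C h - X - \<i> *\<^sub>C (X ** (j_mat ** h))))"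
      unfolding 2 [symmetric] by (simp add: matrix_mul_assoc)
    ultimately show ?thesis by (simp only: matrix_add_ldistrib mult_zero_matrix add_0_right)
  qed
  ultimately have "(w_core has_vector_derivative
      - (\<i> *\<^sub>C ((?m *\<^sub>C h - X) ** j_mat)) + - (X ** h)
      + \<i> *\<^sub>C (j_mat ** (?m *\<^sub>C h - X - \<i> *\<^sub>C (X ** (j_mat ** h))))) (at x within {0..})" by simp
  from has_vector_derivative_add[OF has_vector_derivative_const has_vector_derivative_cscale
        [OF has_vector_derivative_matrix_mult[OF has_vector_derivative_const this]]]
  have w': "(w has_vector_derivative 0 + \<i> *\<^sub>C (j_mat ** (- (\<i> *\<^sub>C ((?m *\<^sub>C h - X) ** j_mat)) + - (X ** h)
      + \<i> *\<^sub>C (j_mat ** (?m *\<^sub>C h - X - \<i> *\<^sub>C (X ** (j_mat ** h))))) + 0 ** w_core x)) (at x within {0..})"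
    unfolding w_def [abs_def] .
  have "dirac_matrix \<mu> (v x) = (\<i> * ?m) *\<^sub>C j_mat + (X - j_mat ** (X ** j_mat))"
    using potential_matrix[OF assms]
    by (simp add: dirac_matrix_def cscale_add_right X_def L_def L'_def s_def)
  then have "0 + \<i> *\<^sub>C (j_mat ** (- (\<i> *\<^sub>C ((?m *\<^sub>C h - X) ** j_mat)) + - (X ** h)
      + \<i> *\<^sub>C (j_mat ** (?m *\<^sub>C h - X - \<i> *\<^sub>C (X ** (j_mat ** h))))) + 0 ** w_core x)
      = dirac_matrix \<mu> (v x) ** w x - (\<i> * ?m) *\<^sub>C (w x ** j_mat)"
    by (simp add: w_def h_def [symmetric] matrix_algebra j_mat_cancel cscale_minus_left)
       (simp add: vec_eq_iff algebra_simps)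
  with w' show ?thesis by simp
qed

lemma Phi_deriv:
  assumes "x \<in> D"
  shows "(Phi has_vector_derivative dirac_matrix \<mu> (v x) ** Phi x) (at x within {0..})"
proof -
  have "(Phi has_vector_derivative w x ** ((\<i> * complex_of_real \<mu>) *\<^sub>C (j_mat ** phase \<mu> x))
      + (dirac_matrix \<mu> (v x) ** w x - (\<i> * complex_of_real \<mu>) *\<^sub>C (w x ** j_mat)) ** phase \<mu> x) (at x within {0..})"
    unfolding Phi_def [abs_def]
    by (intro has_vector_derivative_matrix_mult w_deriv phase_deriv assms)
  then show ?thesis by (simp add: Phi_def matrix_algebra)
qed

text \<open>The adjoint of \<open>w\<close>, written so that its entries have meromorphic continuations. The two agree only
  on \<open>D\<close>, where the inverse of \<open>S\<close> is Hermitian.\<close>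

definition w_adj :: "real \<Rightarrow> complex^('m1 + 'm2)^('m1 + 'm2)" where
  "w_adj x = mat 1 - \<i> *\<^sub>C (adj (Lam x) ** (adj R ** (Sinv x ** (Lam x ** j_mat))))"

lemma adj_w: "x \<in> D \<Longrightarrow> adj (w x) = w_adj x"
  by (simp add: D_iff w_def w_adj_def w_core_def adj_add adj_mult Sinv_herm matrix_mul_assoc cscale_minus_left)

text \<open>For real \<open>\<mu>\<close> the identity for the inverse of \<open>S\<close>, sandwiched between the resolvents, cancels the
  quadratic term against the two linear ones.\<close>

lemma w_j_unitary:
  assumes "x \<in> D"
  shows "adj (w x) ** (j_mat ** w x) = j_mat"
proof -
  have D: "0 \<le> x" "det (S x) \<noteq> 0" using assms by (auto simp: D_iff)
  define L where "L = Lam x"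
  define L' where "L' = adj (Lam x)"
  define s where "s = Sinv x"
  have "\<i> *\<^sub>C (adj R ** (s ** L ** j_mat ** L' ** s) ** R) = adj R ** (s ** \<alpha> - adj \<alpha> ** s) ** R"
    using Sinv_identity[OF D(2,1)] by (simp add: s_def L_def L'_def)
  also have "\<dots> = adj R ** (s ** (\<alpha> ** R)) - (adj R ** adj \<alpha>) ** (s ** R)"
    by (simp add: mult_diff_matrix matrix_mul_assoc)
  also have "\<dots> = s ** R - adj R ** s"
    unfolding alpha_R adj_R_alpha by (simp add: matrix_algebra)
  finally have key: "\<i> *\<^sub>C (adj R ** (s ** L ** j_mat ** L' ** s) ** R) = s ** R - adj R ** s" .
  have "(- \<i>) *\<^sub>C (\<i> *\<^sub>C (adj R ** (s ** L ** j_mat ** L' ** s) ** R)) = (- \<i>) *\<^sub>C (s ** R - adj R ** s)"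
    unfolding key ..
  then have "L' ** (adj R ** (s ** L ** j_mat ** L' ** s) ** R) ** L = L' ** ((- \<i>) *\<^sub>C (s ** R - adj R ** s)) ** L"
    by simp
  then have key': "L' ** (adj R ** (s ** (L ** (j_mat ** (L' ** (s ** (R ** L)))))))
      = \<i> *\<^sub>C (L' ** (adj R ** (s ** L))) - \<i> *\<^sub>C (L' ** (s ** (R ** L)))"
    by (simp add: matrix_algebra cscale_minus_left)
  show ?thesis
    unfolding adj_w[OF assms] unfolding w_adj_def w_def w_core_def L'_def [symmetric]
    unfolding L_def [symmetric] s_def [symmetric]
    by (simp add: matrix_algebra j_mat_cancel key') (simp add: cscale_minus_left)
qed

lemma Phi_j_unitary:
  assumes "x \<in> D"
  shows "adj (Phi x) ** (j_mat ** Phi x) = j_mat" "Phi x ** (j_mat ** (adj (Phi x) ** j_mat)) = mat 1"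
proof -
  have "adj (Phi x) ** (j_mat ** Phi x) = adj (phase \<mu> x) ** ((adj (w x) ** (j_mat ** w x)) ** phase \<mu> x)"
    by (simp add: Phi_def adj_mult matrix_mul_assoc)
  then show 1: "adj (Phi x) ** (j_mat ** Phi x) = j_mat"
    unfolding w_j_unitary[OF assms] phase_unitary .
  have "(j_mat ** (adj (Phi x) ** j_mat)) ** Phi x = j_mat ** (adj (Phi x) ** (j_mat ** Phi x))"
    by (simp add: matrix_mul_assoc)
  then have "(j_mat ** (adj (Phi x) ** j_mat)) ** Phi x = mat 1" by (simp add: 1)
  then show "Phi x ** (j_mat ** (adj (Phi x) ** j_mat)) = mat 1"
    by (rule right_inverse_imp_left_inverse)
qed

lemma Phi_mero: "mero_matrix Phi"
  unfolding Phi_def [abs_def] w_def w_core_def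
  by (intro mero_matrix_mult mero_matrix_add mero_matrix_cscale mero_matrix_const mero_ext_const
      adj_Lam_mero Lam_mero Sinv_mero phase_mero)

lemma dirac_solution_Phi: "dirac_solution D v \<mu> (\<lambda>x. Phi x ** C)"
  unfolding dirac_solution_def mero_matrix_continuation [symmetric] dirac_matrix_def [symmetric]
proof (intro conjI ballI)
  show "mero_matrix (\<lambda>x. Phi x ** C)" by (intro mero_matrix_mult Phi_mero mero_matrix_const)
  fix x assume "x \<in> D"
  from has_vector_derivative_matrix_mult[OF Phi_deriv[OF this] has_vector_derivative_const]
  show "((\<lambda>x. Phi x ** C) has_vector_derivative dirac_matrix \<mu> (v x) ** (Phi x ** C)) (at x within {0..})"
    by (simp add: matrix_mul_assoc)
qed

text \<open>The function \<open>\<Phi>\<^sup>* j u\<close> has derivative zero on \<open>D\<close>. It is constant near \<open>0\<close>, and since its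
  meromorphic version \<open>K'\<close> agrees with it on \<open>D\<close>, it takes the same value at all points of \<open>D\<close>,
  also beyond the singularities of the potential. The relation \<open>\<Phi> j \<Phi>\<^sup>* j = 1\<close> then recovers \<open>u\<close>.\<close>

lemma dirac_solution_eq_Phi:
  fixes u :: "real \<Rightarrow> complex^'q^('m1 + 'm2)"
  assumes "dirac_solution D v \<mu> u"
  obtains C where "\<And>x. x \<in> D \<Longrightarrow> u x = Phi x ** C"
proof -
  have "mero_matrix u \<and> (\<forall>x\<in>D. (u has_vector_derivative dirac_matrix \<mu> (v x) ** u x) (at x within {0..}))"
    using assms unfolding dirac_solution_def mero_matrix_continuation [symmetric] dirac_matrix_def [symmetric] .
  then have u_mero: "mero_matrix u"
    and u_deriv: "\<And>x. x \<in> D \<Longrightarrow> (u has_vector_derivative dirac_matrix \<mu> (v x) ** u x) (at x within {0..})"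
    by blast+
  define K where "K x = adj (Phi x) ** (j_mat ** u x)" for x
  define K' where "K' x = adj (phase \<mu> x) ** (w_adj x ** (j_mat ** u x))" for x
  have K_eq: "K' x = K x" if "x \<in> D" for x
    using adj_w[OF that] by (simp add: K_def K'_def Phi_def adj_mult matrix_mul_assoc)
  have K_deriv: "(K has_vector_derivative 0) (at x within {0..})" if "x \<in> D" for x
  proof -
    have "(K has_vector_derivative adj (Phi x) ** (j_mat ** (dirac_matrix \<mu> (v x) ** u x) + 0 ** u x)
        + adj (dirac_matrix \<mu> (v x) ** Phi x) ** (j_mat ** u x)) (at x within {0..})"
      unfolding K_def [abs_def]
      by (intro has_vector_derivative_matrix_mult has_vector_derivative_adj Phi_deriv u_deriv that
          has_vector_derivative_const)
    also have "adj (Phi x) ** (j_mat ** (dirac_matrix \<mu> (v x) ** u x) + 0 ** u x)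
        + adj (dirac_matrix \<mu> (v x) ** Phi x) ** (j_mat ** u x)
        = adj (Phi x) ** ((adj (dirac_matrix \<mu> (v x)) ** j_mat + j_mat ** dirac_matrix \<mu> (v x)) ** u x)"
      by (simp add: adj_mult matrix_algebra add.commute)
    finally show ?thesis by (simp add: dirac_matrix_j_skew)
  qed
  have K'_mero: "mero_matrix K'"
  proof -
    have "w_adj x = mat 1 + (- \<i>) *\<^sub>C (adj (Lam x) ** (adj R ** (Sinv x ** (Lam x ** j_mat))))" for x
      by (simp add: w_adj_def cscale_minus_left)
    then show ?thesis
      unfolding K'_def [abs_def]
      by (simp only:) (intro mero_matrix_mult mero_matrix_add mero_matrix_cscale mero_matrix_const
          mero_ext_const adj_Lam_mero Lam_mero Sinv_mero adj_phase_mero u_mero)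
  qed
  obtain e where e: "0 < e" "\<And>x. 0 \<le> x \<Longrightarrow> x < e \<Longrightarrow> x \<in> D"
  proof -
    have "\<exists>d>0. \<forall>y\<in>{0..}. y \<noteq> 0 \<and> dist y 0 < d \<longrightarrow> y \<in> D"
      using eventually_in_D[OF zero_in_D] unfolding eventually_at .
    then obtain d where d: "0 < d" "\<forall>y\<in>{0..}. y \<noteq> 0 \<and> dist y 0 < d \<longrightarrow> y \<in> D" by blast
    have "x \<in> D" if "0 \<le> x" "x < d" for x
      using d(2) that zero_in_D by (cases "x = 0") (simp_all add: dist_real_def)
    with d(1) show ?thesis by (rule that)
  qed
  have near0: "K x = K 0" if "0 \<le> x" "x < e" for x
  proof (rule has_vector_derivative_zero_constant[of "{0..<e}" K])
    fix y assume "y \<in> {0..<e}"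
    then show "(K has_vector_derivative 0) (at y within {0..<e})"
      using e(2) by (intro has_vector_derivative_within_subset[OF K_deriv]) auto
  qed (use that e(1) in auto)
  have K_const: "K x = K 0" if "x \<in> D" for x
  proof -
    have "K' x $ i $ k = K 0 $ i $ k" for i k
    proof (rule mero_ext_constant[OF _ e(1)])
      show "mero_ext (\<lambda>x. K' x $ i $ k)" using K'_mero by blast
      show "K' y $ i $ k = K 0 $ i $ k" if "0 \<le> y" "y < e" for y
        using K_eq[OF e(2)[OF that]] near0[OF that] by simp
      show "0 \<le> x" using that by (simp add: D_iff)
      have "(K \<longlongrightarrow> K x) (at x within {0..})"
        using has_vector_derivative_continuous[OF K_deriv[OF that]] by (simp add: continuous_within)
      then have "(K' \<longlongrightarrow> K' x) (at x within {0..})"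
        unfolding K_eq[OF that]
        by (rule Lim_transform_eventually)
           (use eventually_in_D[OF that] K_eq in \<open>auto elim!: eventually_mono\<close>)
      then show "((\<lambda>x. K' x $ i $ k) \<longlongrightarrow> K' x $ i $ k) (at x within {0..})"
        by (intro tendsto_vec_nth)
    qed
    then show ?thesis using K_eq[OF that] by (simp add: vec_eq_iff)
  qed
  show ?thesis
  proof (rule that[of "j_mat ** K 0"])
    fix x assume "x \<in> D"
    have "Phi x ** (j_mat ** K x) = (Phi x ** (j_mat ** (adj (Phi x) ** j_mat))) ** u x"
      by (simp add: K_def matrix_mul_assoc)
    also have "\<dots> = u x" by (simp add: Phi_j_unitary(2)[OF \<open>x \<in> D\<close>])
    finally show "u x = Phi x ** (j_mat ** K 0)" using K_const[OF \<open>x \<in> D\<close>] by simp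
  qed
qed

end

section \<open>The normalised solutions and their behaviour at infinity\<close>

lemma tendsto_unimodular_mult:
  fixes A :: "real \<Rightarrow> complex^'q^'p"
  assumes "(A \<longlongrightarrow> 0) F" and "\<And>x. norm (f x) = 1"
  shows "((\<lambda>x. f x *\<^sub>C A x) \<longlongrightarrow> 0) F"
proof (rule tendsto_matrixI)
  fix i k
  have "((\<lambda>x. A x $ i $ k) \<longlongrightarrow> 0) F"
    using tendsto_vec_nth[OF tendsto_vec_nth[OF assms(1)], of i k] by simp
  then have "((\<lambda>x. norm (f x * A x $ i $ k)) \<longlongrightarrow> 0) F"
    by (simp add: norm_mult assms(2) tendsto_norm_zero)
  then show "((\<lambda>x. (f x *\<^sub>C A x) $ i $ k) \<longlongrightarrow> 0 $ i $ k) F"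
    by (simp add: tendsto_norm_zero_cancel)
qed

lemma bounded_linear_upper:
    "bounded_linear (upper :: complex^'q^('m1::finite + 'm2::finite) \<Rightarrow> complex^'q^'m1)"
  and bounded_linear_lower:
    "bounded_linear (lower :: complex^'q^('m1::finite + 'm2::finite) \<Rightarrow> complex^'q^'m2)"
  unfolding linear_conv_bounded_linear [symmetric]
  by (auto intro!: linearI simp: vec_eq_iff)

lemmas tendsto_upper = bounded_linear.tendsto [OF bounded_linear_upper]
lemmas tendsto_lower = bounded_linear.tendsto [OF bounded_linear_lower]

lemma tendsto_vcat_zero:
  assumes "(A \<longlongrightarrow> 0) F" "(B \<longlongrightarrow> 0) F"
  shows "((\<lambda>x. vcat (A x) (B x)) \<longlongrightarrow> 0) F"
proof (rule vec_tendstoI)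
  fix k
  show "((\<lambda>x. vcat (A x) (B x) $ k) \<longlongrightarrow> 0 $ k) F"
    using assms[THEN tendsto_vec_nth] by (cases k) simp_all
qed

lemma resolvent_identity:
  fixes A B X Y :: "complex^'n^'n"
  assumes "X ** A = mat 1" "B ** Y = mat 1"
  shows "Y + X ** ((B - A) ** Y) = X"
proof -
  have "X ** ((B - A) ** Y) = X ** (B ** Y) - (X ** A) ** Y"
    by (simp add: mult_diff_matrix matrix_mul_assoc)
  then show ?thesis by (simp add: assms)
qed

text \<open>The rule for inverting a transfer function \<open>1 + C X B\<close>: with \<open>X = (\<mu> - A)\<^sup>-\<^sup>1\<close>, the hypothesis is
  the resolvent identity for \<open>Y = (\<mu> - A + B C)\<^sup>-\<^sup>1\<close>.\<close>

lemma state_space_inverse: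
  fixes X Y :: "complex^'n^'n" and B :: "complex^'m^'n" and C :: "complex^'n^'m"
  assumes "Y + X ** (B ** (C ** Y)) = X"
  shows "(mat 1 + C ** (X ** B)) ** (mat 1 - C ** (Y ** B)) = mat 1"
proof -
  have "C ** ((Y + X ** (B ** (C ** Y))) ** B) = C ** (X ** B)" by (simp only: assms)
  then show ?thesis
    by (simp add: matrix_algebra)
qed

context pe_spectral begin

abbreviation S0i :: "complex^'n^'n" where "S0i \<equiv> matrix_inv S\<^sub>0"

lemma Sinv_0: "Sinv 0 = S0i"
  by (simp add: Sinv_def cramer_inv_eq[OF det_S0])

lemma S0_inv: "S\<^sub>0 ** S0i = mat 1" "S0i ** S\<^sub>0 = mat 1"
  using S_Sinv[of 0] det_S0 by (simp_all add: Sinv_0)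

definition W11 :: "real \<Rightarrow> complex^'m1^'m1" where
  "W11 x = mat 1 + \<i> *\<^sub>C (adj \<gamma>\<^sub>1 ** (Pinv x ** (R ** \<gamma>\<^sub>1)))"
definition W12 :: "real \<Rightarrow> complex^'m2^'m1" where
  "W12 x = \<i> *\<^sub>C (adj \<gamma>\<^sub>1 ** (adj (Mixed x) ** (R ** \<gamma>)))"
definition W21 :: "real \<Rightarrow> complex^'m1^'m2" where
  "W21 x = - (\<i> *\<^sub>C (adj \<gamma> ** (Mixed x ** (R ** \<gamma>\<^sub>1))))"
definition W22 :: "real \<Rightarrow> complex^'m2^'m2" where
  "W22 x = mat 1 - \<i> *\<^sub>C (adj \<gamma> ** (Qinv x ** (R ** \<gamma>)))"

text \<open>The resolvent commutes with the exponentials, so each block contains the inverse of \<open>S\<close> between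
  exponentials only, in one of the combinations whose limits are known.\<close>

lemma w_blocks:
  assumes "x \<in> D"
  shows "w x = vcat (hcat (W11 x) (W12 x)) (hcat (W21 x) (W22 x))"
proof -
  have D: "0 \<le> x" "det (S x) \<noteq> 0" using assms by (auto simp: D_iff)
  have RE: "R ** (E c x ** X) = E c x ** (R ** X)" for c and X :: "complex^'r^'n"
    by (simp add: matrix_mul_assoc R_E)
  have "w_core x = vcat
      (hcat (adj \<gamma>\<^sub>1 ** (Pinv x ** (R ** \<gamma>\<^sub>1))) (adj \<gamma>\<^sub>1 ** (adj (Mixed x) ** (R ** \<gamma>))))
      (hcat (adj \<gamma> ** (Mixed x ** (R ** \<gamma>\<^sub>1))) (adj \<gamma> ** (Qinv x ** (R ** \<gamma>))))"
    unfolding w_core_def adj_Lam_eq adj_Mixed[OF D(2,1)] unfolding Lam_eq Pinv_def Qinv_def Mixed_def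
    by (simp only: mult_hcat vcat_mult hcat_vcat RE matrix_mul_assoc [symmetric])
  then show ?thesis
    by (simp add: w_def j_mat_vcat W11_def W12_def W21_def W22_def)
       (simp add: vec_eq_iff all_sum_iff mat_def)
qed

definition W22_limit :: "complex^'m2^'m2" where
  "W22_limit = mat 1 - \<i> *\<^sub>C (adj \<gamma> ** (kap ** (R ** \<gamma>)))"

lemma W_limits:
  "(W11 \<longlongrightarrow> mat 1) at_top" "(W12 \<longlongrightarrow> 0) at_top" "(W21 \<longlongrightarrow> 0) at_top" "(W22 \<longlongrightarrow> W22_limit) at_top"
proof -
  have "(W11 \<longlongrightarrow> mat 1 + \<i> *\<^sub>C (adj \<gamma>\<^sub>1 ** (0 ** (R ** \<gamma>\<^sub>1)))) at_top"
    unfolding W11_def [abs_def] by (intro tendsto_intros Pinv_tendsto_0)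
  then show "(W11 \<longlongrightarrow> mat 1) at_top" by simp
  have "(W12 \<longlongrightarrow> \<i> *\<^sub>C (adj \<gamma>\<^sub>1 ** (0 ** (R ** \<gamma>)))) at_top"
    unfolding W12_def [abs_def] by (intro tendsto_intros Mixed_tendsto_0)
  then show "(W12 \<longlongrightarrow> 0) at_top" by simp
  have "(W21 \<longlongrightarrow> - (\<i> *\<^sub>C (adj \<gamma> ** (0 ** (R ** \<gamma>\<^sub>1))))) at_top"
    unfolding W21_def [abs_def] by (intro tendsto_intros Mixed_tendsto_0)
  then show "(W21 \<longlongrightarrow> 0) at_top" by simp
  show "(W22 \<longlongrightarrow> W22_limit) at_top"
    unfolding W22_def [abs_def] W22_limit_def by (intro tendsto_intros Qinv_tendsto)
qed

abbreviation (input) ex :: "real \<Rightarrow> complex" where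
  "ex x \<equiv> exp (\<i> * complex_of_real x * complex_of_real \<mu>)"
abbreviation (input) ex' :: "real \<Rightarrow> complex" where
  "ex' x \<equiv> exp (- \<i> * complex_of_real x * complex_of_real \<mu>)"

lemma ex_inverse: "ex x * ex' x = 1" "ex' x * ex x = 1"
  by (simp_all flip: exp_add)

lemma eventually_D: "eventually (\<lambda>x. x \<in> D) at_top"
  using eventually_S_det by (simp add: D_iff)

lemma Phi_vcat:
  assumes "x \<in> D"
  shows "Phi x ** vcat A B = vcat (ex x *\<^sub>C (W11 x ** A) + ex' x *\<^sub>C (W12 x ** B))
                                  (ex x *\<^sub>C (W21 x ** A) + ex' x *\<^sub>C (W22 x ** B))"
  unfolding Phi_def matrix_mul_assoc [symmetric] phase_vcat w_blocks[OF assms] vcat_mult hcat_mult_vcat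
  by (simp only: cscale_mult_right)

text \<open>In the limit the Darboux matrix is block diagonal, so each phase factor acts on its own block; the
  cross terms have unimodular coefficients and factors tending to zero.\<close>

lemma solution_limits:
  fixes u :: "real \<Rightarrow> complex^'q^('m1 + 'm2)"
  assumes u: "\<And>x. x \<in> D \<Longrightarrow> u x = Phi x ** vcat A B"
  shows "((\<lambda>x. ex' x *\<^sub>C upper (u x)) \<longlongrightarrow> A) at_top"
    and "((\<lambda>x. ex x *\<^sub>C lower (u x)) \<longlongrightarrow> W22_limit ** B) at_top"
proof -
  have "((\<lambda>x. W12 x ** B) \<longlongrightarrow> 0 ** B) at_top" "((\<lambda>x. W21 x ** A) \<longlongrightarrow> 0 ** A) at_top"
    by (intro tendsto_intros W_limits)+
  then have 0: "((\<lambda>x. W12 x ** B) \<longlongrightarrow> 0) at_top" "((\<lambda>x. W21 x ** A) \<longlongrightarrow> 0) at_top" by simp_all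
  have "((\<lambda>x. W11 x ** A + (ex' x * ex' x) *\<^sub>C (W12 x ** B)) \<longlongrightarrow> mat 1 ** A + 0) at_top"
    by (intro tendsto_add tendsto_matrix_mult tendsto_const W_limits tendsto_unimodular_mult 0)
       (simp add: norm_mult)
  then have 1: "((\<lambda>x. W11 x ** A + (ex' x * ex' x) *\<^sub>C (W12 x ** B)) \<longlongrightarrow> A) at_top"
    by simp
  show "((\<lambda>x. ex' x *\<^sub>C upper (u x)) \<longlongrightarrow> A) at_top"
  proof (rule Lim_transform_eventually[OF 1])
    show "eventually (\<lambda>x. W11 x ** A + (ex' x * ex' x) *\<^sub>C (W12 x ** B) = ex' x *\<^sub>C upper (u x)) at_top"
      using eventually_D
      by eventually_elim (simp only: u Phi_vcat upper_vcat cscale_add_right cscale_cscale ex_inverse cscale_one)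
  qed
  have "((\<lambda>x. (ex x * ex x) *\<^sub>C (W21 x ** A) + W22 x ** B) \<longlongrightarrow> 0 + W22_limit ** B) at_top"
    by (intro tendsto_add tendsto_matrix_mult tendsto_const W_limits tendsto_unimodular_mult 0)
       (simp add: norm_mult)
  then have 2: "((\<lambda>x. (ex x * ex x) *\<^sub>C (W21 x ** A) + W22 x ** B) \<longlongrightarrow> W22_limit ** B) at_top"
    by simp
  show "((\<lambda>x. ex x *\<^sub>C lower (u x)) \<longlongrightarrow> W22_limit ** B) at_top"
  proof (rule Lim_transform_eventually[OF 2])
    show "eventually (\<lambda>x. (ex x * ex x) *\<^sub>C (W21 x ** A) + W22 x ** B = ex x *\<^sub>C lower (u x)) at_top"
      using eventually_D
      by eventually_elim (simp only: u Phi_vcat lower_vcat cscale_add_right cscale_cscale ex_inverse cscale_one)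
  qed
qed

text \<open>The Riccati equation for \<open>\<kappa>\<^sub>R\<close> between the two resolvents.\<close>

lemma kappa_resolvent: "adj R ** kap - kap ** R = \<i> *\<^sub>C (adj R ** (kap ** (\<gamma> ** (adj \<gamma> ** (kap ** R)))))"
proof -
  have "adj R ** ((kap ** \<alpha> - adj \<alpha> ** kap) ** R) = adj R ** (kap ** (\<alpha> ** R)) - (adj R ** adj \<alpha>) ** (kap ** R)"
    by (simp add: mult_diff_matrix matrix_mul_assoc)
  also have "\<dots> = kap ** R - adj R ** kap"
    unfolding alpha_R adj_R_alpha by (simp add: matrix_algebra)
  finally have "kap ** R - adj R ** kap = - (\<i> *\<^sub>C (adj R ** (kap ** (\<gamma> ** (adj \<gamma> ** (kap ** R))))))"
    unfolding kappa_identity by (simp add: matrix_mul_assoc)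
  then show ?thesis by (metis minus_diff_eq minus_minus)
qed

definition W22_limit_inv :: "complex^'m2^'m2" where
  "W22_limit_inv = mat 1 + \<i> *\<^sub>C (adj \<gamma> ** (adj R ** (kap ** \<gamma>)))"

lemma W22_limit_inverse: "W22_limit_inv ** W22_limit = mat 1"
proof -
  define a where "a = adj \<gamma> ** (adj R ** (kap ** \<gamma>))"
  define b where "b = adj \<gamma> ** (kap ** (R ** \<gamma>))"
  have "adj \<gamma> ** ((adj R ** kap - kap ** R) ** \<gamma>)
      = adj \<gamma> ** ((\<i> *\<^sub>C (adj R ** (kap ** (\<gamma> ** (adj \<gamma> ** (kap ** R)))))) ** \<gamma>)"
    unfolding kappa_resolvent ..
  then have "a - b = \<i> *\<^sub>C (a ** b)"
    by (simp add: a_def b_def mult_diff_matrix matrix_mul_assoc)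
  moreover have "(mat 1 + \<i> *\<^sub>C a) ** (mat 1 - \<i> *\<^sub>C b) = mat 1 + \<i> *\<^sub>C (a - b - \<i> *\<^sub>C (a ** b))"
    by (simp add: matrix_algebra cscale_minus_left)
  ultimately show ?thesis
    unfolding W22_limit_inv_def W22_limit_def a_def [symmetric] b_def [symmetric] by simp
qed

lemma solution_Y_exists: "solution_Y D v \<mu> (\<lambda>x. Phi x ** vcat (mat 1) 0)"
  unfolding solution_Y_def
proof (intro conjI dirac_solution_Phi)
  let ?Y = "\<lambda>x. Phi x ** vcat (mat 1 :: complex^'m1^'m1) 0"
  have "((\<lambda>x. W11 x - mat 1) \<longlongrightarrow> mat 1 - mat 1) at_top"
    by (intro tendsto_intros W_limits)
  then have "((\<lambda>x. vcat (W11 x - mat 1) (W21 x)) \<longlongrightarrow> 0) at_top"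
    using W_limits(3) by (intro tendsto_vcat_zero) simp_all
  then have lim: "((\<lambda>x. ex x *\<^sub>C vcat (W11 x - mat 1) (W21 x)) \<longlongrightarrow> 0) at_top"
    by (rule tendsto_unimodular_mult) simp
  show "((\<lambda>x. ?Y x - ex x *\<^sub>C vcat (mat 1) 0) \<longlongrightarrow> 0) at_top"
    by (rule Lim_transform_eventually[OF lim])
       (use eventually_D in \<open>auto elim!: eventually_mono simp: Phi_vcat cscale_vcat vcat_diff cscale_diff_right\<close>)
qed

text \<open>Write \<open>Y = \<Phi> [A; B]\<close>. The normalisation at infinity gives \<open>A = 1\<close> from the upper block, and
  \<open>W22_limit B = 0\<close> from the lower one, where \<open>W22_limit\<close> is invertible.\<close>

lemma solution_Y_unique:
  assumes "solution_Y D v \<mu> Y" "x \<in> D"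
  shows "Y x = Phi x ** vcat (mat 1) 0"
proof -
  obtain C where C: "\<And>x. x \<in> D \<Longrightarrow> Y x = Phi x ** C"
    using dirac_solution_eq_Phi[of Y] assms(1) unfolding solution_Y_def by blast
  define A where "A = upper C"
  define B where "B = lower C"
  have Y: "Y x = Phi x ** vcat A B" if "x \<in> D" for x
    using C[OF that] by (simp add: A_def B_def)
  let ?d = "\<lambda>x. Y x - ex x *\<^sub>C vcat (mat 1) 0"
  have d: "(?d \<longlongrightarrow> 0) at_top" using assms(1) by (simp add: solution_Y_def)
  have up: "((\<lambda>x. upper (ex' x *\<^sub>C ?d x)) \<longlongrightarrow> upper (0 :: complex^'m1^('m1 + 'm2))) at_top"
    by (intro tendsto_upper tendsto_unimodular_mult d) simp
  have "upper (ex' x *\<^sub>C ?d x) = ex' x *\<^sub>C upper (Y x) - mat 1" for x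
  proof -
    have "upper (ex' x *\<^sub>C ?d x) = ex' x *\<^sub>C upper (Y x) - (ex' x * ex x) *\<^sub>C mat 1"
      by (simp add: vec_eq_iff right_diff_distrib mult.assoc)
    then show ?thesis by (simp only: ex_inverse cscale_one)
  qed
  with up have "((\<lambda>x. ex' x *\<^sub>C upper (Y x) - mat 1) \<longlongrightarrow> upper (0 :: complex^'m1^('m1 + 'm2))) at_top" by (simp only:)
  moreover have "((\<lambda>x. ex' x *\<^sub>C upper (Y x) - mat 1) \<longlongrightarrow> A - mat 1) at_top"
    by (intro tendsto_diff tendsto_const solution_limits(1)[OF Y])
  ultimately have "A - mat 1 = upper (0 :: complex^'m1^('m1 + 'm2))"
    by (intro tendsto_unique[OF trivial_limit_at_top_linorder])
  then have A: "A = mat 1" by (simp add: vec_eq_iff)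
  have "((\<lambda>x. lower (ex x *\<^sub>C ?d x)) \<longlongrightarrow> lower (0 :: complex^'m1^('m1 + 'm2))) at_top"
    by (intro tendsto_lower tendsto_unimodular_mult d) simp
  moreover have "lower (ex x *\<^sub>C ?d x) = ex x *\<^sub>C lower (Y x)" for x
    by (simp add: vec_eq_iff)
  ultimately have "((\<lambda>x. ex x *\<^sub>C lower (Y x)) \<longlongrightarrow> lower (0 :: complex^'m1^('m1 + 'm2))) at_top" by (simp only:)
  moreover have "((\<lambda>x. ex x *\<^sub>C lower (Y x)) \<longlongrightarrow> W22_limit ** B) at_top"
    by (rule solution_limits(2)[OF Y])
  ultimately have "W22_limit ** B = lower (0 :: complex^'m1^('m1 + 'm2))"
    by (intro tendsto_unique[OF trivial_limit_at_top_linorder])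
  then have "W22_limit ** B = 0" by (simp add: vec_eq_iff)
  then have "(W22_limit_inv ** W22_limit) ** B = 0" by (simp add: matrix_mul_assoc [symmetric])
  then have "B = 0" by (simp add: W22_limit_inverse)
  with A Y[OF assms(2)] show ?thesis by simp
qed

definition Z_upper :: "complex^'m2^'m1" where
  "Z_upper = - (\<i> *\<^sub>C (adj \<gamma>\<^sub>1 ** (adj R ** (S0i ** \<gamma>))))"
definition Z_lower :: "complex^'m2^'m2" where
  "Z_lower = mat 1 + \<i> *\<^sub>C (adj \<gamma> ** (adj R ** (S0i ** \<gamma>)))"

lemma Phi_0: "Phi 0 = w 0"
  by (simp add: Phi_def)

lemma Lam_0: "Lam 0 = hcat \<gamma>\<^sub>1 \<gamma>"
  by (simp add: Lam_eq)

text \<open>The matrix \<open>j \<Phi>(0)\<^sup>* j\<close> is the inverse of \<open>\<Phi>(0)\<close>, so this is the coefficient vector of the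
  solution with initial value \<open>[0; 1]\<close>.\<close>

lemma initial_Z: "j_mat ** (adj (Phi 0) ** (j_mat ** vcat 0 (mat 1))) = vcat Z_upper Z_lower"
proof -
  have L: "Lam 0 ** (j_mat ** (j_mat ** vcat 0 (mat 1))) = \<gamma>"
    unfolding j_mat_cancel Lam_0 hcat_mult_vcat by simp
  have "adj (Phi 0) ** (j_mat ** vcat 0 (mat 1)) = j_mat ** vcat 0 (mat 1)
      - \<i> *\<^sub>C (adj (Lam 0) ** (adj R ** (S0i ** \<gamma>)))"
    unfolding Phi_0 adj_w[OF zero_in_D] w_adj_def Sinv_0
    by (simp add: matrix_algebra L)
  then have "j_mat ** (adj (Phi 0) ** (j_mat ** vcat 0 (mat 1))) = vcat 0 (mat 1)
      - \<i> *\<^sub>C (j_mat ** (adj (Lam 0) ** (adj R ** (S0i ** \<gamma>))))"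
    by (simp add: matrix_algebra j_mat_cancel)
  also have "\<dots> = vcat Z_upper Z_lower"
    unfolding Lam_0 adj_hcat vcat_mult j_mat_vcat cscale_vcat vcat_diff Z_upper_def Z_lower_def
    by (simp add: cscale_minus_left)
  finally show ?thesis .
qed

lemma solution_Z_exists: "solution_Z D v \<mu> (\<lambda>x. Phi x ** vcat Z_upper Z_lower)"
proof -
  have "Phi 0 ** vcat Z_upper Z_lower = (Phi 0 ** (j_mat ** (adj (Phi 0) ** j_mat))) ** vcat 0 (mat 1)"
    unfolding initial_Z [symmetric] by (simp add: matrix_mul_assoc)
  then show ?thesis
    unfolding solution_Z_def using dirac_solution_Phi
    by (simp add: Phi_j_unitary(2)[OF zero_in_D])
qed

lemma solution_Z_unique:
  assumes "solution_Z D v \<mu> Z" "x \<in> D"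
  shows "Z x = Phi x ** vcat Z_upper Z_lower"
proof -
  obtain C where C: "\<And>x. x \<in> D \<Longrightarrow> Z x = Phi x ** C"
    using dirac_solution_eq_Phi[of Z] assms(1) unfolding solution_Z_def by blast
  have "Phi 0 ** C = vcat 0 (mat 1)"
    using C[OF zero_in_D] assms(1) by (simp add: solution_Z_def)
  then have "j_mat ** (adj (Phi 0) ** (j_mat ** (Phi 0 ** C))) = vcat Z_upper Z_lower"
    using initial_Z by simp
  moreover have "j_mat ** (adj (Phi 0) ** (j_mat ** (Phi 0 ** C)))
      = j_mat ** ((adj (Phi 0) ** (j_mat ** Phi 0)) ** C)"
    by (simp add: matrix_mul_assoc)
  ultimately have "C = vcat Z_upper Z_lower"
    by (simp add: Phi_j_unitary(1)[OF zero_in_D] j_mat_cancel)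
  with C[OF assms(2)] show ?thesis by simp
qed

end

section \<open>Realizations of the four coefficients\<close>

locale pe_scattering = pe_spectral \<alpha> S\<^sub>0 \<gamma>\<^sub>1 \<gamma> \<mu>
  for \<alpha> S\<^sub>0 :: "complex^'n^'n" and \<gamma>\<^sub>1 :: "complex^'m1^'n" and \<gamma> :: "complex^'m2^'n" and \<mu> :: real +
  fixes \<theta> :: "complex^'n^'n"
  assumes theta: "\<theta> = \<alpha> - \<i> *\<^sub>C (\<gamma>\<^sub>1 ** adj \<gamma>\<^sub>1 ** matrix_inv S\<^sub>0)"
    and inv_theta: "invertible (mat (complex_of_real \<mu>) - \<theta>)"
begin

definition G :: "complex^'n^'n" where
  "G = matrix_inv (mat (complex_of_real \<mu>) - \<theta>)"

lemma G_inverse: "(mat (complex_of_real \<mu>) - \<theta>) ** G = mat 1" "G ** (mat (complex_of_real \<mu>) - \<theta>) = mat 1"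
  using matrix_inv_mult[OF inv_theta] by (simp_all add: G_def)

lemma R_inverse: "R ** (mat (complex_of_real \<mu>) - \<alpha>) = mat 1" "(mat (complex_of_real \<mu>) - \<alpha>) ** R = mat 1"
  using matrix_inv_mult[OF inv_alpha] by (simp_all add: R_def)

lemma adj_R_inverse: "adj R ** (mat (complex_of_real \<mu>) - adj \<alpha>) = mat 1"
    "(mat (complex_of_real \<mu>) - adj \<alpha>) ** adj R = mat 1"
  using arg_cong[OF R_inverse(2), of adj] arg_cong[OF R_inverse(1), of adj]
  by (simp_all add: adj_mult adj_diff)

lemma S0_cancel: "S\<^sub>0 ** (S0i ** X) = X" "S0i ** (S\<^sub>0 ** X) = X"
  by (simp_all add: matrix_mul_assoc S0_inv)

text \<open>The matrix \<open>\<theta>\<close> is what the inversion rule for transfer functions produces from the upper left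
  block of \<open>w 0\<close>.\<close>

lemma G_resolvent: "G + R ** (\<gamma>\<^sub>1 ** ((\<i> *\<^sub>C (adj \<gamma>\<^sub>1 ** S0i)) ** G)) = R"
proof -
  have "mat (complex_of_real \<mu>) - \<theta> - (mat (complex_of_real \<mu>) - \<alpha>) = \<i> *\<^sub>C (\<gamma>\<^sub>1 ** adj \<gamma>\<^sub>1 ** S0i)"
    by (simp add: theta)
  with resolvent_identity[OF R_inverse(1) G_inverse(1)] show ?thesis
    by (simp add: matrix_mul_assoc)
qed

definition T_left :: "complex^'m1^'m1" where
  "T_left = mat 1 - \<i> *\<^sub>C (adj \<gamma>\<^sub>1 ** (S0i ** (G ** \<gamma>\<^sub>1)))"

lemma Pinv_0: "Pinv 0 = S0i" and Mixed_0: "Mixed 0 = S0i"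
  by (simp_all add: Pinv_def Mixed_def Sinv_0)

lemma T_left_inverse: "W11 0 ** T_left = mat 1"
  using state_space_inverse[OF G_resolvent]
  by (simp add: W11_def Pinv_0 T_left_def matrix_mul_assoc)

lemma R_left_formula: "W21 0 ** T_left = - (\<i> *\<^sub>C (adj \<gamma> ** (S0i ** (G ** \<gamma>\<^sub>1))))"
proof -
  define a where "a = adj \<gamma> ** (S0i ** (R ** \<gamma>\<^sub>1))"
  define b where "b = a ** (adj \<gamma>\<^sub>1 ** (S0i ** (G ** \<gamma>\<^sub>1)))"
  have "R - R ** (\<gamma>\<^sub>1 ** ((\<i> *\<^sub>C (adj \<gamma>\<^sub>1 ** S0i)) ** G)) = G"
    by (simp only: diff_eq_eq G_resolvent)
  then have "adj \<gamma> ** (S0i ** ((R - R ** (\<gamma>\<^sub>1 ** ((\<i> *\<^sub>C (adj \<gamma>\<^sub>1 ** S0i)) ** G))) ** \<gamma>\<^sub>1))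
      = adj \<gamma> ** (S0i ** (G ** \<gamma>\<^sub>1))" by (simp only:)
  then have "a - \<i> *\<^sub>C b = adj \<gamma> ** (S0i ** (G ** \<gamma>\<^sub>1))"
    by (simp add: a_def b_def mult_diff_matrix matrix_mul_assoc)
  moreover have "W21 0 ** T_left = - (\<i> *\<^sub>C (a - \<i> *\<^sub>C b))"
    by (simp add: W21_def Mixed_0 T_left_def a_def [symmetric] b_def mult_diff_matrix cscale_diff_right
        cscale_minus_left)
  ultimately show ?thesis by simp
qed

text \<open>Similarity with \<open>S\<^sub>0\<close> carries \<open>\<theta>\<close> into \<open>\<alpha>\<^sup>* - \<i> S\<^sub>0\<^sup>-\<^sup>1 \<gamma> \<gamma>\<^sup>*\<close>, because of the identity for \<open>S\<^sub>0\<close>.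
  Resolvents of \<open>\<theta>\<close> thereby become comparable with the adjoint of \<open>R\<close>, which occurs in the
  coefficients of \<open>Z\<close>.\<close>

definition G_conj :: "complex^'n^'n" where
  "G_conj = S0i ** (G ** S\<^sub>0)"

definition pencil_conj :: "complex^'n^'n" where
  "pencil_conj = S0i ** ((mat (complex_of_real \<mu>) - \<theta>) ** S\<^sub>0)"

lemma pencil_conj_G_conj: "pencil_conj ** G_conj = mat 1" and G_conj_pencil_conj: "G_conj ** pencil_conj = mat 1"
proof -
  have "pencil_conj ** G_conj = S0i ** (((mat (complex_of_real \<mu>) - \<theta>) ** G) ** S\<^sub>0)"
    by (simp only: pencil_conj_def G_conj_def matrix_mul_assoc [symmetric] S0_cancel)
  then show "pencil_conj ** G_conj = mat 1" by (simp add: G_inverse S0_inv)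
  then show "G_conj ** pencil_conj = mat 1" by (rule right_inverse_imp_left_inverse)
qed

lemma pencil_conj_eq: "pencil_conj = mat (complex_of_real \<mu>) - adj \<alpha> + \<i> *\<^sub>C (S0i ** (\<gamma> ** adj \<gamma>))"
proof -
  have "\<alpha> ** S\<^sub>0 = S\<^sub>0 ** adj \<alpha> + \<i> *\<^sub>C (\<gamma>\<^sub>1 ** adj \<gamma>\<^sub>1 - \<gamma> ** adj \<gamma>)"
    using S0_identity by (simp add: algebra_simps)
  then have "\<theta> ** S\<^sub>0 = S\<^sub>0 ** adj \<alpha> - \<i> *\<^sub>C (\<gamma> ** adj \<gamma>)"
    by (simp add: theta mult_diff_matrix matrix_mul_assoc [symmetric] S0_inv cscale_diff_right)
  then have "S0i ** (\<theta> ** S\<^sub>0) = adj \<alpha> - \<i> *\<^sub>C (S0i ** (\<gamma> ** adj \<gamma>))"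
    by (simp add: mult_diff_matrix S0_cancel)
  moreover have "S0i ** (mat (complex_of_real \<mu>) ** S\<^sub>0) = mat (complex_of_real \<mu>)"
    unfolding mat_eq_cscale[of "complex_of_real \<mu>"] by (simp add: S0_inv)
  ultimately show ?thesis
    by (simp add: pencil_conj_def mult_diff_matrix)
qed

lemma G_conj_resolvent_left: "G_conj + adj R ** ((S0i ** \<gamma>) ** ((\<i> *\<^sub>C adj \<gamma>) ** G_conj)) = adj R"
  using resolvent_identity[OF adj_R_inverse(1) pencil_conj_G_conj]
  by (simp add: pencil_conj_eq matrix_mul_assoc)

lemma G_conj_resolvent_right: "adj R - \<i> *\<^sub>C (S0i ** (G ** (\<gamma> ** (adj \<gamma> ** adj R)))) = G_conj"
proof -
  have "mat (complex_of_real \<mu>) - adj \<alpha> - pencil_conj = - (\<i> *\<^sub>C (S0i ** (\<gamma> ** adj \<gamma>)))"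
    by (simp add: pencil_conj_eq)
  moreover have "G_conj ** (S0i ** X) = S0i ** (G ** X)" for X :: "complex^'n^'n"
    by (simp add: G_conj_def matrix_mul_assoc [symmetric] S0_cancel)
  ultimately show ?thesis
    using resolvent_identity[OF G_conj_pencil_conj adj_R_inverse(2)]
    by (simp add: matrix_mul_assoc [symmetric])
qed

definition res_gamma :: "complex^'m2^'n" where
  "res_gamma = S0i ** (G ** \<gamma>)"
definition adj_res_gamma :: "complex^'m2^'n" where
  "adj_res_gamma = adj R ** (kap ** \<gamma>)"
definition kappa_res_gamma :: "complex^'m2^'n" where
  "kappa_res_gamma = S0i ** (G ** (S\<^sub>0 ** (kap ** \<gamma>)))"

lemma G_conj_gamma: "G_conj ** (S0i ** \<gamma>) = res_gamma"
  by (simp add: G_conj_def res_gamma_def matrix_mul_assoc [symmetric] S0_cancel)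

text \<open>Multiplying two realizations produces this product; replacing it by a difference is what merges
  them into a single realization.\<close>

lemma res_gamma_product: "\<i> *\<^sub>C (res_gamma ** (adj \<gamma> ** adj_res_gamma)) = adj_res_gamma - kappa_res_gamma"
proof -
  have "(adj R - \<i> *\<^sub>C (S0i ** (G ** (\<gamma> ** (adj \<gamma> ** adj R))))) ** (kap ** \<gamma>) = G_conj ** (kap ** \<gamma>)"
    unfolding G_conj_resolvent_right ..
  then have "adj_res_gamma - \<i> *\<^sub>C (res_gamma ** (adj \<gamma> ** adj_res_gamma)) = kappa_res_gamma"
    by (simp add: res_gamma_def adj_res_gamma_def kappa_res_gamma_def G_conj_def mult_diff_matrix matrix_mul_assoc)
  then show ?thesis by (simp add: algebra_simps)
qed

lemma res_gamma_product': "res_gamma ** (adj \<gamma> ** adj_res_gamma) = - (\<i> *\<^sub>C (adj_res_gamma - kappa_res_gamma))"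
proof -
  have "(- \<i>) *\<^sub>C (\<i> *\<^sub>C (res_gamma ** (adj \<gamma> ** adj_res_gamma))) = (- \<i>) *\<^sub>C (adj_res_gamma - kappa_res_gamma)" unfolding res_gamma_product ..
  then show ?thesis by (simp add: cscale_minus_left)
qed

definition Z_lower_inv :: "complex^'m2^'m2" where
  "Z_lower_inv = mat 1 - \<i> *\<^sub>C (adj \<gamma> ** res_gamma)"

lemma Z_lower_inverse: "Z_lower_inv ** Z_lower = mat 1"
proof (rule right_inverse_imp_left_inverse)
  show "Z_lower ** Z_lower_inv = mat 1"
    using state_space_inverse[OF G_conj_resolvent_left] by (simp add: Z_lower_def Z_lower_inv_def G_conj_gamma)
qed

lemma Z_upper_Z_lower_inv: "Z_upper ** Z_lower_inv = - (\<i> *\<^sub>C (adj \<gamma>\<^sub>1 ** res_gamma))"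
proof -
  have "(G_conj + adj R ** ((S0i ** \<gamma>) ** ((\<i> *\<^sub>C adj \<gamma>) ** G_conj))) ** (S0i ** \<gamma>) = adj R ** (S0i ** \<gamma>)"
    unfolding G_conj_resolvent_left ..
  then have "res_gamma + \<i> *\<^sub>C (adj R ** (S0i ** (\<gamma> ** (adj \<gamma> ** res_gamma)))) = adj R ** (S0i ** \<gamma>)"
    by (simp add: matrix_add_rdistrib matrix_mul_assoc [symmetric] G_conj_gamma)
  then have eq: "adj R ** (S0i ** \<gamma>) - \<i> *\<^sub>C (adj R ** (S0i ** (\<gamma> ** (adj \<gamma> ** res_gamma)))) = res_gamma"
    by (simp add: algebra_simps)
  have "(adj R ** (S0i ** \<gamma>)) ** Z_lower_inv
      = adj R ** (S0i ** \<gamma>) - \<i> *\<^sub>C (adj R ** (S0i ** (\<gamma> ** (adj \<gamma> ** res_gamma))))"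
    by (simp add: Z_lower_inv_def mult_diff_matrix matrix_mul_assoc)
  then have "(adj R ** (S0i ** \<gamma>)) ** Z_lower_inv = res_gamma" unfolding eq .
  moreover have "Z_upper ** Z_lower_inv = - (\<i> *\<^sub>C (adj \<gamma>\<^sub>1 ** ((adj R ** (S0i ** \<gamma>)) ** Z_lower_inv)))"
    by (simp add: Z_upper_def matrix_mul_assoc)
  ultimately show ?thesis by simp
qed

definition T_right :: "complex^'m2^'m2" where
  "T_right = mat 1 - \<i> *\<^sub>C (adj \<gamma> ** (res_gamma - kappa_res_gamma))"

text \<open>The two factors are the inverses of \<open>Z_lower\<close> and of \<open>W22_limit\<close>, whose product the right
  transmission coefficient inverts.\<close>

lemma T_right_factor: "Z_lower_inv ** W22_limit_inv = T_right"
proof -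
  have "Z_lower_inv ** W22_limit_inv = mat 1 + \<i> *\<^sub>C (adj \<gamma> ** adj_res_gamma) - \<i> *\<^sub>C (adj \<gamma> ** res_gamma)
      + adj \<gamma> ** (res_gamma ** (adj \<gamma> ** adj_res_gamma))"
    by (simp add: Z_lower_inv_def W22_limit_inv_def adj_res_gamma_def [symmetric] matrix_algebra cscale_minus_left)
  also have "\<dots> = T_right"
    unfolding res_gamma_product' T_right_def by (simp add: matrix_algebra)
  finally show ?thesis .
qed

lemma T_right_inverse: "(W22_limit ** Z_lower) ** T_right = mat 1"
proof (rule right_inverse_imp_left_inverse)
  have "T_right ** (W22_limit ** Z_lower) = Z_lower_inv ** ((W22_limit_inv ** W22_limit) ** Z_lower)"
    by (simp only: T_right_factor [symmetric] matrix_mul_assoc)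
  then show "T_right ** (W22_limit ** Z_lower) = mat 1"
    by (simp add: W22_limit_inverse Z_lower_inverse)
qed

lemma R_right_formula: "Z_upper ** T_right = - (\<i> *\<^sub>C (adj \<gamma>\<^sub>1 ** (res_gamma - kappa_res_gamma))) - \<i> *\<^sub>C (adj \<gamma>\<^sub>1 ** adj_res_gamma)"
proof -
  have "Z_upper ** T_right = - (\<i> *\<^sub>C (adj \<gamma>\<^sub>1 ** res_gamma)) ** W22_limit_inv"
    by (simp only: T_right_factor [symmetric] matrix_mul_assoc Z_upper_Z_lower_inv)
  also have "\<dots> = - (\<i> *\<^sub>C (adj \<gamma>\<^sub>1 ** res_gamma)) + adj \<gamma>\<^sub>1 ** (res_gamma ** (adj \<gamma> ** adj_res_gamma))"
    by (simp add: W22_limit_inv_def adj_res_gamma_def [symmetric] matrix_algebra)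
  also have "\<dots> = - (\<i> *\<^sub>C (adj \<gamma>\<^sub>1 ** (res_gamma - kappa_res_gamma))) - \<i> *\<^sub>C (adj \<gamma>\<^sub>1 ** adj_res_gamma)"
    unfolding res_gamma_product' by (simp add: matrix_algebra)
  finally show ?thesis .
qed

lemma Y_0:
  assumes "solution_Y D v \<mu> Y"
  shows "upper (Y 0) = W11 0" "lower (Y 0) = W21 0"
  using solution_Y_unique[OF assms zero_in_D] by (simp_all add: Phi_vcat[OF zero_in_D])

lemma is_T_L: "is_T_L D v \<mu> T_left"
  unfolding is_T_L_def
proof (intro conjI allI impI)
  show "\<exists>Y. solution_Y D v \<mu> Y" using solution_Y_exists by blast
  fix Y assume "solution_Y D v \<mu> Y"
  then show "invertible (upper (Y 0))" "T_left = matrix_inv (upper (Y 0))"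
    by (simp_all only: Y_0 matrix_inv_eqI[OF T_left_inverse])
qed

lemma is_R_L: "is_R_L D v \<mu> (- (\<i> *\<^sub>C (adj \<gamma> ** (S0i ** (G ** \<gamma>\<^sub>1)))))"
  unfolding is_R_L_def
proof (intro conjI allI impI)
  show "\<exists>Y. solution_Y D v \<mu> Y" using solution_Y_exists by blast
  fix Y assume "solution_Y D v \<mu> Y"
  then show "invertible (upper (Y 0))"
    "- (\<i> *\<^sub>C (adj \<gamma> ** (S0i ** (G ** \<gamma>\<^sub>1)))) = lower (Y 0) ** matrix_inv (upper (Y 0))"
    by (simp_all only: Y_0 matrix_inv_eqI[OF T_left_inverse] R_left_formula)
qed

lemma Z_limits:
  assumes "solution_Z D v \<mu> Z"
  shows "((\<lambda>x. exp (- \<i> * complex_of_real x * complex_of_real \<mu>) *\<^sub>C upper (Z x)) \<longlongrightarrow> Z_upper) at_top"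
    "((\<lambda>x. exp (\<i> * complex_of_real x * complex_of_real \<mu>) *\<^sub>C lower (Z x)) \<longlongrightarrow> W22_limit ** Z_lower) at_top"
  by (rule solution_limits[OF solution_Z_unique[OF assms]], assumption)+

lemma is_T_R: "is_T_R D v \<mu> T_right"
  unfolding is_T_R_def
proof (intro conjI allI impI)
  show "\<exists>Z. solution_Z D v \<mu> Z" using solution_Z_exists by blast
  fix Z assume "solution_Z D v \<mu> Z"
  then show "\<exists>B. ((\<lambda>x. exp (\<i> * complex_of_real x * complex_of_real \<mu>) *\<^sub>C lower (Z x)) \<longlongrightarrow> B) at_top \<and>
      invertible B \<and> T_right = matrix_inv B"
    by (intro exI[of _ "W22_limit ** Z_lower"] conjI Z_limits matrix_inv_eqI(2)[OF T_right_inverse]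
        matrix_inv_eqI(1)[OF T_right_inverse, symmetric])
qed

lemma is_R_R: "is_R_R D v \<mu> (- (\<i> *\<^sub>C (adj \<gamma>\<^sub>1 ** (res_gamma - kappa_res_gamma))) - \<i> *\<^sub>C (adj \<gamma>\<^sub>1 ** adj_res_gamma))"
  unfolding is_R_R_def
proof (intro conjI allI impI)
  show "\<exists>Z. solution_Z D v \<mu> Z" using solution_Z_exists by blast
  fix Z assume "solution_Z D v \<mu> Z"
  then show "\<exists>A B. ((\<lambda>x. exp (- \<i> * complex_of_real x * complex_of_real \<mu>) *\<^sub>C upper (Z x)) \<longlongrightarrow> A) at_top \<and>
      ((\<lambda>x. exp (\<i> * complex_of_real x * complex_of_real \<mu>) *\<^sub>C lower (Z x)) \<longlongrightarrow> B) at_top \<and>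
      invertible B \<and> - (\<i> *\<^sub>C (adj \<gamma>\<^sub>1 ** (res_gamma - kappa_res_gamma))) - \<i> *\<^sub>C (adj \<gamma>\<^sub>1 ** adj_res_gamma) = A ** matrix_inv B"
    unfolding R_right_formula [symmetric]
    by (intro exI[of _ Z_upper] exI[of _ "W22_limit ** Z_lower"] conjI Z_limits matrix_inv_eqI(2)[OF T_right_inverse])
       (simp_all only: matrix_inv_eqI(1)[OF T_right_inverse])
qed

lemma adj_R_eq: "adj R = matrix_inv (mat (complex_of_real \<mu>) - adj \<alpha>)"
  using matrix_inv_eqI(1)[OF adj_R_inverse(2)] by simp

end

section \<open>Exceptional values of the spectral parameter\<close>

text \<open>The determinant is a polynomial in \<open>z\<close>; it is not the zero polynomial because \<open>mat z - A\<close> is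
  invertible as soon as \<open>z\<close> exceeds a bound for the operator norm of \<open>A\<close>.\<close>

lemma finite_characteristic_roots:
  fixes A :: "complex^'n^'n"
  shows "finite {z. det (mat z - A) = 0}"
proof -
  define q where "q = (\<Sum>p | p permutes (UNIV :: 'n set). of_int (sign p) *
      (\<Prod>i\<in>UNIV. [: - A $ i $ p i, if i = p i then 1 else 0 :]))"
  have q: "poly q z = det (mat z - A)" for z
    unfolding q_def det_def poly_sum poly_mult poly_prod poly_of_int
    by (intro sum.cong refl arg_cong2[where f = "(*)"] prod.cong) (simp_all add: mat_def)
  have "q \<noteq> 0"
  proof
    assume "q = 0"
    obtain B where B: "\<And>y. norm (A *v y) \<le> B * norm y"
      using bounded_linear.bounded[OF bounded_bilinear.bounded_linear_right
          [OF bounded_bilinear_matrix_vector_mult], of A] by (auto simp: mult.commute)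
    let ?z = "complex_of_real (\<bar>B\<bar> + 1)"
    have "det (mat ?z - A) = 0" using q[of ?z] \<open>q = 0\<close> by simp
    then have "\<nexists>C. C ** (mat ?z - A) = mat 1"
      using invertible_det_nz invertible_left_inverse by metis
    then obtain y where y: "(mat ?z - A) *v y = 0" "y \<noteq> 0"
      by (auto simp: matrix_left_invertible_ker)
    have "mat ?z *v y = ?z *s y"
      by (subst mat_eq_cscale) (simp add: cscale_vector)
    with y(1) have "A *v y = ?z *s y" by (simp add: matrix_vector_mult_diff_rdistrib)
    then have "norm (A *v y) = (\<bar>B\<bar> + 1) * norm y"
      by (simp only: norm_cscale_vector norm_of_real abs_abs)
    with B[of y] have "(\<bar>B\<bar> + 1) * norm y \<le> B * norm y" by simp
    with y(2) show False by simp
  qed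
  then show ?thesis using poly_roots_finite[of q] by (simp add: q)
qed

lemma finite_real_characteristic_roots:
  fixes A :: "complex^'n^'n"
  shows "finite {\<mu> :: real. \<not> invertible (mat (complex_of_real \<mu>) - A)}"
  using finite_vimageI[OF finite_characteristic_roots[of A] inj_of_real]
  by (simp add: vimage_def invertible_det_nz)

theorem theorem3p3:
  fixes \<alpha> S\<^sub>0 \<theta> \<kappa> :: "complex^'n^'n"
    and \<gamma>\<^sub>1 :: "complex^'m1^'n" and \<gamma> :: "complex^'m2^'n"
    and v :: "real \<Rightarrow> complex^'m2^'m1" and D :: "real set"
  assumes "admissible \<alpha> S\<^sub>0 \<gamma>\<^sub>1 \<gamma>"
    and "det S\<^sub>0 \<noteq> 0"
    and "v = pe_potential \<alpha> S\<^sub>0 \<gamma>\<^sub>1 \<gamma>"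
    and "D = pe_domain \<alpha> S\<^sub>0 \<gamma>\<^sub>1 \<gamma>"
    and "\<theta> = \<alpha> - \<i> *\<^sub>C (\<gamma>\<^sub>1 ** adj \<gamma>\<^sub>1 ** matrix_inv S\<^sub>0)"
    and "\<kappa> = kappa_R \<alpha> S\<^sub>0 \<gamma>\<^sub>1 \<gamma>"
  shows "\<exists>E :: real set. finite E \<and> (\<forall>\<mu>. \<mu> \<notin> E \<longrightarrow>
      is_T_L D v \<mu>
        (mat 1 - \<i> *\<^sub>C (adj \<gamma>\<^sub>1 ** matrix_inv S\<^sub>0 ** matrix_inv (mat (complex_of_real \<mu>) - \<theta>) ** \<gamma>\<^sub>1)) \<and>
      is_R_L D v \<mu>
        (- (\<i> *\<^sub>C (adj \<gamma> ** matrix_inv S\<^sub>0 ** matrix_inv (mat (complex_of_real \<mu>) - \<theta>) ** \<gamma>\<^sub>1))) \<and>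
      is_T_R D v \<mu>
        (mat 1 - \<i> *\<^sub>C (adj \<gamma> ** matrix_inv S\<^sub>0 ** matrix_inv (mat (complex_of_real \<mu>) - \<theta>)
          ** (mat 1 - S\<^sub>0 ** \<kappa>) ** \<gamma>)) \<and>
      is_R_R D v \<mu>
        (- (\<i> *\<^sub>C (adj \<gamma>\<^sub>1 ** matrix_inv S\<^sub>0 ** matrix_inv (mat (complex_of_real \<mu>) - \<theta>)
          ** (mat 1 - S\<^sub>0 ** \<kappa>) ** \<gamma>))
         - \<i> *\<^sub>C (adj \<gamma>\<^sub>1 ** matrix_inv (mat (complex_of_real \<mu>) - adj \<alpha>) ** \<kappa> ** \<gamma>)))"
proof (intro exI conjI allI impI)
  let ?E = "{\<mu> :: real. \<not> invertible (mat (complex_of_real \<mu>) - \<alpha>)}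
    \<union> {\<mu> :: real. \<not> invertible (mat (complex_of_real \<mu>) - \<theta>)}"
  show "finite ?E" by (simp add: finite_real_characteristic_roots)
  fix \<mu> assume "\<mu> \<notin> ?E"
  then interpret pe_scattering \<alpha> S\<^sub>0 \<gamma>\<^sub>1 \<gamma> \<mu> \<theta>
    using assms by unfold_locales auto
  have gn: "S0i ** (G ** ((mat 1 - S\<^sub>0 ** \<kappa>) ** \<gamma>)) = res_gamma - kappa_res_gamma"
    unfolding assms(6) res_gamma_def kappa_res_gamma_def by (simp add: matrix_algebra)
  have k: "matrix_inv (mat (complex_of_real \<mu>) - adj \<alpha>) ** (\<kappa> ** \<gamma>) = adj_res_gamma"
    unfolding assms(6) adj_res_gamma_def adj_R_eq ..
  note normalize = assms(3,4) G_def [symmetric] matrix_mul_assoc [symmetric]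
  show "is_T_L D v \<mu>
      (mat 1 - \<i> *\<^sub>C (adj \<gamma>\<^sub>1 ** matrix_inv S\<^sub>0 ** matrix_inv (mat (complex_of_real \<mu>) - \<theta>) ** \<gamma>\<^sub>1))"
    using is_T_L unfolding normalize T_left_def .
  show "is_R_L D v \<mu>
      (- (\<i> *\<^sub>C (adj \<gamma> ** matrix_inv S\<^sub>0 ** matrix_inv (mat (complex_of_real \<mu>) - \<theta>) ** \<gamma>\<^sub>1)))"
    using is_R_L unfolding normalize .
  show "is_T_R D v \<mu>
      (mat 1 - \<i> *\<^sub>C (adj \<gamma> ** matrix_inv S\<^sub>0 ** matrix_inv (mat (complex_of_real \<mu>) - \<theta>)
        ** (mat 1 - S\<^sub>0 ** \<kappa>) ** \<gamma>))"
    using is_T_R unfolding normalize gn T_right_def .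
  show "is_R_R D v \<mu>
      (- (\<i> *\<^sub>C (adj \<gamma>\<^sub>1 ** matrix_inv S\<^sub>0 ** matrix_inv (mat (complex_of_real \<mu>) - \<theta>)
        ** (mat 1 - S\<^sub>0 ** \<kappa>) ** \<gamma>))
       - \<i> *\<^sub>C (adj \<gamma>\<^sub>1 ** matrix_inv (mat (complex_of_real \<mu>) - adj \<alpha>) ** \<kappa> ** \<gamma>))"
    using is_R_R unfolding normalize gn k .
qed

end
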